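(* Let $\mathcal{G}$ be the set of all (topologically sorted) directed acyclic graphs $G$ on $\{1,\dots,K\}$ for which $\mathrm{pa}(k)$ is fully connected for every $k$. For every $n\ge 1$ there exists an estimator $\hat\mu^{\mathcal{A},ad}$, depending only on the data $X^1,\dots,X^n$ and on $(d_k)_{k=1}^K$, such that for every $G\in\mathcal{G}$, every $L$, and every $\mu\in\mathcal{P}_G$ satisfying $$\mathcal{W}\big(\mu(dx_k\mid x_{\mathrm{pa}(k)}),\mu(dx_k\mid\tilde x_{\mathrm{pa}(k)})\big)\le L\|x_{\mathrm{pa}(k)}-\tilde x_{\mathrm{pa}(k)}\|\quad\text{for all }2\le k\le K,\ x_{\mathrm{pa}(k)},\tilde x_{\mathrm{pa}(k)}\in\mathcal{X}_{\mathrm{pa}(k)},$$ one has, for $X^1,\dots,X^n$ i.i.d. with law $\mu$, $$\mathbb{E}\left[\mathcal{W}(\mu,\hat\mu^{\mathcal{A},ad})\right]\le C\cdot\max\{1,\log(n)\}\cdot n^{-1/d_{\rm loc}(G)},$$ where $C$ is a constant depending only on $L$, $K$ and $(d_k)_{k=1}^K$.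
   Context: Setting: directed acyclic graphs $G$ on nodes $\{1,\dots,K\}$ are topologically sorted (every edge $i\to j$ has $i<j$); $\mathrm{pa}(k)$ is the set of parents of $k$ in $G$. A set $J$ of nodes is fully connected if there is an edge $k\to\ell$ for all $k,\ell\in J$ with $k<\ell$. $\mathcal{X}=[0,1]^d=\mathcal{X}_1\times\dots\times\mathcal{X}_K$, $\mathcal{X}_k=[0,1]^{d_k}$, $\mathcal{X}_I=\prod_{i\in I}\mathcal{X}_i$. $\|\cdot\|$ is the sup-norm, $\mathcal{W}$ the first-order Wasserstein distance w.r.t. it. $\mathcal{P}_G$ is the set of Borel probability measures $\mu$ on $\mathcal{X}$ with $\mu(dx)=\prod_{k=1}^K\mu(dx_k\mid x_{\mathrm{pa}(k)})$ (regular conditional distributions; the marginal if $\mathrm{pa}(k)=\emptyset$). Lipschitz conditions on kernels mean that versions satisfying them exist; they are void if $\mathrm{pa}(k)=\emptyset$. $d_{\rm loc}(G)=\max_k(\max\{2,d_k\}+\sum_{\ell\in\mathrm{pa}(k)}d_\ell)$. An estimator is a measurable map $\mathcal{X}^n\to\mathcal{P}(\mathcal{X})$. *)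

theory Defs
  imports "HOL-Probability.Probability"
begin

(* A point x of the product space is a function with x k j the j-th coordinate (j < d k) of
   its k-th block.  The product sigma-algebras below are the Borel ones, as all index sets are
   finite. *)

definition cube :: "nat \<Rightarrow> (nat \<Rightarrow> real) measure" where
  "cube m = (\<Pi>\<^sub>M j\<in>{..<m}. restrict_space borel {0..1})"

definition blocks :: "(nat \<Rightarrow> nat) \<Rightarrow> nat set \<Rightarrow> (nat \<Rightarrow> nat \<Rightarrow> real) measure" where
  "blocks d I = (\<Pi>\<^sub>M k\<in>I. cube (d k))"

(* Inserting 0 fixes the value on an empty index set and is harmless otherwise. *)

definition cube_dist :: "nat \<Rightarrow> (nat \<Rightarrow> real) \<Rightarrow> (nat \<Rightarrow> real) \<Rightarrow> real" where
  "cube_dist m x y = Max (insert 0 ((\<lambda>j. \<bar>x j - y j\<bar>) ` {..<m}))"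

definition blocks_dist ::
    "(nat \<Rightarrow> nat) \<Rightarrow> nat set \<Rightarrow> (nat \<Rightarrow> nat \<Rightarrow> real) \<Rightarrow> (nat \<Rightarrow> nat \<Rightarrow> real) \<Rightarrow> real" where
  "blocks_dist d I x y = Max (insert 0 ((\<lambda>k. cube_dist (d k) (x k) (y k)) ` I))"

definition couplings :: "'a measure \<Rightarrow> 'a measure \<Rightarrow> ('a \<times> 'a) measure set" where
  "couplings \<mu> \<nu> = {\<pi> \<in> space (prob_algebra (\<mu> \<Otimes>\<^sub>M \<nu>)). distr \<pi> \<mu> fst = \<mu> \<and> distr \<pi> \<nu> snd = \<nu>}"

definition wasserstein :: "('a \<Rightarrow> 'a \<Rightarrow> real) \<Rightarrow> 'a measure \<Rightarrow> 'a measure \<Rightarrow> ennreal" where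
  "wasserstein \<rho> \<mu> \<nu> = (INF \<pi>\<in>couplings \<mu> \<nu>. \<integral>\<^sup>+ (x, y). ennreal (\<rho> x y) \<partial>\<pi>)"

(* A graph is given by its edge set; (i, j) is the edge from i to j. *)

definition sorted_dag :: "nat \<Rightarrow> nat rel \<Rightarrow> bool" where
  "sorted_dag K E \<longleftrightarrow> E \<subseteq> {1..K} \<times> {1..K} \<and> acyclic E \<and> (\<forall>(i, j)\<in>E. i < j)"

definition pa :: "nat rel \<Rightarrow> nat \<Rightarrow> nat set" where
  "pa E k = {i. (i, k) \<in> E}"

definition fully_connected :: "nat rel \<Rightarrow> nat set \<Rightarrow> bool" where
  "fully_connected E J \<longleftrightarrow> (\<forall>k\<in>J. \<forall>l\<in>J. k < l \<longrightarrow> (k, l) \<in> E)"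

definition d_loc :: "(nat \<Rightarrow> nat) \<Rightarrow> nat \<Rightarrow> nat rel \<Rightarrow> nat" where
  "d_loc d K E = Max ((\<lambda>k. max 2 (d k) + (\<Sum>l\<in>pa E k. d l)) ` {1..K})"

(* \<kappa> is a version of the regular conditional distribution of the k-th block given the blocks
   in I.  For I = {} the space of the conditioning variable has a single point, and \<kappa> is the
   marginal of the k-th block. *)

definition cond_distr :: "(nat \<Rightarrow> nat) \<Rightarrow> (nat \<Rightarrow> nat \<Rightarrow> real) measure \<Rightarrow> nat \<Rightarrow> nat set \<Rightarrow>
    ((nat \<Rightarrow> nat \<Rightarrow> real) \<Rightarrow> (nat \<Rightarrow> real) measure) \<Rightarrow> bool" where
  "cond_distr d \<mu> k I \<kappa> \<longleftrightarrow>
     \<kappa> \<in> blocks d I \<rightarrow>\<^sub>M prob_algebra (cube (d k)) \<and>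
     (\<forall>A\<in>sets (blocks d I). \<forall>B\<in>sets (cube (d k)).
        emeasure \<mu> {x \<in> space \<mu>. restrict x I \<in> A \<and> x k \<in> B} =
        (\<integral>\<^sup>+ x. indicator A (restrict x I) * emeasure (\<kappa> (restrict x I)) B \<partial>\<mu>))"

(* The law on the first m blocks obtained by drawing the k-th block, for k = 1, ..., m in this
   order, from \<kappa> k applied to the parents already drawn. *)

primrec kernel_product :: "(nat \<Rightarrow> nat) \<Rightarrow> nat rel \<Rightarrow>
    (nat \<Rightarrow> (nat \<Rightarrow> nat \<Rightarrow> real) \<Rightarrow> (nat \<Rightarrow> real) measure) \<Rightarrow>
    nat \<Rightarrow> (nat \<Rightarrow> nat \<Rightarrow> real) measure" where
  "kernel_product d E \<kappa> 0 = return (blocks d {}) (\<lambda>_. undefined)"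
| "kernel_product d E \<kappa> (Suc m) =
     kernel_product d E \<kappa> m \<bind> (\<lambda>x. \<kappa> (Suc m) (restrict x (pa E (Suc m))) \<bind>
       (\<lambda>y. return (blocks d {1..Suc m}) (x(Suc m := y))))"

definition graph_measures ::
    "(nat \<Rightarrow> nat) \<Rightarrow> nat \<Rightarrow> nat rel \<Rightarrow> (nat \<Rightarrow> nat \<Rightarrow> real) measure set" where
  "graph_measures d K E = {\<mu> \<in> space (prob_algebra (blocks d {1..K})).
     \<exists>\<kappa>. (\<forall>k\<in>{1..K}. cond_distr d \<mu> k (pa E k) (\<kappa> k)) \<and> \<mu> = kernel_product d E \<kappa> K}"

definition lipschitz_kernels ::
    "(nat \<Rightarrow> nat) \<Rightarrow> nat \<Rightarrow> nat rel \<Rightarrow> real \<Rightarrow> (nat \<Rightarrow> nat \<Rightarrow> real) measure \<Rightarrow> bool" where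
  "lipschitz_kernels d K E L \<mu> \<longleftrightarrow>
     (\<forall>k\<in>{2..K}. pa E k \<noteq> {} \<longrightarrow>
       (\<exists>\<kappa>. cond_distr d \<mu> k (pa E k) \<kappa> \<and>
         (\<forall>x\<in>space (blocks d (pa E k)). \<forall>x'\<in>space (blocks d (pa E k)).
            wasserstein (cube_dist (d k)) (\<kappa> x) (\<kappa> x')
              \<le> ennreal (L * blocks_dist d (pa E k) x x'))))"

end

(* Full connectivity of pa(k) means that pa(k) is contained in {l} together with pa(l) for
   l = max pa(k).  Hence the product of the empirical conditional laws along G, taken on a dyadic
   grid of mesh 2^-J with 2^(J d_loc(G)) of order n, has the same law as the empirical measure on
   the blocks in {k} and pa(k), for every k.  So the error made when the k-th block is added is an
   average, over the dyadic cells of the parents and under the empirical weights, of distances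
   between an empirical conditional law and the true kernel.  By Kantorovich duality and chaining
   over the dyadic scales these distances are controlled by centred fluctuations, whose variances
   sum to the stated rate; the Lipschitz kernels propagate the error along the graph.

   G is unknown, so one such candidate is built for every admissible graph from the first half of
   the sample.  For each pair of candidates take a 1-Lipschitz function that nearly attains their
   distance, and choose the candidate whose integrals of these functions are closest to the
   averages over the second half.  The selected candidate is at most three times as far from mu as
   the one for the true graph, up to deviations of order n^(-1/2) of finitely many averages. *)

theory Submission
  imports Defs
begin

text \<open>The conditional law in a parent cell divides by the number of sample points there, and
  the empirical weight of the cell multiplies by it. These random counts cancel, so thinly filled
  cells need no special treatment and no lower bound on a cell probability is ever used. The second
  moments of the fluctuations are at most twice the joint cell probabilities, which sum to at most
  one; Cauchy-Schwarz then brings in only the number of cells. With p the total dimension of the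
  parents, scale \<open>j\<close> costs about 2^-j times the root of 2^(J p + j d_k) / n. As
  \<open>d_loc\<close> contains max {2, d_k}, this is at most a constant times 2^-J for every
  \<open>j\<close>, and the \<open>J + 1\<close> scales are the origin of the logarithm.

  The test functions are picked by Hilbert choice, which says nothing about measurability in the
  sample. So the sample is first rounded to a grid of mesh 2^-n: it then takes finitely many values,
  every function of it is measurable, and the rounding error is below the rate. The kernels that
  multiply to \<open>\<mu>\<close> and the Lipschitz ones may be different versions; they agree
  almost surely against all Lipschitz functions at once, which is all that the argument
  needs.\<close>

section \<open>Duality for finite transport problems\<close>

text \<open>The induction on the number of functionals is Bartl's short algebraic proof.\<close>

lemma farkas:
  fixes \<alpha> :: "'i \<Rightarrow> ('v \<Rightarrow> real) \<Rightarrow> real" and \<gamma> :: "('v \<Rightarrow> real) \<Rightarrow> real"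
  assumes "finite I"
    and "\<And>i x y c. i \<in> I \<Longrightarrow> \<alpha> i (\<lambda>v. y v - c * x v) = \<alpha> i y - c * \<alpha> i x"
    and "\<And>x y c. \<gamma> (\<lambda>v. y v - c * x v) = \<gamma> y - c * \<gamma> x"
  shows "(\<exists>w. (\<forall>i\<in>I. w i \<ge> 0) \<and> (\<forall>y. \<gamma> y = (\<Sum>i\<in>I. w i * \<alpha> i y))) \<or>
         (\<exists>y. (\<forall>i\<in>I. \<alpha> i y \<le> 0) \<and> \<gamma> y > 0)"
  using assms
proof (induction I arbitrary: \<alpha> \<gamma> rule: finite_induct)
  case empty
  show ?case
  proof (cases "\<forall>y. \<gamma> y = 0")
    case False
    then obtain y where y: "\<gamma> y \<noteq> 0" by auto
    \<comment> \<open>Linearity is assumed only in the form y - c x, so -y is written as y - 2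
      y.\<close>
    have "\<gamma> (\<lambda>v. y v - 2 * y v) = - \<gamma> y" using empty(2)[of y 2 y] by simp
    then show ?thesis using y by (cases "\<gamma> y > 0") (auto intro: exI[of _ y] exI[of _ "\<lambda>v. y v - 2 * y v"])
  qed auto
next
  case (insert k I)
  have "(\<exists>w. (\<forall>i\<in>I. w i \<ge> 0) \<and> (\<forall>y. \<gamma> y = (\<Sum>i\<in>I. w i * \<alpha> i y))) \<or>
         (\<exists>y. (\<forall>i\<in>I. \<alpha> i y \<le> 0) \<and> \<gamma> y > 0)"
    by (rule insert.IH) (use insert.prems in auto)
  then consider (comb) w where "\<forall>i\<in>I. w i \<ge> 0" "\<forall>y. \<gamma> y = (\<Sum>i\<in>I. w i * \<alpha> i y)"
    | (sep) x where "\<forall>i\<in>I. \<alpha> i x \<le> 0" "\<gamma> x > 0" by auto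
  then show ?case
  proof cases
    case comb
    define w' where "w' = w(k := 0)"
    have "(\<Sum>i\<in>insert k I. w' i * \<alpha> i y) = (\<Sum>i\<in>I. w i * \<alpha> i y)" for y
      using insert.hyps by (auto simp: w'_def intro!: sum.cong)
    moreover have "\<forall>i\<in>insert k I. w' i \<ge> 0" using comb by (auto simp: w'_def)
    ultimately show ?thesis using comb by metis
  next
    case sep
    show ?thesis
    proof (cases "\<alpha> k x \<le> 0")
      case True then show ?thesis using sep by auto
    next
      case False
      define s where "s = \<alpha> k x"
      have s: "s > 0" using False by (simp add: s_def)
      \<comment> \<open>The modified functionals vanish at \<open>x\<close>. The induction
        hypothesis for them yields a combination or a separating \<open>y\<close>; moving along
        \<open>x\<close> does not change their values, which leaves room to make
        \<open>\<alpha> k\<close> zero.\<close>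
      define \<alpha>' where "\<alpha>' i y = \<alpha> i y - \<alpha> i x / s * \<alpha> k y" for i y
      define \<gamma>' where "\<gamma>' y = \<gamma> y - \<gamma> x / s * \<alpha> k y" for y
      have "(\<exists>w. (\<forall>i\<in>I. w i \<ge> 0) \<and> (\<forall>y. \<gamma>' y = (\<Sum>i\<in>I. w i * \<alpha>' i y))) \<or>
         (\<exists>y. (\<forall>i\<in>I. \<alpha>' i y \<le> 0) \<and> \<gamma>' y > 0)"
        by (rule insert.IH) (simp_all add: \<alpha>'_def \<gamma>'_def insert.prems algebra_simps add_divide_distrib diff_divide_distrib)
      then consider (comb') w where "\<forall>i\<in>I. w i \<ge> 0" "\<forall>y. \<gamma>' y = (\<Sum>i\<in>I. w i * \<alpha>' i y)"
        | (sep') y where "\<forall>i\<in>I. \<alpha>' i y \<le> 0" "\<gamma>' y > 0" by auto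
      then show ?thesis
      proof cases
        case comb'
        define c where "c = (\<gamma> x - (\<Sum>i\<in>I. w i * \<alpha> i x)) / s"
        have "(\<Sum>i\<in>I. w i * \<alpha> i x) \<le> 0"
          using comb' sep by (intro sum_nonpos) (auto simp: mult_nonneg_nonpos)
        then have c: "c \<ge> 0" using sep s by (simp add: c_def)
        define w' where "w' = w(k := c)"
        have "\<gamma> y = (\<Sum>i\<in>insert k I. w' i * \<alpha> i y)" for y
        proof -
          have "(\<Sum>i\<in>insert k I. w' i * \<alpha> i y) = c * \<alpha> k y + (\<Sum>i\<in>I. w i * \<alpha> i y)"
            using insert.hyps by (auto simp: w'_def intro!: sum.cong)
          moreover have "\<gamma>' y = (\<Sum>i\<in>I. w i * \<alpha> i y) - (\<Sum>i\<in>I. w i * \<alpha> i x) / s * \<alpha> k y"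
            using comb' by (simp add: \<alpha>'_def right_diff_distrib sum_subtractf sum_divide_distrib sum_distrib_right mult.assoc)
          ultimately show ?thesis by (simp add: \<gamma>'_def c_def diff_divide_distrib left_diff_distrib)
        qed
        moreover have "\<forall>i\<in>insert k I. w' i \<ge> 0" using comb' c by (auto simp: w'_def)
        ultimately show ?thesis by blast
      next
        case sep'
        define z where "z = (\<lambda>v. y v - (\<alpha> k y / s) * x v)"
        have "\<alpha> i z = \<alpha>' i y" if "i \<in> I" for i
          unfolding z_def using insert.prems(1)[of i y "\<alpha> k y / s" x] that by (simp add: \<alpha>'_def)
        moreover have "\<alpha> k z = 0" unfolding z_def using insert.prems(1)[of k y "\<alpha> k y / s" x] s by (simp add: s_def)
        moreover have "\<gamma> z = \<gamma>' y" unfolding z_def using insert.prems(2)[of y "\<alpha> k y / s" x] by (simp add: \<gamma>'_def)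
        ultimately show ?thesis using sep' by (intro disjI2 exI[of _ z]) auto
      qed
    qed
  qed
qed

text \<open>Farkas' alternative with one functional per pair (u, v): nonnegative coefficients are a
  transport plan, while a separating vector is a pair of potentials that violates
  \<open>dual\<close>. The hypothesis \<open>dual\<close> speaks of one Lipschitz function only, so
  the pair must first be merged into one.\<close>

lemma finite_transport_duality:
  fixes \<rho> :: "'a \<Rightarrow> 'a \<Rightarrow> real" and a b :: "'a \<Rightarrow> real"
  assumes fin: "finite G"
    and a: "\<And>u. u \<in> G \<Longrightarrow> a u \<ge> 0" "sum a G = 1" and b: "\<And>u. u \<in> G \<Longrightarrow> b u \<ge> 0" "sum b G = 1"
    and refl: "\<And>u. u \<in> G \<Longrightarrow> \<rho> u u = 0"
    and sym: "\<And>u v. u \<in> G \<Longrightarrow> v \<in> G \<Longrightarrow> \<rho> u v = \<rho> v u"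
    and tri: "\<And>u v w. u \<in> G \<Longrightarrow> v \<in> G \<Longrightarrow> w \<in> G \<Longrightarrow> \<rho> u w \<le> \<rho> u v + \<rho> v w"
    and dual: "\<And>f. (\<And>u v. u \<in> G \<Longrightarrow> v \<in> G \<Longrightarrow> \<bar>f u - f v\<bar> \<le> \<rho> u v) \<Longrightarrow>
      (\<Sum>u\<in>G. f u * a u) - (\<Sum>u\<in>G. f u * b u) \<le> \<epsilon>"
  shows "\<exists>\<pi>. (\<forall>u\<in>G. \<forall>v\<in>G. \<pi> u v \<ge> 0) \<and> (\<forall>u\<in>G. (\<Sum>v\<in>G. \<pi> u v) = a u) \<and>
    (\<forall>v\<in>G. (\<Sum>u\<in>G. \<pi> u v) = b v) \<and> (\<Sum>u\<in>G. \<Sum>v\<in>G. \<pi> u v * \<rho> u v) \<le> \<epsilon>"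
proof -
  have ne: "G \<noteq> {}" using a by auto
  \<comment> \<open>Vectors carry two potentials and, at \<open>None\<close>, the multiplier
    \<open>t\<close> of the cost bound. Among the functionals, \<open>Some (u, v)\<close> stands for
    a plan entry and \<open>None\<close> for the slack in the cost bound; the latter forces
    \<open>t \<ge> 0\<close>.\<close>
  define \<alpha> :: "('a \<times> 'a) option \<Rightarrow> (('a + 'a) option \<Rightarrow> real) \<Rightarrow> real" where
    "\<alpha> i y = (case i of None \<Rightarrow> - y None
      | Some (u, v) \<Rightarrow> - (y (Some (Inl u)) + y (Some (Inr v)) + y None * \<rho> u v))" for i y
  define \<gamma> :: "(('a + 'a) option \<Rightarrow> real) \<Rightarrow> real" where
    "\<gamma> y = - ((\<Sum>u\<in>G. y (Some (Inl u)) * a u) + (\<Sum>v\<in>G. y (Some (Inr v)) * b v) + y None * \<epsilon>)" for y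
  define I where "I = insert None (Some ` (G \<times> G))"
  have sumI: "(\<Sum>i\<in>I. h i) = h None + (\<Sum>u\<in>G. \<Sum>v\<in>G. h (Some (u, v)))" for h :: "_ \<Rightarrow> real"
    using fin by (simp add: I_def sum.reindex sum.cartesian_product image_iff)
  have "(\<exists>w. (\<forall>i\<in>I. w i \<ge> 0) \<and> (\<forall>y. \<gamma> y = (\<Sum>i\<in>I. w i * \<alpha> i y))) \<or>
         (\<exists>y. (\<forall>i\<in>I. \<alpha> i y \<le> 0) \<and> \<gamma> y > 0)"
  proof (rule farkas)
    show "finite I" using fin by (simp add: I_def)
    show "\<alpha> i (\<lambda>v. y v - c * x v) = \<alpha> i y - c * \<alpha> i x" for i x y c
      by (auto simp: \<alpha>_def algebra_simps split: option.splits)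
    show "\<gamma> (\<lambda>v. y v - c * x v) = \<gamma> y - c * \<gamma> x" for x y c
      by (simp add: \<gamma>_def algebra_simps sum_subtractf sum_distrib_left)
  qed
  then consider (plan) w where "\<forall>i\<in>I. w i \<ge> 0" "\<And>y. \<gamma> y = (\<Sum>i\<in>I. w i * \<alpha> i y)"
    | (pot) y where "\<forall>i\<in>I. \<alpha> i y \<le> 0" "\<gamma> y > 0" by blast
  then show ?thesis
  proof cases
    case plan
    define \<pi> where "\<pi> u v = w (Some (u, v))" for u v
    have eq: "\<gamma> y = - w None * y None - (\<Sum>u\<in>G. \<Sum>v\<in>G. \<pi> u v * (y (Some (Inl u)) + y (Some (Inr v)) + y None * \<rho> u v))" for y
    proof -
      have "(\<Sum>u\<in>G. \<Sum>v\<in>G. w (Some (u, v)) * \<alpha> (Some (u, v)) y) =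
        - (\<Sum>u\<in>G. \<Sum>v\<in>G. \<pi> u v * (y (Some (Inl u)) + y (Some (Inr v)) + y None * \<rho> u v))"
        unfolding sum_negf[symmetric] by (simp add: \<alpha>_def \<pi>_def algebra_simps)
      then show ?thesis using plan(2)[of y] unfolding sumI by (simp add: \<alpha>_def)
    qed
    \<comment> \<open>Evaluating the identity of functionals at unit vectors reads off the two
      marginals and the cost.\<close>
    have "a u0 = (\<Sum>v\<in>G. \<pi> u0 v)" if "u0 \<in> G" for u0
    proof -
      have "a u0 = - \<gamma> (\<lambda>t. if t = Some (Inl u0) then 1 else 0)"
        using fin that by (simp add: \<gamma>_def if_distrib[of "\<lambda>x. x * _"] if_distribR cong: if_cong)
      also have "\<dots> = (\<Sum>u\<in>G. if u = u0 then (\<Sum>v\<in>G. \<pi> u v) else 0)"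
        unfolding eq by (auto intro!: sum.cong)
      also have "\<dots> = (\<Sum>v\<in>G. \<pi> u0 v)" using fin that by simp
      finally show ?thesis .
    qed
    moreover have "b v0 = (\<Sum>u\<in>G. \<pi> u v0)" if "v0 \<in> G" for v0
    proof -
      have "b v0 = - \<gamma> (\<lambda>t. if t = Some (Inr v0) then 1 else 0)"
        using fin that by (simp add: \<gamma>_def if_distrib[of "\<lambda>x. x * _"] if_distribR cong: if_cong)
      also have "\<dots> = (\<Sum>u\<in>G. \<Sum>v\<in>G. if v = v0 then \<pi> u v else 0)"
        unfolding eq by (auto intro!: sum.cong)
      also have "\<dots> = (\<Sum>u\<in>G. \<pi> u v0)" using fin that by simp
      finally show ?thesis .
    qed
    moreover have "(\<Sum>u\<in>G. \<Sum>v\<in>G. \<pi> u v * \<rho> u v) \<le> \<epsilon>"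
    proof -
      have "\<epsilon> = - \<gamma> (\<lambda>t. if t = None then 1 else 0)" by (simp add: \<gamma>_def)
      also have "\<dots> = w None + (\<Sum>u\<in>G. \<Sum>v\<in>G. \<pi> u v * \<rho> u v)" unfolding eq by simp
      finally show ?thesis using plan(1) by (simp add: I_def)
    qed
    ultimately show ?thesis using plan(1) by (intro exI[of _ \<pi>]) (auto simp: \<pi>_def I_def)
  next
    case pot
    define f where "f u = y (Some (Inl u))" for u
    define g where "g u = y (Some (Inr u))" for u
    define t where "t = y None"
    have t: "t \<ge> 0" using pot(1) by (auto simp: I_def \<alpha>_def t_def)
    have fg: "f u + g v + t * \<rho> u v \<ge> 0" if "u \<in> G" "v \<in> G" for u v
      using bspec[OF pot(1), of "Some (u, v)"] that by (auto simp: I_def \<alpha>_def t_def f_def g_def)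
    have neg: "(\<Sum>u\<in>G. f u * a u) + (\<Sum>v\<in>G. g v * b v) + t * \<epsilon> < 0"
      using pot(2) by (simp add: \<gamma>_def f_def g_def t_def)
    \<comment> \<open>Inf-convolution of \<open>g\<close> with the cost. It lies between
      \<open>- f\<close> and \<open>g\<close> and is Lipschitz with constant \<open>t\<close>, so it
      can stand in for both potentials.\<close>
    define \<phi> where "\<phi> u = Min ((\<lambda>v. t * \<rho> u v + g v) ` G)" for u
    have \<phi>_le: "\<phi> u \<le> t * \<rho> u v + g v" if "v \<in> G" for u v
      unfolding \<phi>_def using fin that by (intro Min_le) auto
    have \<phi>_lip: "\<phi> u \<le> \<phi> v + t * \<rho> u v" if "u \<in> G" "v \<in> G" for u v
    proof -
      have "\<phi> v \<in> (\<lambda>w. t * \<rho> v w + g w) ` G" unfolding \<phi>_def using fin ne by (intro Min_in) auto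
      then obtain w where w: "w \<in> G" "\<phi> v = t * \<rho> v w + g w" by auto
      have "t * \<rho> u w \<le> t * \<rho> u v + t * \<rho> v w"
        using tri[OF that w(1)] t by (metis distrib_left mult_left_mono)
      then show ?thesis using \<phi>_le[OF w(1), of u] w by simp
    qed
    have \<phi>_f: "- f u \<le> \<phi> u" if "u \<in> G" for u
      proof -
      have "- f u \<le> t * \<rho> u v + g v" if "v \<in> G" for v using fg[OF \<open>u \<in> G\<close> that] by linarith
      then show ?thesis unfolding \<phi>_def using fin ne by (subst Min_ge_iff) auto
    qed
    have "(\<Sum>u\<in>G. \<phi> u * b u) \<le> (\<Sum>v\<in>G. g v * b v)"
    proof (intro sum_mono mult_right_mono)
      show "\<phi> u \<le> g u" if "u \<in> G" for u using \<phi>_le[OF that, of u] refl[OF that] by simp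
    qed (use b in auto)
    moreover have "- (\<Sum>u\<in>G. f u * a u) \<le> (\<Sum>u\<in>G. \<phi> u * a u)"
      unfolding sum_negf[symmetric] using a \<phi>_f
      by (intro sum_mono) (metis mult_minus_left mult_right_mono)
    ultimately have less: "(\<Sum>u\<in>G. \<phi> u * b u) + t * \<epsilon> < (\<Sum>u\<in>G. \<phi> u * a u)" using neg by linarith
    have lip: "\<bar>\<phi> u - \<phi> v\<bar> \<le> t * \<rho> u v" if "u \<in> G" "v \<in> G" for u v
      using \<phi>_lip[of u v] \<phi>_lip[of v u] sym[of u v] that by auto
    show ?thesis
    \<comment> \<open>Without a cost multiplier \<open>\<phi>\<close> is constant, and equal total
      masses contradict the strict inequality; otherwise \<open>\<phi> / t\<close> is an admissible
      test function.\<close>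
    proof (cases "t = 0")
      case True
      obtain u0 where u0: "u0 \<in> G" using ne by auto
      have c: "\<phi> u = \<phi> u0" if "u \<in> G" for u using lip[OF that u0] True by simp
      have "(\<Sum>u\<in>G. \<phi> u * c u) = \<phi> u0 * sum c G" for c :: "'a \<Rightarrow> real"
        using c by (simp add: sum_distrib_left)
      then show ?thesis using less a b True by simp
    next
      case False
      then have t: "t > 0" using t by simp
      have "(\<Sum>u\<in>G. \<phi> u / t * a u) - (\<Sum>u\<in>G. \<phi> u / t * b u) \<le> \<epsilon>"
      proof (rule dual)
        fix u v assume "u \<in> G" "v \<in> G"
        then have "\<bar>\<phi> u - \<phi> v\<bar> / t \<le> \<rho> u v" using lip t by (simp add: divide_le_eq mult.commute)
        then show "\<bar>\<phi> u / t - \<phi> v / t\<bar> \<le> \<rho> u v"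
          using t by (simp add: diff_divide_distrib[symmetric])
      qed
      then have "((\<Sum>u\<in>G. \<phi> u * a u) - (\<Sum>u\<in>G. \<phi> u * b u)) / t \<le> \<epsilon>"
        by (simp add: diff_divide_distrib sum_divide_distrib)
      then show ?thesis using less t by (simp add: divide_le_eq mult.commute)
    qed
  qed
qed

section \<open>Wasserstein distance on quantised spaces\<close>

definition lip_fun :: "'a measure \<Rightarrow> ('a \<Rightarrow> 'a \<Rightarrow> real) \<Rightarrow> real \<Rightarrow> ('a \<Rightarrow> real) \<Rightarrow> bool" where
  "lip_fun M \<rho> l f \<longleftrightarrow> f \<in> borel_measurable M \<and>
     (\<forall>x\<in>space M. \<forall>y\<in>space M. \<bar>f x - f y\<bar> \<le> l * \<rho> x y)"

text \<open>What the duality and the chaining need to know about the cubes; single cubes and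
  products of blocks are both instances. By \<open>q_q\<close> the levels are nested, so a point
  rounded at a fine level still determines its coarser roundings. \<open>\<rho>\<close> need only be
  a pseudometric.\<close>

locale quantized =
  fixes M :: "'a measure" and \<rho> :: "'a \<Rightarrow> 'a \<Rightarrow> real"
    and q :: "nat \<Rightarrow> 'a \<Rightarrow> 'a" and G :: "nat \<Rightarrow> 'a set"
  assumes finite_G: "finite (G j)"
    and q_in: "x \<in> space M \<Longrightarrow> q j x \<in> G j"
    and G_space: "G j \<subseteq> space M"
    and q_cell: "q j -` {z} \<inter> space M \<in> sets M"
    and dist_q: "x \<in> space M \<Longrightarrow> \<rho> x (q j x) \<le> (1/2) ^ j"
    and q_q: "i \<le> j \<Longrightarrow> x \<in> space M \<Longrightarrow> q i (q j x) = q i x"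
    and dist_refl: "x \<in> space M \<Longrightarrow> \<rho> x x = 0"
    and dist_sym: "x \<in> space M \<Longrightarrow> y \<in> space M \<Longrightarrow> \<rho> x y = \<rho> y x"
    and dist_tri: "x \<in> space M \<Longrightarrow> y \<in> space M \<Longrightarrow> z \<in> space M \<Longrightarrow> \<rho> x z \<le> \<rho> x y + \<rho> y z"
    and dist_nonneg: "x \<in> space M \<Longrightarrow> y \<in> space M \<Longrightarrow> 0 \<le> \<rho> x y"
    and dist_le_1: "x \<in> space M \<Longrightarrow> y \<in> space M \<Longrightarrow> \<rho> x y \<le> 1"
    and dist_meas: "z \<in> space M \<Longrightarrow> (\<lambda>x. \<rho> x z) \<in> borel_measurable M"
begin

definition cell :: "nat \<Rightarrow> 'a \<Rightarrow> 'a set" where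
  "cell j z = q j -` {z} \<inter> space M"

lemma cell_sets [measurable, simp]: "cell j z \<in> sets M"
  unfolding cell_def by (rule q_cell)

lemma q_space: "x \<in> space M \<Longrightarrow> q j x \<in> space M"
  using q_in G_space by blast

lemma measurable_q: "q j \<in> M \<rightarrow>\<^sub>M count_space (G j)"
  using q_in q_cell by (subst measurable_count_space_eq2[OF finite_G]) auto

lemma integral_comp_q:
  fixes h :: "'a \<Rightarrow> real"
  assumes "prob_space N" "sets N = sets M"
  shows "integrable N (\<lambda>x. h (q j x))"
    and "(\<integral>x. h (q j x) \<partial>N) = (\<Sum>u\<in>G j. h u * measure N (cell j u))"
proof -
  interpret prob_space N by fact
  have sp: "space N = space M" using assms(2) by (rule sets_eq_imp_space_eq)
  have eq: "h (q j x) = (\<Sum>u\<in>G j. h u * indicator (cell j u) x)" if "x \<in> space N" for x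
  proof -
    have "(\<Sum>u\<in>G j. h u * indicator (cell j u) x) = (\<Sum>u\<in>G j. if u = q j x then h u else 0)"
      using that by (intro sum.cong) (auto simp: cell_def sp)
    then show ?thesis using that q_in finite_G by (simp add: sp)
  qed
  have int: "integrable N (\<lambda>x. \<Sum>u\<in>G j. h u * indicator (cell j u) x)"
    using assms(2) by (intro Bochner_Integration.integrable_sum integrable_mult_right integrable_real_indicator)
      (auto simp: emeasure_finite less_top[symmetric])
  then show "integrable N (\<lambda>x. h (q j x))"
    by (subst Bochner_Integration.integrable_cong[OF refl eq]) auto
  have "(\<integral>x. h (q j x) \<partial>N) = (\<integral>x. (\<Sum>u\<in>G j. h u * indicator (cell j u) x) \<partial>N)"
    by (rule Bochner_Integration.integral_cong[OF refl eq])
  also have "\<dots> = (\<Sum>u\<in>G j. h u * measure N (cell j u))"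
    using assms(2) by (subst Bochner_Integration.integral_sum)
      (auto intro!: integrable_mult_right integrable_real_indicator simp: emeasure_finite less_top[symmetric])
  finally show "(\<integral>x. h (q j x) \<partial>N) = (\<Sum>u\<in>G j. h u * measure N (cell j u))" .
qed

lemma sum_cells:
  assumes "prob_space N" "sets N = sets M"
  shows "(\<Sum>u\<in>G j. measure N (cell j u)) = 1"
  using integral_comp_q(2)[OF assms, of "\<lambda>_. 1" j] prob_space.prob_space[OF assms(1)] by simp

lemma nn_integral_comp_q:
  fixes h :: "'a \<Rightarrow> real"
  assumes "prob_space N" "sets N = sets M" "\<And>u. u \<in> G j \<Longrightarrow> h u \<ge> 0"
  shows "(\<integral>\<^sup>+x. ennreal (h (q j x)) \<partial>N) = ennreal (\<Sum>u\<in>G j. h u * measure N (cell j u))"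
  using q_in assms sets_eq_imp_space_eq[OF assms(2)]
  by (subst nn_integral_eq_integral[OF integral_comp_q(1)]) (auto simp: integral_comp_q(2))

lemma lip_fun_bounded:
  assumes "lip_fun M \<rho> l f" "l \<ge> 0"
  obtains B where "\<And>x. x \<in> space M \<Longrightarrow> \<bar>f x\<bar> \<le> B"
proof (cases "space M = {}")
  case True then show ?thesis using that by auto
next
  case False
  then obtain x0 where x0: "x0 \<in> space M" by auto
  have "\<bar>f x\<bar> \<le> \<bar>f x0\<bar> + l" if "x \<in> space M" for x
  proof -
    have "\<bar>f x - f x0\<bar> \<le> l * \<rho> x x0" using assms that x0 by (auto simp: lip_fun_def)
    also have "\<dots> \<le> l" using dist_le_1[OF that x0] assms(2) by (simp add: mult_left_le)
    finally show ?thesis by linarith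
  qed
  then show ?thesis using that by blast
qed

lemma lip_fun_integrable:
  assumes "lip_fun M \<rho> l f" "l \<ge> 0" "prob_space N" "sets N = sets M"
  shows "integrable N f"
proof -
  interpret prob_space N by fact
  obtain B where "\<And>x. x \<in> space M \<Longrightarrow> \<bar>f x\<bar> \<le> B" using lip_fun_bounded assms by blast
  then have "AE x in N. norm (f x) \<le> B" using sets_eq_imp_space_eq[OF assms(4)] by auto
  then show ?thesis
    using assms measurable_cong_sets[OF assms(4) refl, of borel]
    by (intro integrable_const_bound) (auto simp: lip_fun_def)
qed

lemma lip_fun_integral_q:
  assumes "lip_fun M \<rho> l f" "l \<ge> 0" "prob_space N" "sets N = sets M"
  shows "\<bar>(\<integral>x. f (q j x) \<partial>N) - (\<integral>x. f x \<partial>N)\<bar> \<le> l * (1/2) ^ j"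
proof -
  interpret prob_space N by fact
  have "\<bar>f (q j x) - f x\<bar> \<le> l * (1/2) ^ j" if "x \<in> space N" for x
  proof -
    have x: "x \<in> space M" using that sets_eq_imp_space_eq[OF assms(4)] by simp
    have "\<bar>f x - f (q j x)\<bar> \<le> l * \<rho> x (q j x)" using assms x q_space[OF x] by (auto simp: lip_fun_def)
    also have "\<dots> \<le> l * (1/2) ^ j" using dist_q[OF x] assms(2) by (rule mult_left_mono)
    finally show ?thesis by (simp add: abs_minus_commute)
  qed
  note b = this
  note int = integral_comp_q(1)[OF assms(3,4), of f j] lip_fun_integrable[OF assms]
  have "\<bar>\<integral>x. f (q j x) - f x \<partial>N\<bar> \<le> (\<integral>x. \<bar>f (q j x) - f x\<bar> \<partial>N)"
    using integral_norm_bound[of N "\<lambda>x. f (q j x) - f x"] by simp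
  also have "\<dots> \<le> (\<integral>x. l * (1/2) ^ j \<partial>N)"
    using b int by (intro integral_mono) auto
  also have "\<dots> = l * (1/2) ^ j" by (simp add: prob_space)
  finally show ?thesis using int by simp
qed

text \<open>McShane extension from a finite set, which also makes measurability a matter of finitely
  many distance functions.\<close>

lemma lip_fun_extend:
  assumes "\<And>u v. u \<in> G j \<Longrightarrow> v \<in> G j \<Longrightarrow> \<bar>\<phi> u - \<phi> v\<bar> \<le> \<rho> u v" and "G j \<noteq> {}"
  shows "\<exists>f. lip_fun M \<rho> 1 f \<and> (\<forall>u\<in>G j. f u = \<phi> u)"
proof -
  define f where "f x = Min ((\<lambda>v. \<rho> x v + \<phi> v) ` G j)" for x
  have f_le: "f x \<le> \<rho> x v + \<phi> v" if "v \<in> G j" for x v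
    unfolding f_def using finite_G that by (intro Min_le) auto
  have ex: "\<exists>v\<in>G j. f x = \<rho> x v + \<phi> v" for x
  proof -
    have "f x \<in> (\<lambda>v. \<rho> x v + \<phi> v) ` G j"
      unfolding f_def using finite_G assms(2) by (intro Min_in) auto
    then show ?thesis by auto
  qed
  have le: "f x \<le> f y + \<rho> x y" if xy: "x \<in> space M" "y \<in> space M" for x y
  proof -
    obtain v where v: "v \<in> G j" "f y = \<rho> y v + \<phi> v" using ex by blast
    then show ?thesis using f_le[OF v(1), of x] dist_tri[OF xy, of v] subsetD[OF G_space v(1)] by auto
  qed
  have "f u = \<phi> u" if u: "u \<in> G j" for u
  proof (rule antisym)
    show "f u \<le> \<phi> u" using f_le[OF u, of u] dist_refl[of u] subsetD[OF G_space u] by auto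
    obtain v where v: "v \<in> G j" "f u = \<rho> u v + \<phi> v" using ex by blast
    then show "\<phi> u \<le> f u" using assms(1)[OF u v(1)] by auto
  qed
  moreover have "f \<in> borel_measurable M"
    unfolding f_def using finite_G dist_meas G_space
    by (intro borel_measurable_Min borel_measurable_add) auto
  moreover have "\<bar>f x - f y\<bar> \<le> \<rho> x y" if "x \<in> space M" "y \<in> space M" for x y
    using le[OF that] le[OF that(2,1)] dist_sym[OF that] by auto
  ultimately show ?thesis by (auto simp: lip_fun_def)
qed

lemma AE_cell_positive:
  assumes N: "prob_space N" "sets N = sets M"
  shows "AE x in N. measure N (cell j (q j x)) \<noteq> 0"
proof -
  interpret prob_space N by fact
  have sp: "space N = space M" using N(2) by (rule sets_eq_imp_space_eq)
  have "AE x in N. \<forall>u\<in>G j. measure N (cell j u) = 0 \<longrightarrow> x \<notin> cell j u"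
  proof (intro AE_finite_allI[OF finite_G] AE_impI)
    fix u assume "measure N (cell j u) = 0"
    then show "AE x in N. x \<notin> cell j u"
      using N(2) by (intro AE_not_in null_setsI) (auto simp: emeasure_eq_measure)
  qed
  then show ?thesis using AE_space by eventually_elim (use q_in sp in \<open>auto simp: cell_def\<close>)
qed

text \<open>Kantorovich duality up to a quantisation error. The finite duality is applied to the
  cell masses, and the resulting plan is spread out over the cells. Of the error
  \<open>4 * (1/2) ^ j\<close>, one half comes from rounding the arguments of the two integrals of
  \<open>f\<close>, the other from rounding both points in the cost.\<close>

lemma wasserstein_le_dual:
  assumes \<mu>: "prob_space \<mu>" "sets \<mu> = sets M" and \<nu>: "prob_space \<nu>" "sets \<nu> = sets M"
    and dual: "\<And>f. lip_fun M \<rho> 1 f \<Longrightarrow> (\<integral>x. f x \<partial>\<mu>) - (\<integral>x. f x \<partial>\<nu>) \<le> \<epsilon>"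
  shows "wasserstein \<rho> \<mu> \<nu> \<le> ennreal (\<epsilon> + 4 * (1/2) ^ j)"
proof -
  interpret \<mu>: prob_space \<mu> by fact
  interpret \<nu>: prob_space \<nu> by fact
  interpret pair_prob_space \<mu> \<nu> ..
  have sp: "space \<mu> = space M" "space \<nu> = space M" using sets_eq_imp_space_eq[OF \<mu>(2)] sets_eq_imp_space_eq[OF \<nu>(2)] by auto
  have meas_eq: "borel_measurable \<mu> = borel_measurable M" "borel_measurable \<nu> = borel_measurable M"
    using measurable_cong_sets[OF \<mu>(2) refl] measurable_cong_sets[OF \<nu>(2) refl] by auto
  define h :: real where "h = (1/2) ^ j"
  define a where "a u = measure \<mu> (cell j u)" for u
  define b where "b u = measure \<nu> (cell j u)" for u
  have ne: "G j \<noteq> {}" using \<mu>.not_empty q_in[of _ j] sp by auto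
  have G_sp: "u \<in> space M" if "u \<in> G j" for u using that G_space by auto
  have "\<exists>\<pi>. (\<forall>u\<in>G j. \<forall>v\<in>G j. \<pi> u v \<ge> 0) \<and> (\<forall>u\<in>G j. (\<Sum>v\<in>G j. \<pi> u v) = a u) \<and>
    (\<forall>v\<in>G j. (\<Sum>u\<in>G j. \<pi> u v) = b v) \<and> (\<Sum>u\<in>G j. \<Sum>v\<in>G j. \<pi> u v * \<rho> u v) \<le> \<epsilon> + 2 * h"
  proof (rule finite_transport_duality[OF finite_G])
    fix \<phi> assume "\<And>u v. u \<in> G j \<Longrightarrow> v \<in> G j \<Longrightarrow> \<bar>\<phi> u - \<phi> v\<bar> \<le> \<rho> u v"
    then obtain f where f: "lip_fun M \<rho> 1 f" "\<And>u. u \<in> G j \<Longrightarrow> f u = \<phi> u" using lip_fun_extend ne by blast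
    have "(\<Sum>u\<in>G j. \<phi> u * a u) = (\<integral>x. f (q j x) \<partial>\<mu>)" "(\<Sum>u\<in>G j. \<phi> u * b u) = (\<integral>x. f (q j x) \<partial>\<nu>)"
      using f(2) by (auto simp: integral_comp_q[OF \<mu>] integral_comp_q[OF \<nu>] a_def b_def)
    then show "(\<Sum>u\<in>G j. \<phi> u * a u) - (\<Sum>u\<in>G j. \<phi> u * b u) \<le> \<epsilon> + 2 * h"
      using dual[OF f(1)] lip_fun_integral_q[OF f(1) _ \<mu>, of j] lip_fun_integral_q[OF f(1) _ \<nu>, of j]
      by (simp add: h_def)
  qed (use G_sp dist_refl dist_sym dist_tri in \<open>auto simp: a_def b_def sum_cells[OF \<mu>] sum_cells[OF \<nu>]\<close>)
  then obtain \<pi> where \<pi>: "\<And>u v. u \<in> G j \<Longrightarrow> v \<in> G j \<Longrightarrow> \<pi> u v \<ge> 0"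
    "\<And>u. u \<in> G j \<Longrightarrow> (\<Sum>v\<in>G j. \<pi> u v) = a u" "\<And>v. v \<in> G j \<Longrightarrow> (\<Sum>u\<in>G j. \<pi> u v) = b v"
    "(\<Sum>u\<in>G j. \<Sum>v\<in>G j. \<pi> u v * \<rho> u v) \<le> \<epsilon> + 2 * h" by blast
  have a0: "\<pi> u v = 0" if "u \<in> G j" "v \<in> G j" "a u = 0" for u v
    using \<pi>(1,2) that finite_G by (metis sum_nonneg_eq_0_iff)
  have b0: "\<pi> u v = 0" if "u \<in> G j" "v \<in> G j" "b v = 0" for u v
    using \<pi>(1,3) that finite_G sum_nonneg_eq_0_iff[of "G j" "\<lambda>u. \<pi> u v"] by auto
  \<comment> \<open>Density that gives a pair of cells the mass \<open>\<pi> u v\<close> and is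
    proportional to the product measure inside. Where a cell has mass zero, \<open>\<pi>\<close>
    vanishes too, so the default value 0 of the quotient is the right one.\<close>
  define w where "w u v = \<pi> u v / (a u * b v)" for u v
  have w: "w u v \<ge> 0" if "u \<in> G j" "v \<in> G j" for u v
    using \<pi>(1)[OF that] by (simp add: w_def a_def b_def)
  have wab: "w u v * a u * b v = \<pi> u v" if "u \<in> G j" "v \<in> G j" for u v
    using a0[OF that] b0[OF that] by (cases "a u = 0"; cases "b v = 0") (auto simp: w_def)
  have meas2 [measurable]: "(\<lambda>p. ennreal (g (q j (fst p)) (q j (snd p)))) \<in> borel_measurable (\<mu> \<Otimes>\<^sub>M \<nu>)" for g
  proof -
    have "(\<lambda>p. (q j (fst p), q j (snd p))) \<in> \<mu> \<Otimes>\<^sub>M \<nu> \<rightarrow>\<^sub>M count_space (G j) \<Otimes>\<^sub>M count_space (G j)"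
      using measurable_q[of j] measurable_cong_sets[OF \<mu>(2) refl] measurable_cong_sets[OF \<nu>(2) refl]
      by (intro measurable_Pair measurable_compose[OF measurable_fst] measurable_compose[OF measurable_snd]) auto
    then have "(\<lambda>p. (q j (fst p), q j (snd p))) \<in> \<mu> \<Otimes>\<^sub>M \<nu> \<rightarrow>\<^sub>M count_space (G j \<times> G j)"
      by (simp add: pair_measure_count_space finite_G)
    from measurable_compose[OF this, of "\<lambda>p. ennreal (g (fst p) (snd p))" borel] show ?thesis by simp
  qed
  define P where "P = density (\<mu> \<Otimes>\<^sub>M \<nu>) (\<lambda>p. ennreal (w (q j (fst p)) (q j (snd p))))"
  have AE_a: "AE x in \<mu>. a (q j x) \<noteq> 0" unfolding a_def by (rule AE_cell_positive[OF \<mu>])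
  have AE_b: "AE x in \<nu>. b (q j x) \<noteq> 0" unfolding b_def by (rule AE_cell_positive[OF \<nu>])
  have fst_P: "distr P \<mu> fst = \<mu>"
  proof (rule measure_eqI)
    fix A assume "A \<in> sets (distr P \<mu> fst)"
    then have A [measurable]: "A \<in> sets \<mu>" by simp
    have "emeasure (distr P \<mu> fst) A = emeasure P (fst -` A \<inter> space P)"
      by (intro emeasure_distr) (auto simp: P_def)
    also have "\<dots> = (\<integral>\<^sup>+p. ennreal (w (q j (fst p)) (q j (snd p))) * indicator (fst -` A \<inter> space (\<mu> \<Otimes>\<^sub>M \<nu>)) p \<partial>(\<mu> \<Otimes>\<^sub>M \<nu>))"
      unfolding P_def by (subst emeasure_density) auto
    also have "\<dots> = (\<integral>\<^sup>+p. ennreal (w (q j (fst p)) (q j (snd p))) * indicator A (fst p) \<partial>(\<mu> \<Otimes>\<^sub>M \<nu>))"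
      by (intro nn_integral_cong) (auto split: split_indicator)
    also have "\<dots> = (\<integral>\<^sup>+x. \<integral>\<^sup>+y. ennreal (w (q j x) (q j y)) * indicator A x \<partial>\<nu> \<partial>\<mu>)"
      by (subst \<nu>.nn_integral_fst[symmetric]) auto
    also have "\<dots> = (\<integral>\<^sup>+x. indicator A x \<partial>\<mu>)"
    proof (rule nn_integral_cong_AE)
      show "AE x in \<mu>. (\<integral>\<^sup>+y. ennreal (w (q j x) (q j y)) * indicator A x \<partial>\<nu>) = indicator A x"
        using AE_a AE_space
      proof eventually_elim
        case (elim x)
        then have u: "q j x \<in> G j" using q_in sp by auto
        have "(\<integral>\<^sup>+y. ennreal (w (q j x) (q j y)) \<partial>\<nu>) = ennreal (\<Sum>v\<in>G j. w (q j x) v * b v)"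
          using w[OF u] by (subst nn_integral_comp_q[OF \<nu>]) (auto simp: b_def)
        also have "(\<Sum>v\<in>G j. w (q j x) v * b v) = (\<Sum>v\<in>G j. \<pi> (q j x) v / a (q j x))"
          using wab[OF u] elim(1) by (intro sum.cong) (auto simp: field_simps)
        also have "\<dots> = 1" using \<pi>(2)[OF u] elim(1) by (simp add: sum_divide_distrib[symmetric])
        finally show ?case by (auto split: split_indicator)
      qed
    qed
    finally show "emeasure (distr P \<mu> fst) A = emeasure \<mu> A" by simp
  qed simp
  have snd_P: "distr P \<nu> snd = \<nu>"
  proof (rule measure_eqI)
    fix A assume "A \<in> sets (distr P \<nu> snd)"
    then have A [measurable]: "A \<in> sets \<nu>" by simp
    have "emeasure (distr P \<nu> snd) A = emeasure P (snd -` A \<inter> space P)"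
      by (intro emeasure_distr) (auto simp: P_def)
    also have "\<dots> = (\<integral>\<^sup>+p. ennreal (w (q j (fst p)) (q j (snd p))) * indicator (snd -` A \<inter> space (\<mu> \<Otimes>\<^sub>M \<nu>)) p \<partial>(\<mu> \<Otimes>\<^sub>M \<nu>))"
      unfolding P_def by (subst emeasure_density) auto
    also have "\<dots> = (\<integral>\<^sup>+p. ennreal (w (q j (fst p)) (q j (snd p))) * indicator A (snd p) \<partial>(\<mu> \<Otimes>\<^sub>M \<nu>))"
      by (intro nn_integral_cong) (auto split: split_indicator)
    also have "\<dots> = (\<integral>\<^sup>+y. \<integral>\<^sup>+x. ennreal (w (q j x) (q j y)) * indicator A y \<partial>\<mu> \<partial>\<nu>)"
      by (subst nn_integral_snd[symmetric]) (auto simp: split_beta')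
    also have "\<dots> = (\<integral>\<^sup>+y. indicator A y \<partial>\<nu>)"
    proof (rule nn_integral_cong_AE)
      show "AE y in \<nu>. (\<integral>\<^sup>+x. ennreal (w (q j x) (q j y)) * indicator A y \<partial>\<mu>) = indicator A y"
        using AE_b AE_space
      proof eventually_elim
        case (elim y)
        then have v: "q j y \<in> G j" using q_in sp by auto
        have "(\<integral>\<^sup>+x. ennreal (w (q j x) (q j y)) \<partial>\<mu>) = ennreal (\<Sum>u\<in>G j. w u (q j y) * a u)"
          using w[OF _ v] by (subst nn_integral_comp_q[OF \<mu>, of j "\<lambda>u. w u (q j y)"]) (auto simp: a_def)
        also have "(\<Sum>u\<in>G j. w u (q j y) * a u) = (\<Sum>u\<in>G j. \<pi> u (q j y) / b (q j y))"
          using wab[OF _ v] elim(1) by (intro sum.cong) (auto simp: field_simps)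
        also have "\<dots> = 1" using \<pi>(3)[OF v] elim(1) by (simp add: sum_divide_distrib[symmetric])
        finally show ?case by (auto split: split_indicator)
      qed
    qed
    finally show "emeasure (distr P \<nu> snd) A = emeasure \<nu> A" by simp
  qed simp
  have "prob_space P"
  proof
    have "emeasure P (space P) = emeasure (distr P \<mu> fst) (space \<mu>)"
      by (subst emeasure_distr) (auto simp: P_def space_pair_measure intro!: arg_cong2[where f=emeasure])
    then show "emeasure P (space P) = 1" by (simp add: fst_P \<mu>.emeasure_space_1)
  qed
  then have "P \<in> couplings \<mu> \<nu>"
    using fst_P snd_P by (auto simp: couplings_def space_prob_algebra P_def)
  then have "wasserstein \<rho> \<mu> \<nu> \<le> (\<integral>\<^sup>+ (x, y). ennreal (\<rho> x y) \<partial>P)"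
    unfolding wasserstein_def by (rule INF_lower)
  also have "\<dots> \<le> (\<integral>\<^sup>+ p. ennreal (\<rho> (q j (fst p)) (q j (snd p)) + 2 * h) \<partial>P)"
  proof (rule nn_integral_mono)
    fix p assume "p \<in> space P"
    then obtain x y where p: "p = (x, y)" and xy: "x \<in> space M" "y \<in> space M"
      by (cases p) (auto simp: P_def space_pair_measure sp)
    note qs = q_space[OF xy(1), of j] q_space[OF xy(2), of j]
    have "\<rho> x y \<le> \<rho> (q j x) (q j y) + 2 * h"
      using dist_tri[OF xy(1) qs(1) xy(2)] dist_tri[OF qs(1,2) xy(2)] dist_sym[OF qs(2) xy(2)]
        dist_q[OF xy(1), of j] dist_q[OF xy(2), of j] by (simp add: h_def)
    then show "(case p of (x, y) \<Rightarrow> ennreal (\<rho> x y)) \<le> ennreal (\<rho> (q j (fst p)) (q j (snd p)) + 2 * h)"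
      by (simp add: p ennreal_leI)
  qed
  also have "\<dots> = (\<integral>\<^sup>+ p. ennreal (w (q j (fst p)) (q j (snd p))) * ennreal (\<rho> (q j (fst p)) (q j (snd p)) + 2 * h) \<partial>(\<mu> \<Otimes>\<^sub>M \<nu>))"
    unfolding P_def by (subst nn_integral_density) (auto intro: meas2[of "\<lambda>u v. \<rho> u v + 2 * h"])
  also have "\<dots> = (\<integral>\<^sup>+ p. ennreal (w (q j (fst p)) (q j (snd p)) * (\<rho> (q j (fst p)) (q j (snd p)) + 2 * h)) \<partial>(\<mu> \<Otimes>\<^sub>M \<nu>))"
    using q_in w by (intro nn_integral_cong) (auto simp: space_pair_measure sp ennreal_mult')
  also have "\<dots> = (\<integral>\<^sup>+x. \<integral>\<^sup>+y. ennreal (w (q j x) (q j y) * (\<rho> (q j x) (q j y) + 2 * h)) \<partial>\<nu> \<partial>\<mu>)"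
    by (subst \<nu>.nn_integral_fst[symmetric]) (auto intro: meas2[of "\<lambda>u v. w u v * (\<rho> u v + 2 * h)"])
  also have "\<dots> = (\<integral>\<^sup>+x. ennreal (\<Sum>v\<in>G j. w (q j x) v * (\<rho> (q j x) v + 2 * h) * b v) \<partial>\<mu>)"
    using w dist_nonneg G_sp q_in sp
    by (intro nn_integral_cong, subst nn_integral_comp_q[OF \<nu>]) (auto simp: b_def h_def intro!: mult_nonneg_nonneg add_nonneg_nonneg)
  also have "\<dots> = ennreal (\<Sum>u\<in>G j. (\<Sum>v\<in>G j. w u v * (\<rho> u v + 2 * h) * b v) * a u)"
    using w dist_nonneg G_sp q_in sp
    by (subst nn_integral_comp_q[OF \<mu>, of j "\<lambda>u. \<Sum>v\<in>G j. w u v * (\<rho> u v + 2 * h) * b v"])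
      (auto simp: a_def b_def h_def intro!: sum_nonneg mult_nonneg_nonneg add_nonneg_nonneg)
  also have "(\<Sum>u\<in>G j. (\<Sum>v\<in>G j. w u v * (\<rho> u v + 2 * h) * b v) * a u) = (\<Sum>u\<in>G j. \<Sum>v\<in>G j. \<pi> u v * \<rho> u v + 2 * h * \<pi> u v)"
    unfolding sum_distrib_right by (intro sum.cong refl) (auto simp: wab[symmetric] algebra_simps)
  also have "\<dots> = (\<Sum>u\<in>G j. \<Sum>v\<in>G j. \<pi> u v * \<rho> u v) + 2 * h * (\<Sum>u\<in>G j. a u)"
    by (simp add: sum.distrib sum_distrib_left[symmetric] \<pi>(2))
  also have "\<dots> \<le> \<epsilon> + 4 * h" using \<pi>(4) by (simp add: a_def sum_cells[OF \<mu>])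
  finally show ?thesis by (simp add: h_def ennreal_leI)
qed

lemma dual_le_wasserstein:
  assumes \<mu>: "prob_space \<mu>" "sets \<mu> = sets M" and \<nu>: "prob_space \<nu>" "sets \<nu> = sets M"
    and W: "wasserstein \<rho> \<mu> \<nu> \<le> ennreal c" "c \<ge> 0" and f: "lip_fun M \<rho> l f" "l \<ge> 0"
  shows "\<bar>(\<integral>x. f x \<partial>\<mu>) - (\<integral>x. f x \<partial>\<nu>)\<bar> \<le> l * c"
proof -
  interpret \<mu>: prob_space \<mu> by fact
  interpret \<nu>: prob_space \<nu> by fact
  have sp: "space \<mu> = space M" "space \<nu> = space M" using sets_eq_imp_space_eq[OF \<mu>(2)] sets_eq_imp_space_eq[OF \<nu>(2)] by auto
  have one: "\<bar>(\<integral>x. g x \<partial>\<mu>) - (\<integral>x. g x \<partial>\<nu>)\<bar> \<le> c" if g: "lip_fun M \<rho> 1 g" for g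
  \<comment> \<open>The distance is an infimum, so a coupling is taken that is optimal up to
    \<open>e\<close>.\<close>
  proof (rule field_le_epsilon)
    fix e :: real assume e: "e > 0"
    have "wasserstein \<rho> \<mu> \<nu> < ennreal (c + e)"
      using W(1) by (rule le_less_trans) (use W(2) e in \<open>simp add: ennreal_less_iff\<close>)
    then obtain P where P: "P \<in> couplings \<mu> \<nu>" "(\<integral>\<^sup>+ (x, y). ennreal (\<rho> x y) \<partial>P) < ennreal (c + e)"
      unfolding wasserstein_def INF_less_iff by blast
    have sets_P: "sets P = sets (\<mu> \<Otimes>\<^sub>M \<nu>)" and prob_P: "prob_space P"
      and fst_P: "distr P \<mu> fst = \<mu>" and snd_P: "distr P \<nu> snd = \<nu>"
      using P(1) by (auto simp: couplings_def space_prob_algebra)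
    interpret P: prob_space P by fact
    have g_meas: "g \<in> borel_measurable \<mu>" "g \<in> borel_measurable \<nu>"
      using g measurable_cong_sets[OF \<mu>(2) refl] measurable_cong_sets[OF \<nu>(2) refl]
      by (auto simp: lip_fun_def)
    have fs: "fst \<in> P \<rightarrow>\<^sub>M \<mu>" "snd \<in> P \<rightarrow>\<^sub>M \<nu>"
      unfolding measurable_cong_sets[OF sets_P refl] by (rule measurable_fst measurable_snd)+
    have i1: "(\<integral>x. g x \<partial>\<mu>) = (\<integral>p. g (fst p) \<partial>P)"
      by (subst fst_P[symmetric]) (rule integral_distr[OF fs(1) g_meas(1)])
    have i2: "(\<integral>x. g x \<partial>\<nu>) = (\<integral>p. g (snd p) \<partial>P)"
      by (subst snd_P[symmetric]) (rule integral_distr[OF fs(2) g_meas(2)])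
    have int1: "integrable P (\<lambda>p. g (fst p))"
      using lip_fun_integrable[OF g _ \<mu>] integrable_distr_eq[OF fs(1) g_meas(1)] unfolding fst_P by simp
    have int2: "integrable P (\<lambda>p. g (snd p))"
      using lip_fun_integrable[OF g _ \<nu>] integrable_distr_eq[OF fs(2) g_meas(2)] unfolding snd_P by simp
    have "\<bar>(\<integral>x. g x \<partial>\<mu>) - (\<integral>x. g x \<partial>\<nu>)\<bar> = \<bar>\<integral>p. g (fst p) - g (snd p) \<partial>P\<bar>"
      using int1 int2 by (simp add: i1 i2)
    also have "\<dots> \<le> (\<integral>p. \<bar>g (fst p) - g (snd p)\<bar> \<partial>P)"
      using integral_norm_bound[of P "\<lambda>p. g (fst p) - g (snd p)"] by simp
    finally have "ennreal \<bar>(\<integral>x. g x \<partial>\<mu>) - (\<integral>x. g x \<partial>\<nu>)\<bar> \<le> ennreal (\<integral>p. \<bar>g (fst p) - g (snd p)\<bar> \<partial>P)"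
      by (rule ennreal_leI)
    moreover have "(\<integral>\<^sup>+p. ennreal \<bar>g (fst p) - g (snd p)\<bar> \<partial>P) = ennreal (\<integral>p. \<bar>g (fst p) - g (snd p)\<bar> \<partial>P)"
      by (rule nn_integral_eq_integral[OF integrable_abs[OF Bochner_Integration.integrable_diff[OF int1 int2]]]) simp
    moreover have "(\<integral>\<^sup>+p. ennreal \<bar>g (fst p) - g (snd p)\<bar> \<partial>P) \<le> (\<integral>\<^sup>+ (x, y). ennreal (\<rho> x y) \<partial>P)"
    proof (rule nn_integral_mono)
      fix p assume "p \<in> space P"
      then have "fst p \<in> space M" "snd p \<in> space M"
        unfolding sets_eq_imp_space_eq[OF sets_P] by (auto simp: space_pair_measure sp)
      then show "ennreal \<bar>g (fst p) - g (snd p)\<bar> \<le> (case p of (x, y) \<Rightarrow> ennreal (\<rho> x y))"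
        using g by (auto simp: lip_fun_def split_beta' intro!: ennreal_leI)
    qed
    ultimately have "ennreal \<bar>(\<integral>x. g x \<partial>\<mu>) - (\<integral>x. g x \<partial>\<nu>)\<bar> \<le> ennreal (c + e)"
      using P(2) by (metis (no_types, lifting) less_imp_le order_trans)
    then show "\<bar>(\<integral>x. g x \<partial>\<mu>) - (\<integral>x. g x \<partial>\<nu>)\<bar> \<le> c + e"
      using W(2) e by (subst (asm) ennreal_le_iff) auto
  qed
  show ?thesis
  \<comment> \<open>The case \<open>l = 0\<close> cannot be reached by scaling; \<open>f\<close> is
    then constant.\<close>
  proof (cases "l = 0")
    case True
    obtain x0 where x0: "x0 \<in> space M" using \<mu>.not_empty sp by auto
    have const: "f x = f x0" if "x \<in> space M" for x
    proof -
      have "\<bar>f x - f x0\<bar> \<le> 0 * \<rho> x x0" using f(1) that x0 unfolding lip_fun_def True by blast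
      then show ?thesis by simp
    qed
    have "(\<integral>x. f x \<partial>\<mu>) = (\<integral>x. f x0 \<partial>\<mu>)" "(\<integral>x. f x \<partial>\<nu>) = (\<integral>x. f x0 \<partial>\<nu>)"
      by (rule Bochner_Integration.integral_cong[OF refl], use const sp in blast)+
    then show ?thesis by (simp add: True \<mu>.prob_space \<nu>.prob_space)
  next
    case False
    then have l: "l > 0" using f(2) by simp
    have "lip_fun M \<rho> 1 (\<lambda>x. f x / l)"
      using f(1) l by (auto simp: lip_fun_def diff_divide_distrib[symmetric] pos_divide_le_eq mult.commute)
    from one[OF this] have "\<bar>((\<integral>x. f x \<partial>\<mu>) - (\<integral>x. f x \<partial>\<nu>)) / l\<bar> \<le> c"
      by (simp add: diff_divide_distrib)
    then show ?thesis using l by (simp add: pos_divide_le_eq mult.commute)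
  qed
qed

text \<open>Telescoping over the levels: \<open>g \<circ> q j\<close> and
  \<open>g \<circ> q (j - 1)\<close> differ by at most l (1/2)^(j-1), whence the factor 2. The
  family is summed before absolute values are taken, so that the cancellation between different
  \<open>i\<close> is kept; this is what makes the random fluctuations small later.\<close>

lemma chaining:
  assumes I: "finite I" and a: "\<And>i. i \<in> I \<Longrightarrow> prob_space (a i) \<and> sets (a i) = sets M"
    and b: "\<And>i. i \<in> I \<Longrightarrow> prob_space (b i) \<and> sets (b i) = sets M"
    and g: "lip_fun M \<rho> l g" "l \<ge> 0"
  shows "\<bar>\<Sum>i\<in>I. (\<integral>x. g x \<partial>a i) - (\<integral>x. g x \<partial>b i)\<bar> \<le>
    l * (real (card I) * (2 * (1/2) ^ J) + (\<Sum>j\<le>J. 2 * (1/2) ^ j *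
      (\<Sum>z\<in>G j. \<bar>\<Sum>i\<in>I. measure (a i) (cell j z) - measure (b i) (cell j z)\<bar>)))"
proof (cases "I = {}")
  case True then show ?thesis using g(2) by (simp add: sum_nonneg)
next
  case False
  then obtain i0 where i0: "i0 \<in> I" by auto
  obtain x0 where x0: "x0 \<in> space M"
    using prob_space.not_empty[of "a i0"] a[OF i0] sets_eq_imp_space_eq[of "a i0" M] by auto
  define D where "D j z = (\<Sum>i\<in>I. measure (a i) (cell j z) - measure (b i) (cell j z))" for j z
  define S where "S j = (\<Sum>z\<in>G j. \<bar>D j z\<bar>)" for j
  define \<Delta> where "\<Delta> h = (\<Sum>i\<in>I. (\<integral>x. h x \<partial>a i) - (\<integral>x. h x \<partial>b i))" for h :: "'a \<Rightarrow> real"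
  have \<Delta>q: "\<Delta> (\<lambda>x. h (q j x)) = (\<Sum>z\<in>G j. h z * D j z)" for h j
  proof -
    have "\<Delta> (\<lambda>x. h (q j x)) = (\<Sum>i\<in>I. \<Sum>z\<in>G j. h z * (measure (a i) (cell j z) - measure (b i) (cell j z)))"
      unfolding \<Delta>_def using a b
      by (intro sum.cong refl) (simp add: integral_comp_q(2) sum_subtractf right_diff_distrib)
    also have "\<dots> = (\<Sum>z\<in>G j. h z * D j z)"
      by (subst sum.swap) (simp add: D_def sum_distrib_left)
    finally show ?thesis .
  qed
  have bnd: "\<bar>\<Sum>z\<in>G j. h z * D j z\<bar> \<le> c * S j" if "\<And>z. z \<in> G j \<Longrightarrow> \<bar>h z\<bar> \<le> c" for h c j
  proof -
    have "\<bar>\<Sum>z\<in>G j. h z * D j z\<bar> \<le> (\<Sum>z\<in>G j. \<bar>h z\<bar> * \<bar>D j z\<bar>)"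
      using sum_abs[of "\<lambda>z. h z * D j z" "G j"] by (simp add: abs_mult)
    also have "\<dots> \<le> (\<Sum>z\<in>G j. c * \<bar>D j z\<bar>)" using that by (intro sum_mono mult_right_mono) auto
    finally show ?thesis by (simp add: S_def sum_distrib_left)
  qed
  have main: "\<bar>\<Delta> (\<lambda>x. g (q J x))\<bar> \<le> l * (\<Sum>j\<le>J. 2 * (1/2) ^ j * S j)" for J
  proof (induction J)
    case 0
    \<comment> \<open>At the coarsest level there is no previous one to subtract. Equal total masses
      allow \<open>g\<close> to be centred at \<open>x0\<close> instead, and the diameter is at most
      1.\<close>
    have "(\<Sum>z\<in>G 0. D 0 z) = 0"
      using \<Delta>q[of "\<lambda>_. 1" 0] a b by (simp add: \<Delta>_def prob_space.prob_space)
    then have "\<Delta> (\<lambda>x. g (q 0 x)) = (\<Sum>z\<in>G 0. (g z - g x0) * D 0 z)"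
      by (simp add: \<Delta>q left_diff_distrib sum_subtractf sum_distrib_left[symmetric])
    moreover have "\<bar>\<Sum>z\<in>G 0. (g z - g x0) * D 0 z\<bar> \<le> (2 * l) * S 0"
    proof (rule bnd)
      fix z assume "z \<in> G 0"
      then have z: "z \<in> space M" using G_space by auto
      have "\<bar>g z - g x0\<bar> \<le> l * \<rho> z x0" using g(1) z x0 by (auto simp: lip_fun_def)
      also have "\<dots> \<le> l" using dist_le_1[OF z x0] g(2) by (simp add: mult_left_le)
      finally show "\<bar>g z - g x0\<bar> \<le> 2 * l" using g(2) by simp
    qed
    ultimately show ?case by simp
  next
    case (Suc J)
    \<comment> \<open>Nestedness lets the coarse level be written as a sum over the cells of the
      fine one.\<close>
    have "\<Delta> (\<lambda>x. g (q J x)) = \<Delta> (\<lambda>x. g (q J (q (Suc J) x)))"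
      unfolding \<Delta>_def
    proof (intro sum.cong refl arg_cong2[where f="(-)"] Bochner_Integration.integral_cong)
      fix i x assume "i \<in> I" "x \<in> space (a i)"
      then show "g (q J x) = g (q J (q (Suc J) x))" using a sets_eq_imp_space_eq[of "a i" M] q_q[of J "Suc J" x] by auto
    next
      fix i x assume "i \<in> I" "x \<in> space (b i)"
      then show "g (q J x) = g (q J (q (Suc J) x))" using b sets_eq_imp_space_eq[of "b i" M] q_q[of J "Suc J" x] by auto
    qed
    then have "\<Delta> (\<lambda>x. g (q J x)) = (\<Sum>z\<in>G (Suc J). g (q J z) * D (Suc J) z)"
      using \<Delta>q[of "\<lambda>x. g (q J x)" "Suc J"] by simp
    then have "\<Delta> (\<lambda>x. g (q (Suc J) x)) = \<Delta> (\<lambda>x. g (q J x)) + (\<Sum>z\<in>G (Suc J). (g z - g (q J z)) * D (Suc J) z)"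
      by (simp add: \<Delta>q left_diff_distrib sum_subtractf)
    moreover have "\<bar>\<Sum>z\<in>G (Suc J). (g z - g (q J z)) * D (Suc J) z\<bar> \<le> (l * (1/2) ^ J) * S (Suc J)"
    proof (rule bnd)
      fix z assume "z \<in> G (Suc J)"
      then have z: "z \<in> space M" using G_space by auto
      have "\<bar>g z - g (q J z)\<bar> \<le> l * \<rho> z (q J z)" using g(1) z q_space[OF z] by (auto simp: lip_fun_def)
      also have "\<dots> \<le> l * (1/2) ^ J" using dist_q[OF z] g(2) by (rule mult_left_mono)
      finally show "\<bar>g z - g (q J z)\<bar> \<le> l * (1/2) ^ J" .
    qed
    ultimately show ?case using Suc.IH by (simp add: algebra_simps)
  qed
  have "\<bar>\<Delta> g - \<Delta> (\<lambda>x. g (q J x))\<bar> \<le> real (card I) * (l * (2 * (1/2) ^ J))"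
  proof -
    have "\<Delta> g - \<Delta> (\<lambda>x. g (q J x)) = (\<Sum>i\<in>I. ((\<integral>x. g x \<partial>a i) - (\<integral>x. g (q J x) \<partial>a i)) - ((\<integral>x. g x \<partial>b i) - (\<integral>x. g (q J x) \<partial>b i)))"
      by (simp add: \<Delta>_def sum_subtractf)
    also have "\<bar>\<dots>\<bar> \<le> (\<Sum>i\<in>I. \<bar>((\<integral>x. g x \<partial>a i) - (\<integral>x. g (q J x) \<partial>a i)) - ((\<integral>x. g x \<partial>b i) - (\<integral>x. g (q J x) \<partial>b i))\<bar>)"
      by (rule sum_abs)
    also have "\<dots> \<le> (\<Sum>i\<in>I. l * (2 * (1/2) ^ J))"
    proof (rule sum_mono)
      fix i assume i: "i \<in> I"
      have "\<bar>(\<integral>x. g (q J x) \<partial>a i) - (\<integral>x. g x \<partial>a i)\<bar> \<le> l * (1/2) ^ J"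
        using lip_fun_integral_q[OF g] a[OF i] by blast
      moreover have "\<bar>(\<integral>x. g (q J x) \<partial>b i) - (\<integral>x. g x \<partial>b i)\<bar> \<le> l * (1/2) ^ J"
        using lip_fun_integral_q[OF g] b[OF i] by blast
      ultimately show "\<bar>((\<integral>x. g x \<partial>a i) - (\<integral>x. g (q J x) \<partial>a i)) - ((\<integral>x. g x \<partial>b i) - (\<integral>x. g (q J x) \<partial>b i))\<bar> \<le> l * (2 * (1/2) ^ J)"
        by (simp add: algebra_simps)
    qed
    finally show ?thesis by simp
  qed
  then show ?thesis using main[of J] unfolding \<Delta>_def[symmetric] S_def D_def
    by (simp add: algebra_simps)
qed

end

section \<open>Dyadic quantisation of cubes\<close>

type_synonym point = "nat \<Rightarrow> nat \<Rightarrow> real"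

definition dyadic :: "nat \<Rightarrow> real \<Rightarrow> real" where
  "dyadic j t = of_int \<lfloor>2 ^ j * t\<rfloor> / 2 ^ j"

text \<open>Rounding down fixes 1, so the right end point belongs to the grid; this gives
  \<open>2 ^ j + 1\<close> points, later bounded by \<open>2 * 2 ^ j\<close>.\<close>

definition dyadic_grid :: "nat \<Rightarrow> real set" where
  "dyadic_grid j = (\<lambda>k::int. of_int k / 2 ^ j) ` {0..2 ^ j}"

definition cube_q :: "nat \<Rightarrow> nat \<Rightarrow> (nat \<Rightarrow> real) \<Rightarrow> nat \<Rightarrow> real" where
  "cube_q m j x = restrict (\<lambda>i. dyadic j (x i)) {..<m}"

definition cube_grid :: "nat \<Rightarrow> nat \<Rightarrow> (nat \<Rightarrow> real) set" where
  "cube_grid m j = (\<Pi>\<^sub>E i\<in>{..<m}. dyadic_grid j)"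

definition blocks_q :: "(nat \<Rightarrow> nat) \<Rightarrow> nat set \<Rightarrow> nat \<Rightarrow> point \<Rightarrow> nat \<Rightarrow> nat \<Rightarrow> real" where
  "blocks_q d I j x = restrict (\<lambda>k. cube_q (d k) j (x k)) I"

definition blocks_grid :: "(nat \<Rightarrow> nat) \<Rightarrow> nat set \<Rightarrow> nat \<Rightarrow> point set" where
  "blocks_grid d I j = (\<Pi>\<^sub>E k\<in>I. cube_grid (d k) j)"

lemma dyadic_in_grid:
  assumes "0 \<le> t" "t \<le> 1"
  shows "dyadic j t \<in> dyadic_grid j"
proof -
  have "\<lfloor>2 ^ j * t\<rfloor> \<in> {0..2 ^ j}"
    using assms by (auto simp: floor_le_iff mult_left_le le_less_trans[of _ "2 ^ j"])
  then show ?thesis by (auto simp: dyadic_def dyadic_grid_def)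
qed

lemma dyadic_grid_subset: "dyadic_grid j \<subseteq> {0..1}"
proof -
  have "0 \<le> real_of_int k \<and> real_of_int k \<le> 2 ^ j" if "k \<in> {0..2 ^ j}" for k :: int
  proof -
    have "real_of_int k \<le> real_of_int (2 ^ j)" using that by (simp del: of_int_power)
    then show ?thesis using that by simp
  qed
  then show ?thesis by (auto simp: dyadic_grid_def)
qed

lemma abs_diff_dyadic: "\<bar>t - dyadic j t\<bar> \<le> (1/2) ^ j"
proof -
  have "\<bar>2 ^ j * t - of_int \<lfloor>2 ^ j * t\<rfloor>\<bar> \<le> 1" by linarith
  then have "\<bar>2 ^ j * t - of_int \<lfloor>2 ^ j * t\<rfloor>\<bar> / 2 ^ j \<le> 1 / 2 ^ j" by (simp add: divide_right_mono)
  moreover have "t - dyadic j t = (2 ^ j * t - of_int \<lfloor>2 ^ j * t\<rfloor>) / 2 ^ j" by (simp add: dyadic_def field_simps)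
  ultimately show ?thesis by (simp add: power_one_over)
qed

text \<open>Dividing by a power of two and rounding down gives the same result whether or not the
  number was rounded down to an integer before.\<close>

lemma dyadic_dyadic:
  assumes "i \<le> j"
  shows "dyadic i (dyadic j t) = dyadic i t"
proof -
  obtain r where j: "j = i + r" using assms le_Suc_ex by blast
  define s where "s = 2 ^ j * t"
  have "2 ^ i * t = s / real_of_int (2 ^ r)" by (simp add: s_def j power_add)
  then have "\<lfloor>2 ^ i * t\<rfloor> = \<lfloor>s\<rfloor> div 2 ^ r"
    using floor_divide_real_eq_div[of "2 ^ r" s] by simp
  moreover have "2 ^ i * dyadic j t = real_of_int \<lfloor>s\<rfloor> / real_of_int (2 ^ r)"
    by (simp add: dyadic_def s_def j power_add)
  then have "\<lfloor>2 ^ i * dyadic j t\<rfloor> = \<lfloor>s\<rfloor> div 2 ^ r"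
    by (simp only: floor_divide_of_int_eq)
  ultimately show ?thesis by (simp add: dyadic_def)
qed

lemma finite_dyadic_grid: "finite (dyadic_grid j)"
  by (simp add: dyadic_grid_def)

lemma card_dyadic_grid: "card (dyadic_grid j) \<le> 2 * 2 ^ j"
proof -
  have "card (dyadic_grid j) \<le> card {0..(2::int) ^ j}" unfolding dyadic_grid_def by (rule card_image_le) simp
  also have "\<dots> = 2 ^ j + 1" by (simp add: nat_add_distrib nat_power_eq)
  also have "\<dots> \<le> 2 * 2 ^ j" by simp
  finally show ?thesis .
qed

lemma space_cube: "space (cube m) = (\<Pi>\<^sub>E i\<in>{..<m}. {0..1})"
  by (simp add: cube_def space_PiM space_restrict_space)

lemma space_blocks: "space (blocks d I) = (\<Pi>\<^sub>E k\<in>I. space (cube (d k)))"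
  by (simp add: blocks_def space_PiM)

lemma cube_dist_le_iff: "cube_dist m x y \<le> c \<longleftrightarrow> 0 \<le> c \<and> (\<forall>i<m. \<bar>x i - y i\<bar> \<le> c)"
  unfolding cube_dist_def by (subst Max_le_iff) auto

lemma blocks_dist_le_iff:
  "finite I \<Longrightarrow> blocks_dist d I x y \<le> c \<longleftrightarrow> 0 \<le> c \<and> (\<forall>k\<in>I. cube_dist (d k) (x k) (y k) \<le> c)"
  unfolding blocks_dist_def by (subst Max_le_iff) auto

lemma abs_le_cube_dist: "i < m \<Longrightarrow> \<bar>x i - y i\<bar> \<le> cube_dist m x y"
  using cube_dist_le_iff[of m x y "cube_dist m x y"] by simp

lemma cube_dist_le_blocks_dist:
  "finite I \<Longrightarrow> k \<in> I \<Longrightarrow> cube_dist (d k) (x k) (y k) \<le> blocks_dist d I x y"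
  using blocks_dist_le_iff[of I d x y "blocks_dist d I x y"] by simp

lemma cube_dist_nonneg: "0 \<le> cube_dist m x y"
  using cube_dist_le_iff[of m x y "cube_dist m x y"] by simp

lemma blocks_dist_nonneg: "finite I \<Longrightarrow> 0 \<le> blocks_dist d I x y"
  using blocks_dist_le_iff[of I d x y "blocks_dist d I x y"] by simp

lemma measurable_cube_component: "i < m \<Longrightarrow> (\<lambda>x. x i) \<in> borel_measurable (cube m)"
  unfolding cube_def
  by (rule measurable_compose[OF measurable_component_singleton]) (auto intro: measurable_restrict_space1)

lemma measurable_blocks_component: "k \<in> I \<Longrightarrow> (\<lambda>x. x k) \<in> blocks d I \<rightarrow>\<^sub>M cube (d k)"
  unfolding blocks_def by (rule measurable_component_singleton)

lemma cube_dist_measurable: "(\<lambda>x. cube_dist m x z) \<in> borel_measurable (cube m)"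
proof (rule borel_measurableI_le)
  fix c
  have "{x \<in> space (cube m). cube_dist m x z \<le> c} =
    {x \<in> space (cube m). 0 \<le> c \<and> (\<forall>i\<in>{..<m}. \<bar>x i - z i\<bar> \<le> c)}"
    by (auto simp: cube_dist_le_iff)
  also have "\<dots> \<in> sets (cube m)"
  proof -
    have [measurable]: "(\<lambda>x. x i) \<in> borel_measurable (cube m)" if "i \<in> {..<m}" for i
      using measurable_cube_component that by simp
    show ?thesis by measurable
  qed
  finally show "{x \<in> space (cube m). cube_dist m x z \<le> c} \<in> sets (cube m)" .
qed

lemma blocks_dist_measurable:
  assumes "finite I"
  shows "(\<lambda>x. blocks_dist d I x z) \<in> borel_measurable (blocks d I)"
proof (rule borel_measurableI_le)
  fix c
  have "{x \<in> space (blocks d I). blocks_dist d I x z \<le> c} =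
    {x \<in> space (blocks d I). 0 \<le> c \<and> (\<forall>k\<in>I. cube_dist (d k) (x k) (z k) \<le> c)}"
    using assms by (auto simp: blocks_dist_le_iff)
  also have "\<dots> \<in> sets (blocks d I)"
  proof -
    have [measurable]: "(\<lambda>x. cube_dist (d k) (x k) (z k)) \<in> borel_measurable (blocks d I)" if "k \<in> I" for k
      by (rule measurable_compose[OF measurable_blocks_component[OF that] cube_dist_measurable])
    show ?thesis using assms by measurable
  qed
  finally show "{x \<in> space (blocks d I). blocks_dist d I x z \<le> c} \<in> sets (blocks d I)" .
qed

lemma quantized_cube: "quantized (cube m) (cube_dist m) (cube_q m) (cube_grid m)"
proof
  show "finite (cube_grid m j)" for j
    unfolding cube_grid_def by (intro finite_PiE) (auto simp: finite_dyadic_grid)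
  show "cube_q m j x \<in> cube_grid m j" if "x \<in> space (cube m)" for x j
    using that by (auto simp: space_cube cube_grid_def cube_q_def PiE_iff intro!: dyadic_in_grid)
  show "cube_grid m j \<subseteq> space (cube m)" for j
    unfolding cube_grid_def space_cube by (intro PiE_mono dyadic_grid_subset)
  show "cube_q m j -` {z} \<inter> space (cube m) \<in> sets (cube m)" for j z
  proof -
    have [measurable]: "(\<lambda>x. x i) \<in> borel_measurable (cube m)" if "i \<in> {..<m}" for i
      using measurable_cube_component that by simp
    have "cube_q m j -` {z} \<inter> space (cube m) =
      {x \<in> space (cube m). z \<in> extensional {..<m} \<and> (\<forall>i\<in>{..<m}. dyadic j (x i) = z i)}"
      by (auto simp: cube_q_def fun_eq_iff restrict_def extensional_def)
    also have "\<dots> \<in> sets (cube m)" unfolding dyadic_def by measurable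
    finally show ?thesis .
  qed
  show "cube_dist m x (cube_q m j x) \<le> (1/2) ^ j" for x j
    by (simp add: cube_dist_le_iff cube_q_def abs_diff_dyadic)
  show "cube_q m i (cube_q m j x) = cube_q m i x" if "i \<le> j" for i j x
    using that by (auto simp: cube_q_def dyadic_dyadic)
  show "cube_dist m x x = 0" for x
    by (intro antisym cube_dist_nonneg) (simp add: cube_dist_le_iff)
  show "cube_dist m x y = cube_dist m y x" for x y
    by (simp add: cube_dist_def abs_minus_commute)
  show "cube_dist m x z \<le> cube_dist m x y + cube_dist m y z" for x y z
  proof -
    have "\<bar>x i - z i\<bar> \<le> cube_dist m x y + cube_dist m y z" if "i < m" for i
      using abs_le_cube_dist[OF that, of x y] abs_le_cube_dist[OF that, of y z] by linarith
    then show ?thesis by (simp add: cube_dist_le_iff cube_dist_nonneg)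
  qed
  show "0 \<le> cube_dist m x y" for x y by (rule cube_dist_nonneg)
  show "cube_dist m x y \<le> 1" if "x \<in> space (cube m)" "y \<in> space (cube m)" for x y
  proof -
    have "\<bar>x i - y i\<bar> \<le> 1" if "i < m" for i
    proof -
      have "x i \<in> {0..1}" "y i \<in> {0..1}"
        using \<open>x \<in> _\<close> \<open>y \<in> _\<close> that by (auto simp: space_cube PiE_iff)
      then show ?thesis by auto
    qed
    then show ?thesis by (simp add: cube_dist_le_iff)
  qed
  show "(\<lambda>x. cube_dist m x z) \<in> borel_measurable (cube m)" for z by (rule cube_dist_measurable)
qed

lemma quantized_blocks:
  assumes I: "finite I"
  shows "quantized (blocks d I) (blocks_dist d I) (blocks_q d I) (blocks_grid d I)"
proof
  interpret c: quantized "cube m" "cube_dist m" "cube_q m" "cube_grid m" for m by (rule quantized_cube)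
  note le_iff = blocks_dist_le_iff[OF I]
  show "finite (blocks_grid d I j)" for j
    unfolding blocks_grid_def using I by (intro finite_PiE c.finite_G)
  show "blocks_q d I j x \<in> blocks_grid d I j" if "x \<in> space (blocks d I)" for x j
    using that by (auto simp: space_blocks blocks_grid_def blocks_q_def PiE_iff intro!: c.q_in)
  show "blocks_grid d I j \<subseteq> space (blocks d I)" for j
    unfolding blocks_grid_def space_blocks by (intro PiE_mono c.G_space)
  show "blocks_q d I j -` {z} \<inter> space (blocks d I) \<in> sets (blocks d I)" for j z
  proof -
    have [measurable]: "{x \<in> space (blocks d I). cube_q (d k) j (x k) = z k} \<in> sets (blocks d I)" if "k \<in> I" for k
    proof -
      have "(\<lambda>x. x k) -` (cube_q (d k) j -` {z k} \<inter> space (cube (d k))) \<inter> space (blocks d I) \<in> sets (blocks d I)"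
        by (rule measurable_sets[OF measurable_blocks_component[OF that]]) (rule c.q_cell)
      also have "(\<lambda>x. x k) -` (cube_q (d k) j -` {z k} \<inter> space (cube (d k))) \<inter> space (blocks d I) =
        {x \<in> space (blocks d I). cube_q (d k) j (x k) = z k}"
        using that by (auto simp: space_blocks PiE_iff extensional_def)
      finally show ?thesis .
    qed
    have "blocks_q d I j -` {z} \<inter> space (blocks d I) =
      {x \<in> space (blocks d I). z \<in> extensional I \<and> (\<forall>k\<in>I. cube_q (d k) j (x k) = z k)}"
      by (auto simp: blocks_q_def fun_eq_iff restrict_def extensional_def)
    also have "\<dots> \<in> sets (blocks d I)" using I by measurable
    finally show ?thesis .
  qed
  show "blocks_dist d I x (blocks_q d I j x) \<le> (1/2) ^ j" if "x \<in> space (blocks d I)" for x j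
    using that by (auto simp: le_iff blocks_q_def space_blocks PiE_iff intro!: c.dist_q)
  show "blocks_q d I i (blocks_q d I j x) = blocks_q d I i x" if "i \<le> j" "x \<in> space (blocks d I)" for i j x
    using that by (auto simp: blocks_q_def space_blocks PiE_iff c.q_q intro!: restrict_ext)
  show "blocks_dist d I x x = 0" if "x \<in> space (blocks d I)" for x
    using that by (intro antisym blocks_dist_nonneg I) (auto simp: le_iff space_blocks PiE_iff c.dist_refl)
  show "blocks_dist d I x y = blocks_dist d I y x" for x y
    by (simp add: blocks_dist_def cube_dist_def abs_minus_commute)
  show "blocks_dist d I x z \<le> blocks_dist d I x y + blocks_dist d I y z"
    if "x \<in> space (blocks d I)" "y \<in> space (blocks d I)" "z \<in> space (blocks d I)" for x y z
  proof -
    have "cube_dist (d k) (x k) (z k) \<le> blocks_dist d I x y + blocks_dist d I y z" if "k \<in> I" for k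
    proof -
      have "x k \<in> space (cube (d k))" "y k \<in> space (cube (d k))" "z k \<in> space (cube (d k))"
        using \<open>x \<in> _\<close> \<open>y \<in> _\<close> \<open>z \<in> _\<close> that by (auto simp: space_blocks PiE_iff)
      then have "cube_dist (d k) (x k) (z k) \<le> cube_dist (d k) (x k) (y k) + cube_dist (d k) (y k) (z k)"
        by (rule c.dist_tri)
      also have "\<dots> \<le> blocks_dist d I x y + blocks_dist d I y z"
        using that I by (intro add_mono cube_dist_le_blocks_dist)
      finally show ?thesis .
    qed
    then show ?thesis by (simp add: le_iff blocks_dist_nonneg I)
  qed
  show "0 \<le> blocks_dist d I x y" for x y by (rule blocks_dist_nonneg[OF I])
  show "blocks_dist d I x y \<le> 1" if "x \<in> space (blocks d I)" "y \<in> space (blocks d I)" for x y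
    using that by (auto simp: le_iff space_blocks PiE_iff intro!: c.dist_le_1)
  show "(\<lambda>x. blocks_dist d I x z) \<in> borel_measurable (blocks d I)" for z by (rule blocks_dist_measurable[OF I])
qed

lemma card_cube_grid: "card (cube_grid m j) \<le> (2 * 2 ^ j) ^ m"
proof -
  have "card (cube_grid m j) = card (dyadic_grid j) ^ m"
    unfolding cube_grid_def by (simp add: card_PiE)
  then show ?thesis using power_mono[OF card_dyadic_grid[of j], of m] by simp
qed

lemma card_blocks_grid:
  assumes "finite I"
  shows "card (blocks_grid d I j) \<le> (2 * 2 ^ j) ^ (\<Sum>k\<in>I. d k)"
proof -
  have "card (blocks_grid d I j) = (\<Prod>k\<in>I. card (cube_grid (d k) j))"
    unfolding blocks_grid_def using assms by (simp add: card_PiE)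
  also have "\<dots> \<le> (\<Prod>k\<in>I. (2 * 2 ^ j) ^ d k)" by (intro prod_mono conjI card_cube_grid) auto
  finally show ?thesis by (simp add: power_sum)
qed

section \<open>Sums of orthogonal functions of an i.i.d. sample\<close>

lemma (in prob_space) expectation_abs_le_sqrt:
  fixes Z :: "'a \<Rightarrow> real"
  assumes "Z \<in> borel_measurable M" "\<And>x. x \<in> space M \<Longrightarrow> \<bar>Z x\<bar> \<le> B"
  shows "expectation (\<lambda>x. \<bar>Z x\<bar>) \<le> sqrt (expectation (\<lambda>x. (Z x)\<^sup>2))"
proof -
  have 1: "integrable M (\<lambda>x. \<bar>Z x\<bar>)"
    using assms by (intro integrable_const_bound[where B=B]) auto
  have 2: "integrable M (\<lambda>x. \<bar>Z x\<bar>\<^sup>2)"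
  proof (rule integrable_const_bound[where B="B\<^sup>2"])
    show "AE x in M. norm (\<bar>Z x\<bar>\<^sup>2) \<le> B\<^sup>2"
      by (intro AE_I2) (auto simp: abs_le_square_iff[symmetric] intro: order_trans[OF assms(2) abs_ge_self])
  qed (use assms(1) in auto)
  have "(expectation (\<lambda>x. \<bar>Z x\<bar>))\<^sup>2 \<le> expectation (\<lambda>x. \<bar>Z x\<bar>\<^sup>2)"
    using variance_eq[OF 1 2] variance_positive[of "\<lambda>x. \<bar>Z x\<bar>"] by linarith
  then show ?thesis by (intro real_le_rsqrt) simp
qed

lemma PiM_const_integral_split:
  fixes f :: "('i \<Rightarrow> 'a) \<Rightarrow> real"
  assumes "prob_space \<mu>" "finite N" "j \<in> N"
    and f: "f \<in> borel_measurable (\<Pi>\<^sub>M i\<in>N. \<mu>)" "\<And>X. X \<in> space (\<Pi>\<^sub>M i\<in>N. \<mu>) \<Longrightarrow> \<bar>f X\<bar> \<le> B"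
  shows "(\<integral>X. f X \<partial>(\<Pi>\<^sub>M i\<in>N. \<mu>)) = (\<integral>X. (\<integral>y. f (X(j := y)) \<partial>\<mu>) \<partial>(\<Pi>\<^sub>M i\<in>N - {j}. \<mu>))"
proof -
  interpret prob_space \<mu> by fact
  interpret product_prob_space "\<lambda>_. \<mu>" N by standard
  interpret P: prob_space "\<Pi>\<^sub>M i\<in>N. \<mu>" by (intro prob_space_PiM assms)
  have ins: "insert j (N - {j}) = N" using assms(3) by auto
  have "integrable (\<Pi>\<^sub>M i\<in>N. \<mu>) f"
    using f by (intro P.integrable_const_bound[where B=B]) auto
  then show ?thesis
    using product_integral_insert[of "N - {j}" j f, unfolded ins] assms(2) by simp
qed

text \<open>Integrating the coordinate \<open>j\<close> first annihilates every mixed product, so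
  only the diagonal of the squared sum survives. The \<open>g i\<close> may depend on coordinates
  outside \<open>S\<close>, as the test functions fitted on the other half of the sample
  will.\<close>

lemma PiM_orthogonal_sum:
  fixes g :: "'i \<Rightarrow> ('i \<Rightarrow> 'a) \<Rightarrow> real"
  assumes \<mu>: "prob_space \<mu>" and N: "finite N" "S \<subseteq> N"
    and meas: "\<And>i. i \<in> S \<Longrightarrow> g i \<in> borel_measurable (\<Pi>\<^sub>M i\<in>N. \<mu>)"
    and bound: "\<And>i X. i \<in> S \<Longrightarrow> X \<in> space (\<Pi>\<^sub>M i\<in>N. \<mu>) \<Longrightarrow> \<bar>g i X\<bar> \<le> B"
    and indep: "\<And>i j X y. i \<in> S \<Longrightarrow> j \<in> S \<Longrightarrow> i \<noteq> j \<Longrightarrow> X \<in> space (\<Pi>\<^sub>M i\<in>N. \<mu>) \<Longrightarrow>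
      y \<in> space \<mu> \<Longrightarrow> g i (X(j := y)) = g i X"
    and mean: "\<And>j X. j \<in> S \<Longrightarrow> X \<in> space (\<Pi>\<^sub>M i\<in>N. \<mu>) \<Longrightarrow> (\<integral>y. g j (X(j := y)) \<partial>\<mu>) = 0"
    and var: "\<And>i. i \<in> S \<Longrightarrow> (\<integral>X. (g i X)\<^sup>2 \<partial>(\<Pi>\<^sub>M i\<in>N. \<mu>)) \<le> v"
  shows "(\<integral>X. \<bar>\<Sum>i\<in>S. g i X\<bar> \<partial>(\<Pi>\<^sub>M i\<in>N. \<mu>)) \<le> sqrt (real (card S) * v)"
proof -
  interpret prob_space \<mu> by fact
  interpret P: prob_space "\<Pi>\<^sub>M i\<in>N. \<mu>" by (intro prob_space_PiM \<mu>)
  have S: "finite S" using N finite_subset by auto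
  have int2: "integrable (\<Pi>\<^sub>M i\<in>N. \<mu>) (\<lambda>X. g i X * g j X)" if "i \<in> S" "j \<in> S" for i j
  proof (rule P.integrable_const_bound[where B="B * B"])
    show "AE X in \<Pi>\<^sub>M i\<in>N. \<mu>. norm (g i X * g j X) \<le> B * B"
      using bound that by (intro AE_I2) (auto simp: abs_mult intro!: mult_mono intro: order_trans[OF abs_ge_zero])
  qed (use meas that in auto)
  have orth: "(\<integral>X. g i X * g j X \<partial>(\<Pi>\<^sub>M i\<in>N. \<mu>)) = 0" if ij: "i \<in> S" "j \<in> S" "i \<noteq> j" for i j
  proof -
    have jN: "j \<in> N" using ij N by auto
    have "(\<integral>X. g i X * g j X \<partial>(\<Pi>\<^sub>M i\<in>N. \<mu>)) =
      (\<integral>X. (\<integral>y. g i (X(j := y)) * g j (X(j := y)) \<partial>\<mu>) \<partial>(\<Pi>\<^sub>M i\<in>N - {j}. \<mu>))"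
    proof (rule PiM_const_integral_split[OF \<mu> N(1) jN, where B="B * B"])
      show "\<bar>g i X * g j X\<bar> \<le> B * B" if "X \<in> space (\<Pi>\<^sub>M i\<in>N. \<mu>)" for X
        using bound[OF ij(1) that] bound[OF ij(2) that]
        by (auto simp: abs_mult intro!: mult_mono intro: order_trans[OF abs_ge_zero])
    qed (use meas ij in auto)
    also have "\<dots> = (\<integral>X. 0 \<partial>(\<Pi>\<^sub>M i\<in>N - {j}. \<mu>))"
    proof (rule Bochner_Integration.integral_cong[OF refl])
      fix X assume X: "X \<in> space (\<Pi>\<^sub>M i\<in>N - {j}. \<mu>)"
      obtain y0 where y0: "y0 \<in> space \<mu>" using not_empty by auto
      \<comment> \<open>The hypotheses concern points with all coordinates, so the missing one is
        filled in arbitrarily before it is overwritten by \<open>y\<close>.\<close>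
      define X' where "X' = X(j := y0)"
      have X': "X' \<in> space (\<Pi>\<^sub>M i\<in>N. \<mu>)"
        using X y0 jN by (auto simp: X'_def space_PiM PiE_iff extensional_def)
      have upd: "X(j := y) = X'(j := y)" for y by (simp add: X'_def)
      have "(\<integral>y. g i (X(j := y)) * g j (X(j := y)) \<partial>\<mu>) = (\<integral>y. g i X' * g j (X'(j := y)) \<partial>\<mu>)"
        unfolding upd using indep[OF ij X'] by (intro Bochner_Integration.integral_cong refl) simp
      then show "(\<integral>y. g i (X(j := y)) * g j (X(j := y)) \<partial>\<mu>) = 0"
        using mean[OF ij(2) X'] by simp
    qed
    finally show ?thesis by simp
  qed
  have "(\<integral>X. (\<Sum>i\<in>S. g i X)\<^sup>2 \<partial>(\<Pi>\<^sub>M i\<in>N. \<mu>)) = (\<integral>X. (\<Sum>i\<in>S. \<Sum>j\<in>S. g i X * g j X) \<partial>(\<Pi>\<^sub>M i\<in>N. \<mu>))"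
    by (simp add: power2_eq_square sum_product)
  also have "\<dots> = (\<Sum>i\<in>S. \<Sum>j\<in>S. \<integral>X. g i X * g j X \<partial>(\<Pi>\<^sub>M i\<in>N. \<mu>))"
    using int2 by (simp add: Bochner_Integration.integral_sum Bochner_Integration.integrable_sum)
  also have "\<dots> = (\<Sum>i\<in>S. \<Sum>j\<in>S. if j = i then \<integral>X. (g i X)\<^sup>2 \<partial>(\<Pi>\<^sub>M i\<in>N. \<mu>) else 0)"
    using orth by (intro sum.cong refl) (auto simp: power2_eq_square)
  also have "\<dots> = (\<Sum>i\<in>S. \<integral>X. (g i X)\<^sup>2 \<partial>(\<Pi>\<^sub>M i\<in>N. \<mu>))" using S by simp
  also have "\<dots> \<le> real (card S) * v" using sum_bounded_above[of S _ v] var by simp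
  finally have *: "(\<integral>X. (\<Sum>i\<in>S. g i X)\<^sup>2 \<partial>(\<Pi>\<^sub>M i\<in>N. \<mu>)) \<le> real (card S) * v" .
  have "(\<integral>X. \<bar>\<Sum>i\<in>S. g i X\<bar> \<partial>(\<Pi>\<^sub>M i\<in>N. \<mu>)) \<le> sqrt (\<integral>X. (\<Sum>i\<in>S. g i X)\<^sup>2 \<partial>(\<Pi>\<^sub>M i\<in>N. \<mu>))"
  proof (rule P.expectation_abs_le_sqrt)
    show "\<bar>\<Sum>i\<in>S. g i X\<bar> \<le> real (card S) * B" if "X \<in> space (\<Pi>\<^sub>M i\<in>N. \<mu>)" for X
      using order_trans[OF sum_abs sum_bounded_above[of S "\<lambda>i. \<bar>g i X\<bar>" B]] bound that by blast
  qed (use meas in auto)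
  also have "\<dots> \<le> sqrt (real (card S) * v)" using * by simp
  finally show ?thesis .
qed

section \<open>Kernels of a graph measure\<close>

text \<open>Keeps the index sets \<open>{1..m}\<close> of the blocks in that form.\<close>

declare One_nat_def [simp del]

lemma measurable_blocks_restrict: "J \<subseteq> I \<Longrightarrow> (\<lambda>x. restrict x J) \<in> blocks d I \<rightarrow>\<^sub>M blocks d J"
  unfolding blocks_def by (rule measurable_restrict_subset)

lemma measurable_blocks_update:
  "(\<lambda>(x, y). x(Suc m := y)) \<in> blocks d {1..m} \<Otimes>\<^sub>M cube (d (Suc m)) \<rightarrow>\<^sub>M blocks d {1..Suc m}"
proof -
  have "insert (Suc m) {1..m} = {1..Suc m}" by auto
  then show ?thesis
    using measurable_add_dim[of "Suc m" "{1..m}" "\<lambda>k. cube (d k)"] by (simp add: blocks_def)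
qed

lemma measurable_blocks_update1:
  "x \<in> space (blocks d {1..m}) \<Longrightarrow> (\<lambda>y. x(Suc m := y)) \<in> cube (d (Suc m)) \<rightarrow>\<^sub>M blocks d {1..Suc m}"
  using measurable_compose[OF measurable_Pair1' measurable_blocks_update, of x d m] by simp

lemma sorted_dag_pa: "sorted_dag K E \<Longrightarrow> pa E k \<subseteq> {1..<k}"
  unfolding sorted_dag_def pa_def by fastforce

locale graph_kernels =
  fixes d :: "nat \<Rightarrow> nat" and K :: nat and E :: "nat rel"
    and \<kappa> :: "nat \<Rightarrow> point \<Rightarrow> (nat \<Rightarrow> real) measure"
  assumes pa_sub: "\<And>k. pa E k \<subseteq> {1..<k}"
    and kernel: "\<And>k. k \<in> {1..K} \<Longrightarrow> \<kappa> k \<in> blocks d (pa E k) \<rightarrow>\<^sub>M prob_algebra (cube (d k))"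
begin

lemma pa_sub_Suc: "pa E (Suc m) \<subseteq> {1..m}"
  using pa_sub[of "Suc m"] by auto

lemma kernel_restrict:
  "m < K \<Longrightarrow> (\<lambda>x. \<kappa> (Suc m) (restrict x (pa E (Suc m)))) \<in> blocks d {1..m} \<rightarrow>\<^sub>M prob_algebra (cube (d (Suc m)))"
  by (rule measurable_compose[OF measurable_blocks_restrict[OF pa_sub_Suc] kernel]) auto

lemma kernel_props:
  assumes "k \<in> {1..K}" "x \<in> space (blocks d (pa E k))"
  shows "prob_space (\<kappa> k x)" "sets (\<kappa> k x) = sets (cube (d k))" "space (\<kappa> k x) = space (cube (d k))"
proof -
  have "\<kappa> k x \<in> space (prob_algebra (cube (d k)))"
    using measurable_space[OF kernel[OF assms(1)] assms(2)] .
  then show "prob_space (\<kappa> k x)" "sets (\<kappa> k x) = sets (cube (d k))" by (auto simp: space_prob_algebra)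
  from sets_eq_imp_space_eq[OF this(2)] show "space (\<kappa> k x) = space (cube (d k))" .
qed

lemma restrict_pa_space:
  "x \<in> space (blocks d {1..m}) \<Longrightarrow> restrict x (pa E (Suc m)) \<in> space (blocks d (pa E (Suc m)))"
  using measurable_space[OF measurable_blocks_restrict[OF pa_sub_Suc]] by simp

definition kernel_step where
  "kernel_step m x = \<kappa> (Suc m) (restrict x (pa E (Suc m))) \<bind> (\<lambda>y. return (blocks d {1..Suc m}) (x(Suc m := y)))"

lemma kernel_step_measurable:
  assumes "m < K"
  shows "kernel_step m \<in> blocks d {1..m} \<rightarrow>\<^sub>M prob_algebra (blocks d {1..Suc m})"
  unfolding kernel_step_def
proof (rule measurable_bind_prob_space2[OF kernel_restrict[OF assms]])
  show "(\<lambda>(x, y). return (blocks d {1..Suc m}) (x(Suc m := y))) \<in>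
    blocks d {1..m} \<Otimes>\<^sub>M cube (d (Suc m)) \<rightarrow>\<^sub>M prob_algebra (blocks d {1..Suc m})"
    using measurable_compose[OF measurable_blocks_update measurable_return_prob_space]
    by (simp add: split_beta')
qed

lemma kernel_product_Suc: "kernel_product d E \<kappa> (Suc m) = kernel_product d E \<kappa> m \<bind> kernel_step m"
  by (simp add: kernel_step_def[abs_def])

lemma kernel_product_space:
  "m \<le> K \<Longrightarrow> kernel_product d E \<kappa> m \<in> space (prob_algebra (blocks d {1..m}))"
proof (induction m)
  case 0
  have "(\<lambda>_. undefined) \<in> space (blocks d {})" by (simp add: space_blocks)
  then have "return (blocks d {}) (\<lambda>_. undefined) \<in> space (prob_algebra (blocks d {}))"
    by (rule measurable_space[OF measurable_return_prob_space])
  then show ?case by simp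
next
  case (Suc m)
  then have "kernel_product d E \<kappa> m \<in> space (prob_algebra (blocks d {1..m}))" by simp
  then show ?case
    unfolding kernel_product_Suc
    using prob_space_bind'[OF _ kernel_step_measurable] sets_bind'[OF _ kernel_step_measurable] Suc.prems
    unfolding space_prob_algebra[of "blocks d {1..Suc m}"] by auto
qed

lemma integral_kernel_step:
  fixes f :: "_ \<Rightarrow> real"
  assumes "m < K" "x \<in> space (blocks d {1..m})" and f: "f \<in> borel_measurable (blocks d {1..Suc m})"
  shows "(\<integral>z. f z \<partial>kernel_step m x) = (\<integral>y. f (x(Suc m := y)) \<partial>\<kappa> (Suc m) (restrict x (pa E (Suc m))))"
proof -
  let ?k = "\<kappa> (Suc m) (restrict x (pa E (Suc m)))"
  have k: "prob_space ?k" "sets ?k = sets (cube (d (Suc m)))"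
    using kernel_props[OF _ restrict_pa_space[OF assms(2)]] assms(1) by auto
  have upd: "(\<lambda>y. x(Suc m := y)) \<in> ?k \<rightarrow>\<^sub>M blocks d {1..Suc m}"
    using measurable_blocks_update1[OF assms(2)] measurable_cong_sets[OF k(2) refl] by blast
  have "kernel_step m x = distr ?k (blocks d {1..Suc m}) (\<lambda>y. x(Suc m := y))"
    unfolding kernel_step_def using prob_space.not_empty[OF k(1)] upd
    by (subst bind_return_distr'[symmetric]) auto
  then show ?thesis using integral_distr[OF upd f] by simp
qed

lemma integral_kernel_product_Suc:
  fixes f :: "_ \<Rightarrow> real"
  assumes "m < K" and f: "f \<in> borel_measurable (blocks d {1..Suc m})"
    "\<And>x. x \<in> space (blocks d {1..Suc m}) \<Longrightarrow> \<bar>f x\<bar> \<le> B"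
  shows "(\<integral>z. f z \<partial>kernel_product d E \<kappa> (Suc m)) =
    (\<integral>x. (\<integral>y. f (x(Suc m := y)) \<partial>\<kappa> (Suc m) (restrict x (pa E (Suc m)))) \<partial>kernel_product d E \<kappa> m)"
proof -
  let ?P = "kernel_product d E \<kappa> m"
  have P: "prob_space ?P" "sets ?P = sets (blocks d {1..m})"
    using kernel_product_space[of m] assms(1) by (auto simp: space_prob_algebra)
  have sp: "space ?P = space (blocks d {1..m})" by (rule sets_eq_imp_space_eq[OF P(2)])
  have step: "kernel_step m \<in> ?P \<rightarrow>\<^sub>M subprob_algebra (blocks d {1..Suc m})"
    using measurable_prob_algebraD[OF kernel_step_measurable[OF assms(1)]] measurable_cong_sets[OF P(2) refl] by blast
  have "(\<integral>z. f z \<partial>kernel_product d E \<kappa> (Suc m)) = (\<integral>x. (\<integral>z. f z \<partial>kernel_step m x) \<partial>?P)"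
    unfolding kernel_product_Suc
  proof (rule integral_bind[OF f step])
    show "finite_measure ?P" using P(1) by (rule prob_space.finite_measure)
    show "AE x in ?P. emeasure (kernel_step m x) (space (kernel_step m x)) \<le> ennreal 1"
      using subprob_space.subprob_emeasure_le_1 measurable_space[OF step]
      by (intro AE_I2) (auto simp: space_subprob_algebra)
  qed
  also have "\<dots> = (\<integral>x. (\<integral>y. f (x(Suc m := y)) \<partial>\<kappa> (Suc m) (restrict x (pa E (Suc m)))) \<partial>?P)"
    using integral_kernel_step[OF assms(1) _ f(1)] sp by (intro Bochner_Integration.integral_cong refl) auto
  finally show ?thesis .
qed

lemma kernel_integral_measurable:
  fixes f :: "_ \<Rightarrow> real"
  assumes "m < K" and f: "f \<in> borel_measurable (blocks d {1..Suc m})"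
    "\<And>x. x \<in> space (blocks d {1..Suc m}) \<Longrightarrow> \<bar>f x\<bar> \<le> B"
  shows "(\<lambda>x. \<integral>y. f (x(Suc m := y)) \<partial>\<kappa> (Suc m) (restrict x (pa E (Suc m)))) \<in> borel_measurable (blocks d {1..m})"
    and "x \<in> space (blocks d {1..m}) \<Longrightarrow> \<bar>\<integral>y. f (x(Suc m := y)) \<partial>\<kappa> (Suc m) (restrict x (pa E (Suc m)))\<bar> \<le> B"
proof -
  have "(\<lambda>x. \<integral>z. f z \<partial>kernel_step m x) \<in> borel_measurable (blocks d {1..m})"
    by (rule measurable_compose[OF measurable_prob_algebraD[OF kernel_step_measurable[OF assms(1)]]
        integral_measurable_subprob_algebra[OF f(1)]])
  then show "(\<lambda>x. \<integral>y. f (x(Suc m := y)) \<partial>\<kappa> (Suc m) (restrict x (pa E (Suc m)))) \<in> borel_measurable (blocks d {1..m})"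
    by (subst (asm) measurable_cong[OF integral_kernel_step[OF assms(1) _ f(1)]])
next
  assume x: "x \<in> space (blocks d {1..m})"
  let ?k = "\<kappa> (Suc m) (restrict x (pa E (Suc m)))"
  have k: "prob_space ?k" "sets ?k = sets (cube (d (Suc m)))" "space ?k = space (cube (d (Suc m)))"
    using kernel_props[OF _ restrict_pa_space[OF x]] assms(1) by auto
  interpret k: prob_space ?k by fact
  have upd: "(\<lambda>y. x(Suc m := y)) \<in> ?k \<rightarrow>\<^sub>M blocks d {1..Suc m}"
    using measurable_blocks_update1[OF x] measurable_cong_sets[OF k(2) refl] by blast
  have b: "\<bar>f (x(Suc m := y))\<bar> \<le> B" if "y \<in> space ?k" for y
    using measurable_space[OF upd that] f(2) by blast
  have int: "integrable ?k (\<lambda>y. f (x(Suc m := y)))"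
    using b measurable_compose[OF upd f(1)] by (intro k.integrable_const_bound[where B=B]) auto
  have "\<bar>\<integral>y. f (x(Suc m := y)) \<partial>?k\<bar> \<le> (\<integral>y. \<bar>f (x(Suc m := y))\<bar> \<partial>?k)"
    using integral_norm_bound[of ?k "\<lambda>y. f (x(Suc m := y))"] by simp
  also have "\<dots> \<le> (\<integral>y. B \<partial>?k)" using b int by (intro integral_mono) auto
  finally show "\<bar>\<integral>y. f (x(Suc m := y)) \<partial>?k\<bar> \<le> B" by (simp add: k.prob_space)
qed

lemma kernel_product_marginal:
  fixes f :: "_ \<Rightarrow> real"
  assumes "m \<le> n" "n \<le> K" and f: "f \<in> borel_measurable (blocks d {1..m})"
    "\<And>x. x \<in> space (blocks d {1..m}) \<Longrightarrow> \<bar>f x\<bar> \<le> B"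
  shows "(\<integral>x. f (restrict x {1..m}) \<partial>kernel_product d E \<kappa> n) = (\<integral>x. f x \<partial>kernel_product d E \<kappa> m)"
  using assms(1,2)
proof (induction n rule: dec_induct)
  case base
  have "space (kernel_product d E \<kappa> m) = space (blocks d {1..m})"
    using kernel_product_space[of m] base by (intro sets_eq_imp_space_eq) (simp add: space_prob_algebra)
  then show ?case
    by (intro Bochner_Integration.integral_cong refl) (auto simp: space_blocks PiE_restrict)
next
  case (step n)
  have r: "(\<lambda>x. restrict x {1..m}) \<in> blocks d {1..Suc n} \<rightarrow>\<^sub>M blocks d {1..m}"
    using step.hyps by (intro measurable_blocks_restrict) auto
  have P: "prob_space (kernel_product d E \<kappa> n)" "sets (kernel_product d E \<kappa> n) = sets (blocks d {1..n})"
    using kernel_product_space[of n] step.prems by (auto simp: space_prob_algebra)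
  have "(\<integral>x. f (restrict x {1..m}) \<partial>kernel_product d E \<kappa> (Suc n)) =
    (\<integral>x. (\<integral>y. f (restrict (x(Suc n := y)) {1..m}) \<partial>\<kappa> (Suc n) (restrict x (pa E (Suc n)))) \<partial>kernel_product d E \<kappa> n)"
  proof (rule integral_kernel_product_Suc[where B=B])
    show "n < K" using step.prems by simp
    show "\<bar>f (restrict x {1..m})\<bar> \<le> B" if "x \<in> space (blocks d {1..Suc n})" for x
      using measurable_space[OF r that] f(2) by blast
  qed (use measurable_compose[OF r f(1)] in simp)
  also have "\<dots> = (\<integral>x. f (restrict x {1..m}) \<partial>kernel_product d E \<kappa> n)"
  proof (rule Bochner_Integration.integral_cong[OF refl])
    fix x assume "x \<in> space (kernel_product d E \<kappa> n)"
    then have x: "x \<in> space (blocks d {1..n})" using sets_eq_imp_space_eq[OF P(2)] by simp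
    have "restrict (x(Suc n := y)) {1..m} = restrict x {1..m}" for y
      using step.hyps by (auto simp: restrict_def)
    moreover have "prob_space (\<kappa> (Suc n) (restrict x (pa E (Suc n))))"
      using kernel_props(1)[OF _ restrict_pa_space[OF x]] step.prems by simp
    ultimately show "(\<integral>y. f (restrict (x(Suc n := y)) {1..m}) \<partial>\<kappa> (Suc n) (restrict x (pa E (Suc n)))) = f (restrict x {1..m})"
      by (simp add: prob_space.prob_space)
  qed
  finally show ?case using step.IH[OF Suc_leD[OF step.prems]] by (simp only:)
qed

text \<open>Both sides are integrals against the full law rather than a marginal, which is the form
  in which kernels can be replaced by versions that agree almost surely.\<close>

lemma integral_kernel_disintegration:
  fixes f :: "_ \<Rightarrow> real"
  assumes "m < K" and f: "f \<in> borel_measurable (blocks d {1..Suc m})"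
    "\<And>x. x \<in> space (blocks d {1..Suc m}) \<Longrightarrow> \<bar>f x\<bar> \<le> B"
  shows "(\<integral>x. f (restrict x {1..Suc m}) \<partial>kernel_product d E \<kappa> K) =
    (\<integral>x. (\<integral>y. f ((restrict x {1..m})(Suc m := y)) \<partial>\<kappa> (Suc m) (restrict x (pa E (Suc m)))) \<partial>kernel_product d E \<kappa> K)"
proof -
  define h where "h x = (\<integral>y. f (x(Suc m := y)) \<partial>\<kappa> (Suc m) (restrict x (pa E (Suc m))))" for x
  have "(\<integral>x. f (restrict x {1..Suc m}) \<partial>kernel_product d E \<kappa> K) = (\<integral>x. f x \<partial>kernel_product d E \<kappa> (Suc m))"
    using assms by (intro kernel_product_marginal) auto
  also have "\<dots> = (\<integral>x. h x \<partial>kernel_product d E \<kappa> m)"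
    unfolding h_def by (rule integral_kernel_product_Suc[OF assms])
  also have "\<dots> = (\<integral>x. h (restrict x {1..m}) \<partial>kernel_product d E \<kappa> K)"
    using kernel_integral_measurable[OF assms] assms(1) unfolding h_def[symmetric]
    by (intro kernel_product_marginal[symmetric]) auto
  also have "\<dots> = (\<integral>x. (\<integral>y. f ((restrict x {1..m})(Suc m := y)) \<partial>\<kappa> (Suc m) (restrict x (pa E (Suc m)))) \<partial>kernel_product d E \<kappa> K)"
    using pa_sub_Suc[of m] by (simp add: h_def Int_absorb1)
  finally show ?thesis .
qed

end

text \<open>Two versions agree almost surely on each of the countably many dyadic cells, hence on a
  single set of full measure they agree on all of them, and by approximation on all Lipschitz
  functions. The quantifiers over \<open>g\<close> and \<open>l\<close> must stand inside: later
  \<open>g\<close> depends on \<open>x\<close>.\<close>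

lemma cond_distr_unique:
  assumes \<mu>: "prob_space \<mu>" "sets \<mu> = sets (blocks d {1..K})" and I: "I \<subseteq> {1..K}"
    and \<kappa>: "cond_distr d \<mu> k I \<kappa>" and \<kappa>': "cond_distr d \<mu> k I \<kappa>'"
  shows "AE x in \<mu>. \<forall>g l. l \<ge> 0 \<longrightarrow> lip_fun (cube (d k)) (cube_dist (d k)) l g \<longrightarrow>
    (\<integral>y. g y \<partial>\<kappa> (restrict x I)) = (\<integral>y. g y \<partial>\<kappa>' (restrict x I))"
proof -
  interpret \<mu>: prob_space \<mu> by fact
  interpret c: quantized "cube (d k)" "cube_dist (d k)" "cube_q (d k)" "cube_grid (d k)" by (rule quantized_cube)
  have r: "(\<lambda>x. restrict x I) \<in> \<mu> \<rightarrow>\<^sub>M blocks d I"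
    using measurable_blocks_restrict[OF I] measurable_cong_sets[OF \<mu>(2) refl] by blast
  define \<mu>I where "\<mu>I = distr \<mu> (blocks d I) (\<lambda>x. restrict x I)"
  interpret \<mu>I: prob_space \<mu>I unfolding \<mu>I_def by (rule \<mu>.prob_space_distr[OF r])
  have ker: "\<kappa> \<in> blocks d I \<rightarrow>\<^sub>M prob_algebra (cube (d k))" "\<kappa>' \<in> blocks d I \<rightarrow>\<^sub>M prob_algebra (cube (d k))"
    using \<kappa> \<kappa>' by (auto simp: cond_distr_def)
  have em: "(\<lambda>c. emeasure (\<tau> c) B) \<in> borel_measurable (blocks d I)"
    if "B \<in> sets (cube (d k))" "\<tau> \<in> blocks d I \<rightarrow>\<^sub>M prob_algebra (cube (d k))" for B \<tau>
    by (rule measurable_compose[OF measurable_prob_algebraD[OF that(2)] measurable_emeasure_subprob_algebra[OF that(1)]])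
  have AE1: "AE x in \<mu>. emeasure (\<kappa> (restrict x I)) B = emeasure (\<kappa>' (restrict x I)) B"
    if B: "B \<in> sets (cube (d k))" for B
  proof -
    have dens: "emeasure (density \<mu>I (\<lambda>c. emeasure (\<tau> c) B)) A = emeasure \<mu> {x \<in> space \<mu>. restrict x I \<in> A \<and> x k \<in> B}"
      if A: "A \<in> sets (blocks d I)" and \<tau>: "cond_distr d \<mu> k I \<tau>" for A \<tau>
    proof -
      have t: "\<tau> \<in> blocks d I \<rightarrow>\<^sub>M prob_algebra (cube (d k))" using \<tau> by (simp add: cond_distr_def)
      have "emeasure (density \<mu>I (\<lambda>c. emeasure (\<tau> c) B)) A = (\<integral>\<^sup>+c. emeasure (\<tau> c) B * indicator A c \<partial>\<mu>I)"
        using A em[OF B t] by (subst emeasure_density) (auto simp: \<mu>I_def)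
      also have "\<dots> = (\<integral>\<^sup>+x. emeasure (\<tau> (restrict x I)) B * indicator A (restrict x I) \<partial>\<mu>)"
        unfolding \<mu>I_def using A em[OF B t] by (subst nn_integral_distr[OF r]) auto
      also have "\<dots> = emeasure \<mu> {x \<in> space \<mu>. restrict x I \<in> A \<and> x k \<in> B}"
        using \<tau> A B by (simp add: cond_distr_def mult.commute)
      finally show ?thesis .
    qed
    \<comment> \<open>Both densities integrate to the same joint probabilities by
      \<open>cond_distr\<close>, so they coincide almost everywhere under the law of the
      parents.\<close>
    have "density \<mu>I (\<lambda>c. emeasure (\<kappa> c) B) = density \<mu>I (\<lambda>c. emeasure (\<kappa>' c) B)"
      using dens[OF _ \<kappa>] dens[OF _ \<kappa>'] by (intro measure_eqI) (auto simp: \<mu>I_def)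
    then have "AE c in \<mu>I. emeasure (\<kappa> c) B = emeasure (\<kappa>' c) B"
      using em[OF B ker(1)] em[OF B ker(2)] by (intro \<mu>I.density_unique) (auto simp: \<mu>I_def)
    then show ?thesis unfolding \<mu>I_def by (rule AE_distrD[OF r])
  qed
  have "AE x in \<mu>. \<forall>j. \<forall>z\<in>cube_grid (d k) j. emeasure (\<kappa> (restrict x I)) (c.cell j z) = emeasure (\<kappa>' (restrict x I)) (c.cell j z)"
    using AE1[OF c.cell_sets] by (simp add: AE_all_countable AE_ball_countable' c.finite_G countable_finite)
  then show ?thesis using AE_space
  proof eventually_elim
    case (elim x)
    show ?case
    proof (intro allI impI)
      fix g and l :: real assume l: "l \<ge> 0" and g: "lip_fun (cube (d k)) (cube_dist (d k)) l g"
      have x: "restrict x I \<in> space (blocks d I)" using measurable_space[OF r elim(2)] .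
      have k1: "prob_space (\<kappa> (restrict x I))" "sets (\<kappa> (restrict x I)) = sets (cube (d k))"
        and k2: "prob_space (\<kappa>' (restrict x I))" "sets (\<kappa>' (restrict x I)) = sets (cube (d k))"
        using measurable_space[OF ker(1) x] measurable_space[OF ker(2) x] by (auto simp: space_prob_algebra)
      let ?a = "\<integral>y. g y \<partial>\<kappa> (restrict x I)" and ?b = "\<integral>y. g y \<partial>\<kappa>' (restrict x I)"
      have bound: "\<bar>?a - ?b\<bar> \<le> 2 * l * (1/2) ^ j" for j
      proof -
        have "(\<integral>y. g (cube_q (d k) j y) \<partial>\<kappa> (restrict x I)) = (\<integral>y. g (cube_q (d k) j y) \<partial>\<kappa>' (restrict x I))"
          unfolding c.integral_comp_q(2)[OF k1] c.integral_comp_q(2)[OF k2] using elim(1)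
          by (intro sum.cong refl) (simp add: measure_def)
        then show ?thesis
          using c.lip_fun_integral_q[OF g l k1, of j] c.lip_fun_integral_q[OF g l k2, of j] by linarith
      qed
      have "(\<lambda>j. 2 * l * (1/2) ^ j) \<longlonglongrightarrow> 2 * l * 0"
        by (intro tendsto_mult tendsto_const LIMSEQ_power_zero) simp
      then have "\<bar>?a - ?b\<bar> \<le> 2 * l * 0"
        by (rule LIMSEQ_le_const) (use bound in auto)
      then show "?a = ?b" by simp
    qed
  qed
qed

section \<open>Kernels tested against Lipschitz functions\<close>

lemma blocks_dist_update:
  "finite I \<Longrightarrow> k \<in> I \<Longrightarrow> blocks_dist d I (x(k := y)) (x(k := y')) \<le> cube_dist (d k) y y'"
  by (subst blocks_dist_le_iff) (auto simp: cube_dist_nonneg cube_dist_le_iff[of _ _ _ "cube_dist (d k) y y'"] abs_le_cube_dist)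

lemma lip_fun_update:
  assumes f: "lip_fun (blocks d {1..Suc m}) (blocks_dist d {1..Suc m}) l f" "l \<ge> 0"
    and x: "x \<in> space (blocks d {1..m})"
  shows "lip_fun (cube (d (Suc m))) (cube_dist (d (Suc m))) l (\<lambda>y. f (x(Suc m := y)))"
  unfolding lip_fun_def
proof (intro conjI ballI)
  note upd = measurable_blocks_update1[OF x]
  show "(\<lambda>y. f (x(Suc m := y))) \<in> borel_measurable (cube (d (Suc m)))"
    using measurable_compose[OF upd] f(1) by (auto simp: lip_fun_def)
  fix y y' assume y: "y \<in> space (cube (d (Suc m)))" "y' \<in> space (cube (d (Suc m)))"
  have "\<bar>f (x(Suc m := y)) - f (x(Suc m := y'))\<bar> \<le> l * blocks_dist d {1..Suc m} (x(Suc m := y)) (x(Suc m := y'))"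
    using f(1) measurable_space[OF upd y(1)] measurable_space[OF upd y(2)] by (auto simp: lip_fun_def)
  also have "\<dots> \<le> l * cube_dist (d (Suc m)) y y'"
    using f(2) by (intro mult_left_mono blocks_dist_update) auto
  finally show "\<bar>f (x(Suc m := y)) - f (x(Suc m := y'))\<bar> \<le> l * cube_dist (d (Suc m)) y y'" .
qed

text \<open>The Lipschitz condition in dual form, with the constant \<open>l\<close> of the test
  function made explicit. It is stated for every \<open>k\<close>: without parents the conditioning
  space is a single point and the bound is trivial.\<close>

definition kernels_lipschitz :: "(nat \<Rightarrow> nat) \<Rightarrow> nat \<Rightarrow> nat rel \<Rightarrow> real \<Rightarrow>
    (nat \<Rightarrow> point \<Rightarrow> (nat \<Rightarrow> real) measure) \<Rightarrow> bool" where
  "kernels_lipschitz d K E L \<kappa> \<longleftrightarrow> (\<forall>k\<in>{1..K}. \<forall>x\<in>space (blocks d (pa E k)). \<forall>x'\<in>space (blocks d (pa E k)).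
     \<forall>l\<ge>0. \<forall>g. lip_fun (cube (d k)) (cube_dist (d k)) l g \<longrightarrow>
       \<bar>(\<integral>y. g y \<partial>\<kappa> k x) - (\<integral>y. g y \<partial>\<kappa> k x')\<bar> \<le> l * (L * blocks_dist d (pa E k) x x'))"

text \<open>The product structure of \<open>\<mu>\<close>, block by block and tested on Lipschitz
  functions only. In this form it passes from one version of the kernels to another.\<close>

definition disintegrates :: "(nat \<Rightarrow> nat) \<Rightarrow> nat \<Rightarrow> nat rel \<Rightarrow> point measure \<Rightarrow>
    (nat \<Rightarrow> point \<Rightarrow> (nat \<Rightarrow> real) measure) \<Rightarrow> bool" where
  "disintegrates d K E \<mu> \<kappa> \<longleftrightarrow> (\<forall>m<K. \<forall>l\<ge>0. \<forall>f. lip_fun (blocks d {1..Suc m}) (blocks_dist d {1..Suc m}) l f \<longrightarrow>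
     (\<integral>x. f (restrict x {1..Suc m}) \<partial>\<mu>) =
     (\<integral>x. (\<integral>y. f ((restrict x {1..m})(Suc m := y)) \<partial>\<kappa> (Suc m) (restrict x (pa E (Suc m)))) \<partial>\<mu>))"

text \<open>One family of kernels has to serve both hypotheses. The Lipschitz versions are taken,
  and almost sure uniqueness carries the product structure over to them. For negative
  \<open>L\<close> the hypothesis bounds the distances by 0, so \<open>\<bar>L\<bar>\<close> is
  always admissible.\<close>

lemma graph_measure_kernels:
  assumes E: "sorted_dag K E" and \<mu>: "\<mu> \<in> graph_measures d K E" and L: "lipschitz_kernels d K E L \<mu>"
  obtains \<kappa> where "graph_kernels d K E \<kappa>"
    and "\<And>k. k \<in> {1..K} \<Longrightarrow> cond_distr d \<mu> k (pa E k) (\<kappa> k)"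
    and "kernels_lipschitz d K E \<bar>L\<bar> \<kappa>"
    and "disintegrates d K E \<mu> \<kappa>"
proof -
  note pa_sub = sorted_dag_pa[OF E]
  have \<mu>p: "prob_space \<mu>" "sets \<mu> = sets (blocks d {1..K})"
    using \<mu> by (auto simp: graph_measures_def space_prob_algebra)
  have sp: "space \<mu> = space (blocks d {1..K})" by (rule sets_eq_imp_space_eq[OF \<mu>p(2)])
  obtain \<kappa>0 where \<kappa>0: "\<And>k. k \<in> {1..K} \<Longrightarrow> cond_distr d \<mu> k (pa E k) (\<kappa>0 k)" "\<mu> = kernel_product d E \<kappa>0 K"
    using \<mu> unfolding graph_measures_def by blast
  define lipk where "lipk k \<tau> \<longleftrightarrow> (\<forall>x\<in>space (blocks d (pa E k)). \<forall>x'\<in>space (blocks d (pa E k)).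
            wasserstein (cube_dist (d k)) (\<tau> x) (\<tau> x') \<le> ennreal (L * blocks_dist d (pa E k) x x'))" for k \<tau>
  have "\<exists>\<tau>. cond_distr d \<mu> k (pa E k) \<tau> \<and> (pa E k \<noteq> {} \<longrightarrow> lipk k \<tau>)" if k: "k \<in> {1..K}" for k
  proof (cases "pa E k = {}")
    case True then show ?thesis using \<kappa>0(1)[OF k] by auto
  next
    case False
    \<comment> \<open>The Lipschitz hypothesis starts at 2, which loses nothing because the first
      node has no parents.\<close>
    then have "k \<ge> 2" using pa_sub[of k] by fastforce
    then show ?thesis using L False k by (auto simp: lipschitz_kernels_def lipk_def)
  qed
  then obtain \<kappa> where \<kappa>: "\<And>k. k \<in> {1..K} \<Longrightarrow> cond_distr d \<mu> k (pa E k) (\<kappa> k)"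
    "\<And>k. k \<in> {1..K} \<Longrightarrow> pa E k \<noteq> {} \<Longrightarrow> lipk k (\<kappa> k)" by metis
  interpret k0: graph_kernels d K E \<kappa>0
    using pa_sub \<kappa>0(1) by unfold_locales (auto simp: cond_distr_def)
  interpret k: graph_kernels d K E \<kappa>
    using pa_sub \<kappa>(1) by unfold_locales (auto simp: cond_distr_def)
  show ?thesis
  proof (rule that)
    show "graph_kernels d K E \<kappa>" ..
    show "cond_distr d \<mu> k (pa E k) (\<kappa> k)" if "k \<in> {1..K}" for k using \<kappa>(1) that .
  next
    show "kernels_lipschitz d K E \<bar>L\<bar> \<kappa>"
      unfolding kernels_lipschitz_def
    proof (intro ballI allI impI)
      fix k x x' l g
      assume k: "k \<in> {1..K}" and x: "x \<in> space (blocks d (pa E k))" "x' \<in> space (blocks d (pa E k))"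
        and l: "(l::real) \<ge> 0" and g: "lip_fun (cube (d k)) (cube_dist (d k)) l g"
      have fin: "finite (pa E k)" using pa_sub[of k] finite_subset by blast
      have nn: "0 \<le> blocks_dist d (pa E k) x x'" using blocks_dist_nonneg[OF fin] .
      show "\<bar>(\<integral>y. g y \<partial>\<kappa> k x) - (\<integral>y. g y \<partial>\<kappa> k x')\<bar> \<le> l * (\<bar>L\<bar> * blocks_dist d (pa E k) x x')"
      proof (cases "pa E k = {}")
        case True
        then have "x = x'" using x by (auto simp: space_blocks)
        then show ?thesis using l nn by simp
      next
        case False
        have "wasserstein (cube_dist (d k)) (\<kappa> k x) (\<kappa> k x') \<le> ennreal (L * blocks_dist d (pa E k) x x')"
          using \<kappa>(2)[OF k False] x by (auto simp: lipk_def)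
        also have "\<dots> \<le> ennreal (\<bar>L\<bar> * blocks_dist d (pa E k) x x')"
          using nn by (intro ennreal_leI mult_right_mono) auto
        finally show ?thesis
          using quantized.dual_le_wasserstein[OF quantized_cube k.kernel_props(1,2)[OF k x(1)] k.kernel_props(1,2)[OF k x(2)] _ _ g l] nn
          by simp
      qed
    qed
  next
    show "disintegrates d K E \<mu> \<kappa>"
      unfolding disintegrates_def
    proof (intro allI impI)
      fix m l f assume m: "m < K" and l: "(l::real) \<ge> 0"
        and f: "lip_fun (blocks d {1..Suc m}) (blocks_dist d {1..Suc m}) l f"
      interpret b: quantized "blocks d {1..Suc m}" "blocks_dist d {1..Suc m}" "blocks_q d {1..Suc m}" "blocks_grid d {1..Suc m}"
        by (rule quantized_blocks) simp
      obtain B where B: "\<And>x. x \<in> space (blocks d {1..Suc m}) \<Longrightarrow> \<bar>f x\<bar> \<le> B"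
        using b.lip_fun_bounded[OF f l] by blast
      have fm: "f \<in> borel_measurable (blocks d {1..Suc m})" using f by (simp add: lip_fun_def)
      have pK: "pa E (Suc m) \<subseteq> {1..K}" using pa_sub[of "Suc m"] m by auto
      have r: "(\<lambda>x. restrict x {1..m}) \<in> blocks d {1..K} \<rightarrow>\<^sub>M blocks d {1..m}"
        using m by (intro measurable_blocks_restrict) auto
      have restr: "restrict (restrict x {1..m}) (pa E (Suc m)) = restrict x (pa E (Suc m))" for x :: point
        using k.pa_sub_Suc[of m] by (simp add: Int_absorb1)
      have meas: "(\<lambda>x. \<integral>y. f ((restrict x {1..m})(Suc m := y)) \<partial>\<tau> (Suc m) (restrict x (pa E (Suc m)))) \<in> borel_measurable \<mu>"
        if "graph_kernels d K E \<tau>" for \<tau>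
        using measurable_compose[OF r graph_kernels.kernel_integral_measurable(1)[OF that m fm B]]
        by (simp only: restr measurable_cong_sets[OF \<mu>p(2) refl])
      have "(\<integral>x. f (restrict x {1..Suc m}) \<partial>\<mu>) =
        (\<integral>x. (\<integral>y. f ((restrict x {1..m})(Suc m := y)) \<partial>\<kappa>0 (Suc m) (restrict x (pa E (Suc m)))) \<partial>\<mu>)"
        using k0.integral_kernel_disintegration[OF m fm B] \<kappa>0(2) by simp
      also have "\<dots> = (\<integral>x. (\<integral>y. f ((restrict x {1..m})(Suc m := y)) \<partial>\<kappa> (Suc m) (restrict x (pa E (Suc m)))) \<partial>\<mu>)"
      proof (rule integral_cong_AE)
        have "AE x in \<mu>. \<forall>g l. l \<ge> 0 \<longrightarrow> lip_fun (cube (d (Suc m))) (cube_dist (d (Suc m))) l g \<longrightarrow>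
          (\<integral>y. g y \<partial>\<kappa>0 (Suc m) (restrict x (pa E (Suc m)))) = (\<integral>y. g y \<partial>\<kappa> (Suc m) (restrict x (pa E (Suc m))))"
          using m by (intro cond_distr_unique[OF \<mu>p pK] \<kappa>0(1) \<kappa>(1)) auto
        then show "AE x in \<mu>. (\<integral>y. f ((restrict x {1..m})(Suc m := y)) \<partial>\<kappa>0 (Suc m) (restrict x (pa E (Suc m)))) =
          (\<integral>y. f ((restrict x {1..m})(Suc m := y)) \<partial>\<kappa> (Suc m) (restrict x (pa E (Suc m))))"
          using AE_space
        proof eventually_elim
          case (elim x)
          have "lip_fun (cube (d (Suc m))) (cube_dist (d (Suc m))) l (\<lambda>y. f ((restrict x {1..m})(Suc m := y)))"
            using elim(2) measurable_space[OF r] sp by (intro lip_fun_update[OF f l]) auto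
          then show ?case using elim(1) l by blast
        qed
      qed (rule meas k0.graph_kernels_axioms k.graph_kernels_axioms)+
      finally show "(\<integral>x. f (restrict x {1..Suc m}) \<partial>\<mu>) =
        (\<integral>x. (\<integral>y. f ((restrict x {1..m})(Suc m := y)) \<partial>\<kappa> (Suc m) (restrict x (pa E (Suc m)))) \<partial>\<mu>)" .
    qed
  qed
qed

section \<open>The product of the empirical kernels\<close>

definition matching :: "('i \<Rightarrow> 'k \<Rightarrow> 'v) \<Rightarrow> 'i set \<Rightarrow> 'k set \<Rightarrow> ('k \<Rightarrow> 'v) \<Rightarrow> 'i set" where
  "matching Y I J x = {i \<in> I. \<forall>l\<in>J. Y i l = x l}"

text \<open>Whenever the empty case of \<open>donors\<close> matters, it has probability zero (\<open>support_matching_nonempty\<close>).\<close>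

definition donors :: "('i \<Rightarrow> 'k \<Rightarrow> 'v) \<Rightarrow> 'i set \<Rightarrow> 'k set \<Rightarrow> ('k \<Rightarrow> 'v) \<Rightarrow> 'i set" where
  "donors Y I J x = (if matching Y I J x = {} then I else matching Y I J x)"

text \<open>Copying the block of a uniformly drawn donor is sampling from the empirical conditional
  law given the parents. The start is the only point of the product over no blocks, as in
  \<open>kernel_product\<close>.\<close>

primrec empirical_product :: "nat rel \<Rightarrow> ('i \<Rightarrow> nat \<Rightarrow> 'v) \<Rightarrow> 'i set \<Rightarrow> nat \<Rightarrow> (nat \<Rightarrow> 'v) pmf" where
  "empirical_product E Y I 0 = return_pmf (\<lambda>_. undefined)"
| "empirical_product E Y I (Suc m) = empirical_product E Y I m \<bind>
     (\<lambda>x. map_pmf (\<lambda>i. x(Suc m := Y i (Suc m))) (pmf_of_set (donors Y I (pa E (Suc m)) x)))"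

definition depends_on :: "(('k \<Rightarrow> 'v) \<Rightarrow> 'b) \<Rightarrow> 'k set \<Rightarrow> bool" where
  "depends_on h J \<longleftrightarrow> (\<forall>x y. (\<forall>l\<in>J. x l = y l) \<longrightarrow> h x = h y)"

lemma depends_onD: "depends_on h J \<Longrightarrow> (\<And>l. l \<in> J \<Longrightarrow> x l = y l) \<Longrightarrow> h x = h y"
  by (auto simp: depends_on_def)

lemma depends_on_mono: "depends_on h J \<Longrightarrow> J \<subseteq> J' \<Longrightarrow> depends_on h J'"
  unfolding depends_on_def by blast

lemma matching_cong: "(\<And>l. l \<in> J \<Longrightarrow> x l = y l) \<Longrightarrow> matching Y I J x = matching Y I J y"
  by (auto simp: matching_def)

lemma matching_self: "i \<in> I \<Longrightarrow> i \<in> matching Y I J (Y i)"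
  by (simp add: matching_def)

text \<open>Tower property of the empirical measure: matching is an equivalence relation on the
  sample, and averaging over its classes preserves the total.\<close>

lemma sum_matching_average:
  fixes g :: "'i \<Rightarrow> real"
  assumes "finite I"
  shows "(\<Sum>i\<in>I. (\<Sum>i'\<in>matching Y I J (Y i). g i') / card (matching Y I J (Y i))) = (\<Sum>i\<in>I. g i)"
proof -
  let ?S = "\<lambda>i. matching Y I J (Y i)"
  have fin: "finite (?S i)" for i using assms by (simp add: matching_def)
  have "(\<Sum>i\<in>I. (\<Sum>i'\<in>?S i. g i') / card (?S i)) = (\<Sum>i\<in>I. \<Sum>i'\<in>I. if i' \<in> ?S i then g i' / card (?S i) else 0)"
  proof (intro sum.cong refl)
    fix i assume "i \<in> I"
    have "(\<Sum>i'\<in>?S i. g i') / card (?S i) = (\<Sum>i'\<in>?S i. g i' / card (?S i))" by (simp add: sum_divide_distrib)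
    also have "\<dots> = (\<Sum>i'\<in>{i'\<in>I. i' \<in> ?S i}. g i' / card (?S i))"
      by (intro sum.cong refl) (auto simp: matching_def)
    also have "\<dots> = (\<Sum>i'\<in>I. if i' \<in> ?S i then g i' / card (?S i) else 0)"
      using assms by (simp add: sum.inter_filter)
    finally show "(\<Sum>i'\<in>?S i. g i') / card (?S i) = (\<Sum>i'\<in>I. if i' \<in> ?S i then g i' / card (?S i) else 0)" .
  qed
  also have "\<dots> = (\<Sum>i'\<in>I. \<Sum>i\<in>I. if i' \<in> ?S i then g i' / card (?S i) else 0)" by (rule sum.swap)
  also have "\<dots> = (\<Sum>i'\<in>I. g i')"
  proof (intro sum.cong refl)
    fix i' assume i': "i' \<in> I"
    have sym: "?S i = ?S i'" if "i' \<in> ?S i" for i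
      using that by (intro matching_cong) (auto simp: matching_def)
    have "(\<Sum>i\<in>I. if i' \<in> ?S i then g i' / card (?S i) else 0) = (\<Sum>i\<in>I. if i \<in> ?S i' then g i' / card (?S i') else 0)"
      using sym i' by (intro sum.cong refl) (auto simp: matching_def)
    also have "\<dots> = (\<Sum>i\<in>{i\<in>I. i \<in> ?S i'}. g i' / card (?S i'))"
      by (rule sum.inter_filter[OF assms, symmetric])
    also have "{i\<in>I. i \<in> ?S i'} = ?S i'" by (auto simp: matching_def)
    also have "(\<Sum>i\<in>?S i'. g i' / card (?S i')) = g i'"
    proof -
      have "card (?S i') \<noteq> 0" using matching_self[OF i', of Y J] fin[of i'] by (metis card_0_eq empty_iff)
      then show ?thesis by simp
    qed
    finally show "(\<Sum>i\<in>I. if i' \<in> ?S i then g i' / card (?S i) else 0) = g i'" .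
  qed
  finally show ?thesis .
qed

lemma restrict_eq_iff: "restrict f J = restrict g J \<longleftrightarrow> (\<forall>l\<in>J. f l = g l)"
  by (metis restrict_apply' restrict_ext)

text \<open>An occupied class has as many members as its divisor, so it contributes
  \<open>T c\<close> exactly once; unoccupied values of \<open>c\<close> only enlarge the right
  side. This is the cancellation of the random counts.\<close>

lemma sum_matching_le:
  fixes T :: "('k \<Rightarrow> 'v) \<Rightarrow> real"
  assumes "finite I" "finite G" "\<And>i. i \<in> I \<Longrightarrow> restrict (Y i) J \<in> G" "\<And>c. c \<in> G \<Longrightarrow> T c \<ge> 0"
  shows "(\<Sum>i\<in>I. T (restrict (Y i) J) / card (matching Y I J (Y i))) \<le> (\<Sum>c\<in>G. T c)"
proof -
  let ?S = "\<lambda>i. matching Y I J (Y i)"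
  have fin: "finite (?S i)" for i using assms by (simp add: matching_def)
  have "(\<Sum>i\<in>I. T (restrict (Y i) J) / card (?S i)) =
    (\<Sum>c\<in>G. \<Sum>i\<in>{i\<in>I. restrict (Y i) J = c}. T (restrict (Y i) J) / card (?S i))"
    using assms by (subst sum.group) auto
  also have "\<dots> \<le> (\<Sum>c\<in>G. T c)"
  proof (rule sum_mono)
    fix c assume c: "c \<in> G"
    show "(\<Sum>i\<in>{i\<in>I. restrict (Y i) J = c}. T (restrict (Y i) J) / card (?S i)) \<le> T c"
    proof (cases "{i\<in>I. restrict (Y i) J = c} = {}")
      case True then show ?thesis using assms(4)[OF c] by (simp only: sum.empty)
    next
      case False
      then obtain i0 where i0: "i0 \<in> I" "restrict (Y i0) J = c" by auto
      have eq: "{i\<in>I. restrict (Y i) J = c} = ?S i0"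
        unfolding i0(2)[symmetric] restrict_eq_iff by (auto simp: matching_def)
      have S: "?S i = ?S i0" if "i \<in> ?S i0" for i
        using that by (intro matching_cong) (auto simp: matching_def)
      have "(\<Sum>i\<in>?S i0. T (restrict (Y i) J) / card (?S i)) = (\<Sum>i\<in>?S i0. T c / card (?S i0))"
      proof (intro sum.cong refl)
        fix i assume "i \<in> ?S i0"
        then show "T (restrict (Y i) J) / card (?S i) = T c / card (?S i0)" using S[of i] eq by auto
      qed
      also have "\<dots> = T c"
      proof -
        have "card (?S i0) \<noteq> 0" using matching_self[OF i0(1), of Y J] fin[of i0] by (metis card_0_eq empty_iff)
        then show ?thesis by simp
      qed
      finally show ?thesis unfolding eq by simp
    qed
  qed
  finally show ?thesis .
qed

locale empirical =
  fixes E :: "nat rel" and Y :: "'i \<Rightarrow> nat \<Rightarrow> 'v" and I :: "'i set"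
  assumes finite_I: "finite I" and I_ne: "I \<noteq> {}"
    and pa_less: "\<And>k. pa E k \<subseteq> {1..<k}"
begin

abbreviation "P \<equiv> empirical_product E Y I"
abbreviation "S k \<equiv> matching Y I (pa E k)"
abbreviation "D k \<equiv> donors Y I (pa E k)"

lemma donors_props: "finite (D k x)" "D k x \<noteq> {}"
  using finite_I I_ne by (auto simp: donors_def matching_def)

lemma finite_support: "finite (set_pmf (P m))"
  by (induction m) (auto simp: donors_props set_pmf_of_set)

lemma integrable_P: "integrable (measure_pmf (P m)) (f :: _ \<Rightarrow> real)"
  by (rule integrable_measure_pmf_finite[OF finite_support])

lemma expectation_Suc:
  fixes f :: "_ \<Rightarrow> real"
  shows "measure_pmf.expectation (P (Suc m)) f =
    measure_pmf.expectation (P m) (\<lambda>x. (\<Sum>i\<in>D (Suc m) x. f (x(Suc m := Y i (Suc m)))) / card (D (Suc m) x))"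
proof -
  have "measure_pmf.expectation (P (Suc m)) f = (\<Sum>x\<in>set_pmf (P m). pmf (P m) x *\<^sub>R
    measure_pmf.expectation (map_pmf (\<lambda>i. x(Suc m := Y i (Suc m))) (pmf_of_set (D (Suc m) x))) f)"
    unfolding empirical_product.simps
    by (rule pmf_expectation_bind) (auto simp: finite_support donors_props set_pmf_of_set)
  also have "\<dots> = (\<Sum>x\<in>set_pmf (P m). pmf (P m) x *\<^sub>R
    ((\<Sum>i\<in>D (Suc m) x. f (x(Suc m := Y i (Suc m)))) / card (D (Suc m) x)))"
    by (simp add: integral_pmf_of_set donors_props)
  also have "\<dots> = measure_pmf.expectation (P m) (\<lambda>x. (\<Sum>i\<in>D (Suc m) x. f (x(Suc m := Y i (Suc m)))) / card (D (Suc m) x))"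
    by (rule integral_measure_pmf[symmetric]) (auto simp: finite_support)
  finally show ?thesis .
qed

lemma expectation_ignore:
  fixes h :: "_ \<Rightarrow> real"
  assumes "depends_on h {1..l}" "l \<le> m"
  shows "measure_pmf.expectation (P m) h = measure_pmf.expectation (P l) h"
  using assms(2)
proof (induction m rule: dec_induct)
  case (step m)
  have "h (x(Suc m := y)) = h x" for x y
    using step.hyps by (intro depends_onD[OF assms(1)]) auto
  moreover have "card (D (Suc m) x) \<noteq> 0" for x using donors_props by (simp add: card_eq_0_iff)
  ultimately have "measure_pmf.expectation (P (Suc m)) h = measure_pmf.expectation (P m) h"
    unfolding expectation_Suc by simp
  then show ?case using step.IH by simp
qed simp

abbreviation average :: "((nat \<Rightarrow> 'v) \<Rightarrow> real) \<Rightarrow> real" where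
  "average h \<equiv> (\<Sum>i\<in>I. h (Y i)) / card I"

text \<open>\<open>P k\<close> is the law just before the block \<open>Suc k\<close> is drawn. If
  \<open>Suc m\<close> is the largest parent, undoing its draw leaves a function of the parents of
  \<open>Suc m\<close>, to which the induction hypothesis at the smaller \<open>m\<close> applies;
  the tower property turns the result back into the average of \<open>h\<close>.\<close>

lemma marginal_pa:
  assumes fc: "\<And>k. k \<in> {1..K} \<Longrightarrow> fully_connected E (pa E k)" and "k < K" "depends_on h (pa E (Suc k))"
  shows "measure_pmf.expectation (P k) h = average h"
  using assms(2,3)
proof (induction k arbitrary: h rule: less_induct)
  case (less k)
  have fin: "finite (pa E (Suc k))" using pa_less finite_subset by blast
  show ?case
  proof (cases "pa E (Suc k) = {}")
    case True
    then have c: "h x = h undefined" for x using less.prems(2) by (auto simp: depends_on_def)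
    have "measure_pmf.expectation (P k) h = measure_pmf.expectation (P k) (\<lambda>_. h undefined)"
      using c by (rule Bochner_Integration.integral_cong[OF refl])
    moreover have "(\<Sum>i\<in>I. h (Y i)) = (\<Sum>i\<in>I. h undefined)" using c by (rule sum.cong[OF refl])
    ultimately show ?thesis using finite_I I_ne by simp
  next
    case False
    define m where "m = Max (pa E (Suc k)) - 1"
    have mx: "Max (pa E (Suc k)) \<in> pa E (Suc k)" using False fin by (intro Max_in)
    then have m: "Suc m = Max (pa E (Suc k))" "Suc m \<le> k"
      using pa_less[of "Suc k"] by (auto simp: m_def)
    have sub: "pa E (Suc k) \<subseteq> insert (Suc m) (pa E (Suc m))"
    proof
      fix i assume i: "i \<in> pa E (Suc k)"
      then have "i \<le> Suc m" using m fin by simp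
      moreover have "(i, Suc m) \<in> E" if "i < Suc m"
        using fc[of "Suc k"] i mx that less.prems(1) unfolding fully_connected_def m(1) by auto
      ultimately show "i \<in> insert (Suc m) (pa E (Suc m))" by (cases "i < Suc m") (auto simp: pa_def)
    qed
    then have dep: "depends_on h (insert (Suc m) (pa E (Suc m)))" using less.prems(2) depends_on_mono by blast
    define \<phi> where "\<phi> x = (\<Sum>i\<in>D (Suc m) x. h (x(Suc m := Y i (Suc m)))) / card (D (Suc m) x)" for x
    \<comment> \<open>Averaging over the donors overwrites the block \<open>Suc m\<close>, and the
      donors themselves are determined by the parents of \<open>Suc m\<close>.\<close>
    have dep\<phi>: "depends_on \<phi> (pa E (Suc m))"
      unfolding depends_on_def
    proof (intro allI impI)
      fix x y :: "nat \<Rightarrow> 'v" assume xy: "\<forall>l\<in>pa E (Suc m). x l = y l"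
      then have "S (Suc m) x = S (Suc m) y" by (intro matching_cong) auto
      then have "D (Suc m) x = D (Suc m) y" by (simp add: donors_def)
      moreover have "h (x(Suc m := v)) = h (y(Suc m := v))" for v
        using xy by (intro depends_onD[OF dep]) auto
      ultimately show "\<phi> x = \<phi> y" by (simp add: \<phi>_def)
    qed
    have "measure_pmf.expectation (P k) h = measure_pmf.expectation (P (Suc m)) h"
    proof (rule expectation_ignore[OF depends_on_mono[OF less.prems(2)] m(2)])
      show "pa E (Suc k) \<subseteq> {1..Suc m}" using sub pa_less[of "Suc m"] by fastforce
    qed
    also have "\<dots> = measure_pmf.expectation (P m) \<phi>" unfolding \<phi>_def by (rule expectation_Suc)
    also have "\<dots> = average \<phi>" using m(2) less.prems(1) by (intro less.IH dep\<phi>) auto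
    also have "(\<Sum>i\<in>I. \<phi> (Y i)) = (\<Sum>i\<in>I. (\<Sum>i'\<in>S (Suc m) (Y i). h (Y i')) / card (S (Suc m) (Y i)))"
    proof (rule sum.cong[OF refl])
      fix i assume i: "i \<in> I"
      have D: "D (Suc m) (Y i) = S (Suc m) (Y i)"
        using matching_self[OF i, of Y "pa E (Suc m)"] unfolding donors_def by (metis empty_iff)
      have "h ((Y i)(Suc m := Y i' (Suc m))) = h (Y i')" if "i' \<in> S (Suc m) (Y i)" for i'
        using that by (intro depends_onD[OF dep]) (auto simp: matching_def)
      then show "\<phi> (Y i) = (\<Sum>i'\<in>S (Suc m) (Y i). h (Y i')) / card (S (Suc m) (Y i))"
        unfolding \<phi>_def D by simp
    qed
    also have "\<dots> = (\<Sum>i\<in>I. h (Y i))" by (rule sum_matching_average[OF finite_I])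
    finally show ?thesis .
  qed
qed

text \<open>The indicator of having no match depends on the parents alone and vanishes at every
  sample point. By the marginal identity its mean is 0, so it vanishes on the support.\<close>

lemma support_matching_nonempty:
  assumes "\<And>k. k \<in> {1..K} \<Longrightarrow> fully_connected E (pa E k)" "k < K" "x \<in> set_pmf (P k)"
  shows "S (Suc k) x \<noteq> {}"
proof
  define h where "h x = (if S (Suc k) x = {} then 1 else 0 :: real)" for x
  assume e: "S (Suc k) x = {}"
  have "measure_pmf.expectation (P k) h = average h"
  proof (rule marginal_pa[OF assms(1,2)])
    have "h x = h y" if "\<forall>l\<in>pa E (Suc k). x l = y l" for x y
      unfolding h_def using matching_cong[of "pa E (Suc k)" x y Y I] that by simp
    then show "depends_on h (pa E (Suc k))" by (auto simp: depends_on_def)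
  qed
  also have "\<dots> = 0"
  proof -
    have "h (Y i) = 0" if "i \<in> I" for i
      unfolding h_def using matching_self[OF that, of Y "pa E (Suc k)"] by (metis empty_iff)
    then show ?thesis by simp
  qed
  finally have "AE y in measure_pmf (P k). h y = 0"
    by (subst integral_nonneg_eq_0_iff_AE[symmetric]) (auto simp: integrable_P h_def)
  then show False using assms(3) e by (auto simp: AE_measure_pmf_iff h_def split: if_splits)
qed

end

section \<open>Error of the empirical product for a fixed sample\<close>

text \<open>The fluctuation of the \<open>k\<close>-th block in the conditioning cell \<open>c\<close> and the cell \<open>z\<close> of level \<open>j\<close>;
  it is centred since \<open>\<kappa> k\<close> is the conditional law.\<close>

definition fluct :: "(nat \<Rightarrow> nat) \<Rightarrow> nat rel \<Rightarrow> (nat \<Rightarrow> point \<Rightarrow> (nat \<Rightarrow> real) measure) \<Rightarrow> nat \<Rightarrow>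
    nat \<Rightarrow> point \<Rightarrow> nat \<Rightarrow> (nat \<Rightarrow> real) \<Rightarrow> point \<Rightarrow> real" where
  "fluct d E \<kappa> J k c j z x = indicator (quantized.cell (blocks d (pa E k)) (blocks_q d (pa E k)) J c) (restrict x (pa E k)) *
     (indicator (quantized.cell (cube (d k)) (cube_q (d k)) j z) (x k) -
      measure (\<kappa> k (restrict x (pa E k))) (quantized.cell (cube (d k)) (cube_q (d k)) j z))"

text \<open>The chaining sum for the parent cell \<open>c\<close>, not yet divided by the number of
  sample points in it.\<close>

definition total_fluct :: "(nat \<Rightarrow> nat) \<Rightarrow> nat rel \<Rightarrow> (nat \<Rightarrow> point \<Rightarrow> (nat \<Rightarrow> real) measure) \<Rightarrow> nat \<Rightarrow>
    'i set \<Rightarrow> ('i \<Rightarrow> nat \<Rightarrow> nat \<Rightarrow> real) \<Rightarrow> nat \<Rightarrow> point \<Rightarrow> real" where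
  "total_fluct d E \<kappa> J I X k c = (\<Sum>j\<le>J. 2 * (1/2) ^ j * (\<Sum>z\<in>cube_grid (d k) j. \<bar>\<Sum>i\<in>I. fluct d E \<kappa> J k c j z (X i)\<bar>))"

text \<open>In \<open>3 + L\<close>, 1 is the cost of rounding the drawn block, 2 that of stopping
  the chaining at level \<open>J\<close>, and \<open>L\<close> that of rounding the parents inside
  the kernel.\<close>

definition level_error :: "(nat \<Rightarrow> nat) \<Rightarrow> nat rel \<Rightarrow> (nat \<Rightarrow> point \<Rightarrow> (nat \<Rightarrow> real) measure) \<Rightarrow> real \<Rightarrow> nat \<Rightarrow>
    'i set \<Rightarrow> ('i \<Rightarrow> nat \<Rightarrow> nat \<Rightarrow> real) \<Rightarrow> nat \<Rightarrow> real" where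
  "level_error d E \<kappa> L J I X k = (3 + L) * (1/2) ^ J +
     (\<Sum>c\<in>blocks_grid d (pa E k) J. total_fluct d E \<kappa> J I X k c) / card I"

text \<open>The factor \<open>1 + L\<close> is the growth of the Lipschitz constant when the last
  block is integrated out.\<close>

primrec product_error :: "(nat \<Rightarrow> nat) \<Rightarrow> nat rel \<Rightarrow> (nat \<Rightarrow> point \<Rightarrow> (nat \<Rightarrow> real) measure) \<Rightarrow> real \<Rightarrow> nat \<Rightarrow>
    'i set \<Rightarrow> ('i \<Rightarrow> nat \<Rightarrow> nat \<Rightarrow> real) \<Rightarrow> nat \<Rightarrow> real" where
  "product_error d E \<kappa> L J I X 0 = 0"
| "product_error d E \<kappa> L J I X (Suc m) = (1 + L) * product_error d E \<kappa> L J I X m + level_error d E \<kappa> L J I X (Suc m)"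

lemma total_fluct_nonneg: "total_fluct d E \<kappa> J I X k c \<ge> 0"
  unfolding total_fluct_def by (intro sum_nonneg mult_nonneg_nonneg) auto

lemma blocks_dist_restrict:
  assumes "finite I" "J \<subseteq> I"
  shows "blocks_dist d J (restrict x J) (restrict y J) \<le> blocks_dist d I x y"
  using assms finite_subset[OF assms(2,1)]
  by (subst blocks_dist_le_iff) (auto simp: blocks_dist_nonneg intro: cube_dist_le_blocks_dist)

lemma blocks_dist_update_same:
  assumes "finite I" "finite J" "I \<subseteq> insert k J"
  shows "blocks_dist d I (x(k := y)) (x'(k := y)) \<le> blocks_dist d J x x'"
proof -
  have "cube_dist (d l) y y \<le> blocks_dist d J x x'" for l
    by (simp add: cube_dist_le_iff blocks_dist_nonneg[OF assms(2)])
  then show ?thesis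
    using assms by (subst blocks_dist_le_iff) (auto simp: blocks_dist_nonneg intro: cube_dist_le_blocks_dist)
qed

text \<open>The sample \<open>X\<close> is an arbitrary fixed family here, so the estimates hold for
  every sample; its randomness enters only when the fluctuations are integrated.\<close>

locale kernel_estimate = graph_kernels d K E \<kappa>
  for d :: "nat \<Rightarrow> nat" and K :: nat and E :: "nat rel"
    and \<kappa> :: "nat \<Rightarrow> point \<Rightarrow> (nat \<Rightarrow> real) measure" +
  fixes \<mu> :: "point measure" and L :: real
    and J :: nat and I :: "'i set" and X :: "'i \<Rightarrow> nat \<Rightarrow> nat \<Rightarrow> real"
  assumes \<mu>: "prob_space \<mu>" "sets \<mu> = sets (blocks d {1..K})"
    and L: "L \<ge> 0"
    and fc: "\<And>k. k \<in> {1..K} \<Longrightarrow> fully_connected E (pa E k)"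
    and lip: "kernels_lipschitz d K E L \<kappa>"
    and dis: "disintegrates d K E \<mu> \<kappa>"
    and I: "finite I" "I \<noteq> {}" and X: "\<And>i. i \<in> I \<Longrightarrow> X i \<in> space (blocks d {1..K})"
begin

lemmas kernel_lip = lip[unfolded kernels_lipschitz_def, rule_format]
lemmas disintegration = dis[unfolded disintegrates_def, rule_format]

definition "Y i = blocks_q d {1..K} J (X i)"

sublocale emp: empirical E Y I
  using I pa_sub by unfold_locales auto

interpretation c: quantized "cube m" "cube_dist m" "cube_q m" "cube_grid m" for m by (rule quantized_cube)

interpretation b: quantized "blocks d {1..m}" "blocks_dist d {1..m}" "blocks_q d {1..m}" "blocks_grid d {1..m}" for m
  by (rule quantized_blocks) simp

lemma finite_pa: "finite (pa E k)"
  using pa_sub finite_subset by blast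

interpretation p: quantized "blocks d (pa E k)" "blocks_dist d (pa E k)" "blocks_q d (pa E k)" "blocks_grid d (pa E k)" for k
  by (rule quantized_blocks[OF finite_pa])

lemma X_component: "i \<in> I \<Longrightarrow> k \<in> {1..K} \<Longrightarrow> X i k \<in> space (cube (d k))"
  using X by (auto simp: space_blocks PiE_iff)

lemma Y_component: "k \<in> {1..K} \<Longrightarrow> Y i k = cube_q (d k) J (X i k)"
  by (simp add: Y_def blocks_q_def)

lemma pa_sub_K: "k \<in> {1..K} \<Longrightarrow> pa E k \<subseteq> {1..K}"
  using pa_sub[of k] by auto

lemma X_pa: "i \<in> I \<Longrightarrow> k \<in> {1..K} \<Longrightarrow> restrict (X i) (pa E k) \<in> space (blocks d (pa E k))"
  using measurable_space[OF measurable_blocks_restrict[OF pa_sub_K] X] by blast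

lemma Y_pa: "k \<in> {1..K} \<Longrightarrow> restrict (Y i) (pa E k) = blocks_q d (pa E k) J (restrict (X i) (pa E k))"
  using pa_sub_K[of k] by (auto simp: blocks_q_def Y_def restrict_def fun_eq_iff)

lemma support_space:
  "m \<le> K \<Longrightarrow> x \<in> set_pmf (emp.P m) \<Longrightarrow> x \<in> space (blocks d {1..m})"
proof (induction m arbitrary: x)
  case 0
  then show ?case by (simp add: space_blocks)
next
  case (Suc m)
  then obtain y i where y: "y \<in> set_pmf (emp.P m)" and i: "i \<in> I" and x: "x = y(Suc m := Y i (Suc m))"
    by (auto simp: set_pmf_of_set emp.donors_props) (auto simp: donors_def matching_def split: if_splits)
  have ys: "y \<in> space (blocks d {1..m})" using Suc.IH[OF _ y] Suc.prems by simp
  have "Y i (Suc m) \<in> space (cube (d (Suc m)))"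
    using Suc.prems X_component[OF i, of "Suc m"] Y_component[of "Suc m" i] c.q_space by simp
  then show ?case unfolding x by (rule measurable_space[OF measurable_blocks_update1[OF ys]])
qed

definition mean :: "nat \<Rightarrow> (point \<Rightarrow> real) \<Rightarrow> point \<Rightarrow> real" where
  "mean m f x = (\<integral>y. f (x(Suc m := y)) \<partial>\<kappa> (Suc m) (restrict x (pa E (Suc m))))"

text \<open>Moving \<open>x\<close> inside \<open>f\<close> with the kernel held fixed costs
  \<open>l\<close>, moving the kernel costs \<open>l * L\<close>.\<close>

lemma lip_fun_mean:
  assumes m: "m < K" and f: "lip_fun (blocks d {1..Suc m}) (blocks_dist d {1..Suc m}) l f" "l \<ge> 0"
  shows "lip_fun (blocks d {1..m}) (blocks_dist d {1..m}) (l * (1 + L)) (mean m f)"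
  unfolding lip_fun_def
proof (intro conjI ballI)
  obtain B where "\<And>x. x \<in> space (blocks d {1..Suc m}) \<Longrightarrow> \<bar>f x\<bar> \<le> B"
    using b.lip_fun_bounded[OF f] by blast
  then show "mean m f \<in> borel_measurable (blocks d {1..m})"
    unfolding mean_def using f(1) m by (intro kernel_integral_measurable(1)) (auto simp: lip_fun_def)
  fix x x' assume x: "x \<in> space (blocks d {1..m})" "x' \<in> space (blocks d {1..m})"
  note rx = restrict_pa_space[OF x(1)] restrict_pa_space[OF x(2)]
  have k: "Suc m \<in> {1..K}" using m by simp
  let ?\<kappa> = "\<kappa> (Suc m) (restrict x' (pa E (Suc m)))"
  note props = kernel_props[OF k rx(2)]
  interpret k': prob_space ?\<kappa> by (rule props(1))
  note g = lip_fun_update[OF f x(1)] and g' = lip_fun_update[OF f x(2)]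
  have i: "integrable ?\<kappa> (\<lambda>y. f (x(Suc m := y)))" "integrable ?\<kappa> (\<lambda>y. f (x'(Suc m := y)))"
    using c.lip_fun_integrable[OF g f(2) props(1,2)] c.lip_fun_integrable[OF g' f(2) props(1,2)] by auto
  have "\<bar>mean m f x - (\<integral>y. f (x(Suc m := y)) \<partial>?\<kappa>)\<bar> \<le> l * (L * blocks_dist d (pa E (Suc m)) (restrict x (pa E (Suc m))) (restrict x' (pa E (Suc m))))"
    unfolding mean_def by (rule kernel_lip[OF k rx f(2) g])
  also have "\<dots> \<le> l * (L * blocks_dist d {1..m} x x')"
    using f(2) L pa_sub_Suc by (intro mult_left_mono blocks_dist_restrict) auto
  finally have 1: "\<bar>mean m f x - (\<integral>y. f (x(Suc m := y)) \<partial>?\<kappa>)\<bar> \<le> l * (L * blocks_dist d {1..m} x x')" .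
  have pt: "\<bar>f (x(Suc m := y)) - f (x'(Suc m := y))\<bar> \<le> l * blocks_dist d {1..m} x x'" if "y \<in> space ?\<kappa>" for y
  proof -
    have y: "y \<in> space (cube (d (Suc m)))" using that props(3) by simp
    have "\<bar>f (x(Suc m := y)) - f (x'(Suc m := y))\<bar> \<le> l * blocks_dist d {1..Suc m} (x(Suc m := y)) (x'(Suc m := y))"
      using f(1) measurable_space[OF measurable_blocks_update1[OF x(1)] y]
        measurable_space[OF measurable_blocks_update1[OF x(2)] y] unfolding lip_fun_def by blast
    also have "\<dots> \<le> l * blocks_dist d {1..m} x x'"
      using f(2) by (intro mult_left_mono blocks_dist_update_same) auto
    finally show ?thesis .
  qed
  have "\<bar>(\<integral>y. f (x(Suc m := y)) \<partial>?\<kappa>) - mean m f x'\<bar> = \<bar>\<integral>y. f (x(Suc m := y)) - f (x'(Suc m := y)) \<partial>?\<kappa>\<bar>"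
    using i by (simp add: mean_def)
  also have "\<dots> \<le> (\<integral>y. \<bar>f (x(Suc m := y)) - f (x'(Suc m := y))\<bar> \<partial>?\<kappa>)"
    using integral_norm_bound[of ?\<kappa> "\<lambda>y. f (x(Suc m := y)) - f (x'(Suc m := y))"] by simp
  also have "\<dots> \<le> (\<integral>y. l * blocks_dist d {1..m} x x' \<partial>?\<kappa>)"
    using pt i by (intro integral_mono) auto
  also have "\<dots> = l * blocks_dist d {1..m} x x'" by (simp add: k'.prob_space)
  finally have "\<bar>(\<integral>y. f (x(Suc m := y)) \<partial>?\<kappa>) - mean m f x'\<bar> \<le> l * blocks_dist d {1..m} x x'" .
  with 1 show "\<bar>mean m f x - mean m f x'\<bar> \<le> l * (1 + L) * blocks_dist d {1..m} x x'"
    by (simp add: algebra_simps)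
qed

definition local_bound :: "nat \<Rightarrow> point \<Rightarrow> real" where
  "local_bound m x = (3 + L) * (1/2) ^ J +
     total_fluct d E \<kappa> J I X (Suc m) (restrict x (pa E (Suc m))) / card (emp.S (Suc m) x)"

text \<open>Three replacements under the average over the matching sample points: rounded by true
  block values (\<open>B\<close>), these by the kernels at their own parents through chaining
  (\<open>A\<close>), and these by the kernel at \<open>x\<close> (\<open>C\<close>).\<close>

lemma local_estimate:
  assumes m: "m < K" and f: "lip_fun (blocks d {1..Suc m}) (blocks_dist d {1..Suc m}) l f" "l \<ge> 0"
    and x: "x \<in> set_pmf (emp.P m)"
  shows "\<bar>(\<Sum>i\<in>emp.D (Suc m) x. f (x(Suc m := Y i (Suc m)))) / card (emp.D (Suc m) x) - mean m f x\<bar> \<le> l * local_bound m x"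
proof -
  let ?k = "Suc m" and ?p = "pa E (Suc m)" and ?h = "(1/2::real) ^ J"
  let ?S = "emp.S ?k x" and ?T = "total_fluct d E \<kappa> J I X ?k (restrict x ?p)"
  have k: "?k \<in> {1..K}" using m by simp
  have xs: "x \<in> space (blocks d {1..m})" using support_space[OF _ x] m by simp
  note rx = restrict_pa_space[OF xs]
  have S_ne: "?S \<noteq> {}" by (rule emp.support_matching_nonempty[OF fc m x])
  then have D: "emp.D ?k x = ?S" by (simp add: donors_def)
  have fin: "finite ?S" and sub: "?S \<subseteq> I" using I by (auto simp: matching_def)
  have card: "real (card ?S) > 0" using S_ne fin by (simp add: card_gt_0_iff)
  define g where "g y = f (x(?k := y))" for y
  have g: "lip_fun (cube (d ?k)) (cube_dist (d ?k)) l g" unfolding g_def by (rule lip_fun_update[OF f xs])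
  have X_k: "X i ?k \<in> space (cube (d ?k))" if "i \<in> ?S" for i using X_component[OF _ k] sub that by auto
  \<comment> \<open>On the parents \<open>x\<close> carries a rounded value, so to match it is to
    lie in the corresponding dyadic cell.\<close>
  have mem: "i \<in> ?S \<longleftrightarrow> i \<in> I \<and> blocks_q d ?p J (restrict (X i) ?p) = restrict x ?p" for i
    by (simp add: Y_pa[OF k, symmetric] restrict_eq_iff) (auto simp: matching_def)
  \<comment> \<open>Point masses put the sample values into the form that \<open>chaining\<close>
    compares with the kernels.\<close>
  define a where "a i = return (cube (d ?k)) (X i ?k)" for i
  define \<tau> where "\<tau> i = \<kappa> ?k (restrict (X i) ?p)" for i
  have a: "prob_space (a i) \<and> sets (a i) = sets (cube (d ?k))" if "i \<in> ?S" for i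
    using prob_space_return[OF X_k[OF that]] by (simp add: a_def)
  have \<tau>: "prob_space (\<tau> i) \<and> sets (\<tau> i) = sets (cube (d ?k))" if "i \<in> ?S" for i
    using kernel_props[OF k X_pa[OF _ k]] that sub by (auto simp: \<tau>_def)
  have int_a: "(\<integral>y. g y \<partial>a i) = g (X i ?k)" if "i \<in> ?S" for i
    using g X_k[OF that] by (simp add: a_def lip_fun_def integral_return)
  have fl: "(\<Sum>i\<in>?S. measure (a i) (c.cell (d ?k) j z) - measure (\<tau> i) (c.cell (d ?k) j z)) =
    (\<Sum>i\<in>I. fluct d E \<kappa> J ?k (restrict x ?p) j z (X i))" for j z
  proof -
    have "(\<Sum>i\<in>I. fluct d E \<kappa> J ?k (restrict x ?p) j z (X i)) = (\<Sum>i\<in>?S. fluct d E \<kappa> J ?k (restrict x ?p) j z (X i))"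
    proof (rule sum.mono_neutral_right[OF I(1) sub], intro ballI)
      fix i assume "i \<in> I - ?S"
      then have "restrict (X i) ?p \<notin> p.cell ?k J (restrict x ?p)" using mem by (auto simp: p.cell_def)
      then show "fluct d E \<kappa> J ?k (restrict x ?p) j z (X i) = 0" by (simp add: fluct_def)
    qed
    also have "\<dots> = (\<Sum>i\<in>?S. measure (a i) (c.cell (d ?k) j z) - measure (\<tau> i) (c.cell (d ?k) j z))"
    proof (intro sum.cong refl)
      fix i assume i: "i \<in> ?S"
      then have "restrict (X i) ?p \<in> p.cell ?k J (restrict x ?p)"
        using mem X_pa[OF _ k] by (auto simp: p.cell_def)
      then show "fluct d E \<kappa> J ?k (restrict x ?p) j z (X i) = measure (a i) (c.cell (d ?k) j z) - measure (\<tau> i) (c.cell (d ?k) j z)"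
        by (simp add: fluct_def a_def \<tau>_def measure_return)
    qed
    finally show ?thesis by simp
  qed
  have A: "\<bar>\<Sum>i\<in>?S. g (X i ?k) - (\<integral>y. g y \<partial>\<tau> i)\<bar> \<le> l * (real (card ?S) * (2 * ?h) + ?T)"
  proof -
    have "\<bar>\<Sum>i\<in>?S. (\<integral>y. g y \<partial>a i) - (\<integral>y. g y \<partial>\<tau> i)\<bar> \<le> l * (real (card ?S) * (2 * ?h) + (\<Sum>j\<le>J. 2 * (1/2) ^ j *
      (\<Sum>z\<in>cube_grid (d ?k) j. \<bar>\<Sum>i\<in>?S. measure (a i) (c.cell (d ?k) j z) - measure (\<tau> i) (c.cell (d ?k) j z)\<bar>)))"
      by (rule c.chaining[OF fin _ _ g f(2)]) (use a \<tau> in auto)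
    moreover have "(\<Sum>i\<in>?S. (\<integral>y. g y \<partial>a i) - (\<integral>y. g y \<partial>\<tau> i)) = (\<Sum>i\<in>?S. g (X i ?k) - (\<integral>y. g y \<partial>\<tau> i))"
      by (intro sum.cong refl) (simp add: int_a)
    ultimately show ?thesis by (simp only: fl total_fluct_def)
  qed
  have B: "\<bar>\<Sum>i\<in>?S. g (Y i ?k) - g (X i ?k)\<bar> \<le> real (card ?S) * (l * ?h)"
  proof (rule order_trans[OF sum_abs sum_bounded_above])
    fix i assume i: "i \<in> ?S"
    have "\<bar>g (X i ?k) - g (Y i ?k)\<bar> \<le> l * cube_dist (d ?k) (X i ?k) (Y i ?k)"
      using g X_k[OF i] c.q_space[OF X_k[OF i]] by (auto simp: lip_fun_def Y_component[OF k])
    also have "\<dots> \<le> l * ?h"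
      using c.dist_q[OF X_k[OF i], of J] f(2) by (simp add: Y_component[OF k] mult_left_mono)
    finally show "\<bar>g (Y i ?k) - g (X i ?k)\<bar> \<le> l * ?h" by (simp add: abs_minus_commute)
  qed
  have C: "\<bar>\<Sum>i\<in>?S. (\<integral>y. g y \<partial>\<tau> i) - mean m f x\<bar> \<le> real (card ?S) * (l * (L * ?h))"
  proof (rule order_trans[OF sum_abs sum_bounded_above])
    fix i assume i: "i \<in> ?S"
    then have iI: "i \<in> I" using sub by auto
    have "blocks_dist d ?p (restrict (X i) ?p) (restrict x ?p) \<le> ?h"
      using p.dist_q[OF X_pa[OF iI k], of J] i mem by simp
    then have "l * (L * blocks_dist d ?p (restrict (X i) ?p) (restrict x ?p)) \<le> l * (L * ?h)"
      using f(2) L by (intro mult_left_mono) auto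
    then show "\<bar>(\<integral>y. g y \<partial>\<tau> i) - mean m f x\<bar> \<le> l * (L * ?h)"
      using kernel_lip[OF k X_pa[OF iI k] rx f(2) g] unfolding mean_def \<tau>_def g_def by linarith
  qed
  have "(\<Sum>i\<in>?S. g (Y i ?k)) - real (card ?S) * mean m f x =
    (\<Sum>i\<in>?S. g (Y i ?k) - g (X i ?k)) + (\<Sum>i\<in>?S. g (X i ?k) - (\<integral>y. g y \<partial>\<tau> i)) + (\<Sum>i\<in>?S. (\<integral>y. g y \<partial>\<tau> i) - mean m f x)"
    by (simp add: sum_subtractf)
  then have "\<bar>(\<Sum>i\<in>?S. g (Y i ?k)) - real (card ?S) * mean m f x\<bar> \<le>
    real (card ?S) * (l * ?h) + l * (real (card ?S) * (2 * ?h) + ?T) + real (card ?S) * (l * (L * ?h))"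
    using A B C by linarith
  also have "\<dots> = (l * local_bound m x) * real (card ?S)"
    using card by (simp add: local_bound_def field_simps)
  finally have "\<bar>(\<Sum>i\<in>?S. g (Y i ?k)) - real (card ?S) * mean m f x\<bar> / real (card ?S) \<le> l * local_bound m x"
    using card by (simp add: pos_divide_le_eq)
  moreover have "(\<Sum>i\<in>?S. g (Y i ?k)) / real (card ?S) - mean m f x = ((\<Sum>i\<in>?S. g (Y i ?k)) - real (card ?S) * mean m f x) / real (card ?S)"
    using card by (simp add: field_simps)
  ultimately show ?thesis unfolding D g_def using card by (simp add: abs_divide)
qed

text \<open>The bound sees only the parents, so its mean under the empirical product is an average
  over the sample, where the counts cancel.\<close>

lemma local_bound_average:
  assumes m: "m < K"
  shows "measure_pmf.expectation (emp.P m) (local_bound m) \<le> level_error d E \<kappa> L J I X (Suc m)"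
proof -
  have k: "Suc m \<in> {1..K}" using m by simp
  let ?T = "total_fluct d E \<kappa> J I X (Suc m)" and ?p = "pa E (Suc m)"
  have dep: "depends_on (local_bound m) ?p"
    unfolding depends_on_def
  proof (intro allI impI)
    fix x y :: point assume "\<forall>l\<in>?p. x l = y l"
    then have "restrict x ?p = restrict y ?p" "emp.S (Suc m) x = emp.S (Suc m) y"
      by (auto simp: restrict_eq_iff intro!: matching_cong)
    then show "local_bound m x = local_bound m y" by (simp add: local_bound_def)
  qed
  have "measure_pmf.expectation (emp.P m) (local_bound m) = (\<Sum>i\<in>I. local_bound m (Y i)) / card I"
    by (rule emp.marginal_pa[OF fc m dep])
  also have "\<dots> = (3 + L) * (1/2) ^ J + (\<Sum>i\<in>I. ?T (restrict (Y i) ?p) / card (emp.S (Suc m) (Y i))) / card I"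
    using I by (simp add: local_bound_def sum.distrib add_divide_distrib card_gt_0_iff)
  also have "\<dots> \<le> level_error d E \<kappa> L J I X (Suc m)"
    unfolding level_error_def
  proof (intro add_left_mono divide_right_mono sum_matching_le)
    show "restrict (Y i) ?p \<in> blocks_grid d ?p J" if "i \<in> I" for i
      unfolding Y_pa[OF k] by (rule p.q_in[OF X_pa[OF that k]])
  qed (auto simp: I p.finite_G total_fluct_nonneg)
  finally show ?thesis .
qed

text \<open>The last empirical conditional law is exchanged for the true kernel, at the price of one
  \<open>level_error\<close>; what remains is the same problem for \<open>mean m f\<close>, one
  block shorter and with constant \<open>l * (1 + L)\<close>. The induction therefore keeps
  \<open>l\<close> and \<open>f\<close> arbitrary.\<close>

lemma product_estimate:
  assumes "m \<le> K" "lip_fun (blocks d {1..m}) (blocks_dist d {1..m}) l f" "l \<ge> 0"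
  shows "\<bar>measure_pmf.expectation (emp.P m) f - (\<integral>x. f (restrict x {1..m}) \<partial>\<mu>)\<bar> \<le> l * product_error d E \<kappa> L J I X m"
  using assms
proof (induction m arbitrary: f l)
  case 0
  then show ?case using prob_space.prob_space[OF \<mu>(1)] by (simp add: restrict_def)
next
  case (Suc m)
  have m: "m < K" using Suc.prems(1) by simp
  note f = Suc.prems(2,3)
  define \<phi> where "\<phi> x = (\<Sum>i\<in>emp.D (Suc m) x. f (x(Suc m := Y i (Suc m)))) / card (emp.D (Suc m) x)" for x
  have 1: "\<bar>measure_pmf.expectation (emp.P m) \<phi> - measure_pmf.expectation (emp.P m) (mean m f)\<bar> \<le> l * level_error d E \<kappa> L J I X (Suc m)"
  proof -
    have "\<bar>measure_pmf.expectation (emp.P m) \<phi> - measure_pmf.expectation (emp.P m) (mean m f)\<bar> =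
      \<bar>measure_pmf.expectation (emp.P m) (\<lambda>x. \<phi> x - mean m f x)\<bar>"
      by (simp add: emp.integrable_P)
    also have "\<dots> \<le> measure_pmf.expectation (emp.P m) (\<lambda>x. \<bar>\<phi> x - mean m f x\<bar>)"
      using integral_norm_bound[of "measure_pmf (emp.P m)" "\<lambda>x. \<phi> x - mean m f x"] by simp
    also have "\<dots> \<le> measure_pmf.expectation (emp.P m) (\<lambda>x. l * local_bound m x)"
    proof (intro integral_mono_AE emp.integrable_P)
      have "\<forall>x\<in>set_pmf (emp.P m). \<bar>\<phi> x - mean m f x\<bar> \<le> l * local_bound m x"
        unfolding \<phi>_def using local_estimate[OF m f] by blast
      then show "AE x in measure_pmf (emp.P m). \<bar>\<phi> x - mean m f x\<bar> \<le> l * local_bound m x"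
        by (simp add: AE_measure_pmf_iff)
    qed
    also have "\<dots> = l * measure_pmf.expectation (emp.P m) (local_bound m)" by simp
    also have "\<dots> \<le> l * level_error d E \<kappa> L J I X (Suc m)"
      using local_bound_average[OF m] f(2) by (rule mult_left_mono)
    finally show ?thesis .
  qed
  have restr: "restrict (restrict x {1..m}) (pa E (Suc m)) = restrict x (pa E (Suc m))" for x :: point
    using pa_sub_Suc[of m] by (simp add: Int_absorb1)
  have "(\<integral>x. f (restrict x {1..Suc m}) \<partial>\<mu>) = (\<integral>x. mean m f (restrict x {1..m}) \<partial>\<mu>)"
    using disintegration[OF m f(2,1)] by (simp only: mean_def restr)
  moreover have "\<bar>measure_pmf.expectation (emp.P m) (mean m f) - (\<integral>x. mean m f (restrict x {1..m}) \<partial>\<mu>)\<bar> \<le>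
    l * (1 + L) * product_error d E \<kappa> L J I X m"
    using m f(2) L by (intro Suc.IH lip_fun_mean[OF m f]) auto
  moreover have "measure_pmf.expectation (emp.P (Suc m)) f = measure_pmf.expectation (emp.P m) \<phi>"
    unfolding \<phi>_def by (rule emp.expectation_Suc)
  moreover have "l * product_error d E \<kappa> L J I X (Suc m) =
    l * (1 + L) * product_error d E \<kappa> L J I X m + l * level_error d E \<kappa> L J I X (Suc m)"
    by (simp add: algebra_simps)
  ultimately show ?case using 1 by linarith
qed

end

section \<open>Expected fluctuations\<close>

lemma sum_sqrt_le:
  fixes w :: "'a \<Rightarrow> real"
  assumes "\<And>s. s \<in> A \<Longrightarrow> w s \<ge> 0"
  shows "(\<Sum>s\<in>A. sqrt (w s)) \<le> sqrt (card A * (\<Sum>s\<in>A. w s))"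
proof (rule real_le_rsqrt)
  have "(\<Sum>s\<in>A. 1 * sqrt (w s))\<^sup>2 \<le> (\<Sum>s\<in>A. 1\<^sup>2) * (\<Sum>s\<in>A. (sqrt (w s))\<^sup>2)"
    by (rule Cauchy_Schwarz_ineq_sum)
  then show "(\<Sum>s\<in>A. sqrt (w s))\<^sup>2 \<le> card A * (\<Sum>s\<in>A. w s)" using assms by simp
qed

text \<open>After squaring and clearing denominators everything rests on j dk + 2 J \<le> J max {2,
  dk} + 2 j. For dk \<ge> 2 the difference is (J - j) (dk - 2), and for dk \<le> 2 it is clear; this
  is the reason for the maximum in \<open>d_loc\<close>. The 6 combines the variance factor 2 with
  \<open>n \<le> 3 * m\<close>, and \<open>2 ^ DS\<close> collects the constants in the grid
  cardinalities.\<close>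

lemma level_term_bound:
  fixes J j dp dk D DS n m :: nat
  assumes "j \<le> J" "2 ^ (J * D) \<le> n" "n \<le> 3 * m" "m > 0" "dp + max 2 dk \<le> D" "dp + dk \<le> DS"
  shows "(1/2) ^ j * sqrt ((2::real) * ((2 * 2 ^ J) ^ dp * (2 * 2 ^ j) ^ dk) / real m) \<le> sqrt (6 * 2 ^ DS) * (1/2) ^ J"
proof -
  have "real (2 ^ (j * dk + 2 * J)) \<le> 2 ^ (J * max 2 dk + 2 * j)"
  proof -
    have "j * dk + 2 * J \<le> J * max 2 dk + 2 * j"
    proof (cases "dk \<le> 2")
      case True
      then have "j * dk \<le> 2 * j" by simp
      then show ?thesis using True by simp
    next
      case False
      then obtain e where e: "dk = 2 + e" using le_Suc_ex by (metis nat_le_linear)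
      have "j * e \<le> J * e" using assms(1) by simp
      then show ?thesis by (simp add: e algebra_simps)
    qed
    then show ?thesis by (simp add: power_increasing)
  qed
  then have 1: "2 ^ (j * dk) * (2::real) ^ (2 * J) \<le> 2 ^ (J * max 2 dk) * 2 ^ (2 * j)" by (simp add: power_add)
  have 2: "(2::real) ^ (J * dp) * 2 ^ (J * max 2 dk) \<le> 3 * real m"
  proof -
    have "J * dp + J * max 2 dk \<le> J * D" using assms(5) by (simp add: add_mult_distrib2[symmetric])
    then have "(2::real) ^ (J * dp + J * max 2 dk) \<le> 2 ^ (J * D)" by (intro power_increasing) auto
    also have "\<dots> = real (2 ^ (J * D))" by simp
    also have "\<dots> \<le> real (3 * m)" using assms(2,3) by (simp only: of_nat_le_iff)
    finally show ?thesis by (simp add: power_add)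
  qed
  have 3: "(2::real) ^ (dp + dk) \<le> 2 ^ DS" using assms(6) by (intro power_increasing) auto
  have "(2::real) * ((2 * 2 ^ J) ^ dp * (2 * 2 ^ j) ^ dk) * 2 ^ (2 * J) = 2 * 2 ^ (dp + dk) * 2 ^ (J * dp) * (2 ^ (j * dk) * (2::real) ^ (2 * J))"
    by (simp add: power_mult_distrib power_add power_mult[symmetric] mult_ac)
  also have "\<dots> \<le> 2 * 2 ^ (dp + dk) * 2 ^ (J * dp) * (2 ^ (J * max 2 dk) * 2 ^ (2 * j))"
    using 1 by (intro mult_left_mono) auto
  also have "\<dots> = 2 * 2 ^ (dp + dk) * (2 ^ (J * dp) * 2 ^ (J * max 2 dk)) * 2 ^ (2 * j)" by simp
  also have "\<dots> \<le> 2 * 2 ^ DS * (3 * real m) * 2 ^ (2 * j)"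
  proof -
    have "2 * 2 ^ (dp + dk) * (2 ^ (J * dp) * 2 ^ (J * max 2 dk)) \<le> (2::real) * 2 ^ DS * (3 * real m)"
      by (rule mult_mono) (use 2 3 in auto)
    then show ?thesis by (rule mult_right_mono) simp
  qed
  finally have 4: "(2::real) * ((2 * 2 ^ J) ^ dp * (2 * 2 ^ j) ^ dk) * 2 ^ (2 * J) \<le> 6 * 2 ^ DS * real m * 2 ^ (2 * j)" by simp
  have pow_sqrt: "(2::real) ^ a = sqrt (2 ^ (2 * a))" for a :: nat
    by (simp add: power_mult power_commuting_commutes mult.commute[of 2 a])
  have "sqrt ((2::real) * ((2 * 2 ^ J) ^ dp * (2 * 2 ^ j) ^ dk) / real m) * 2 ^ J = sqrt ((2::real) * ((2 * 2 ^ J) ^ dp * (2 * 2 ^ j) ^ dk) / real m * 2 ^ (2 * J))"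
    by (simp only: real_sqrt_mult pow_sqrt[symmetric])
  also have "\<dots> \<le> sqrt (6 * 2 ^ DS * 2 ^ (2 * j))"
    using 4 assms(4) by (intro real_sqrt_le_mono) (simp add: field_simps)
  also have "\<dots> = sqrt (6 * 2 ^ DS) * 2 ^ j"
    by (simp only: real_sqrt_mult pow_sqrt[symmetric])
  finally show ?thesis by (simp add: power_one_over field_simps)
qed

text \<open>The product measure runs over the whole sample \<open>N\<close> although only
  \<open>I\<close> is fitted, so that these bounds can later be added to those for the other
  half.\<close>

locale kernel_sample = graph_kernels d K E \<kappa>
  for d :: "nat \<Rightarrow> nat" and K :: nat and E :: "nat rel"
    and \<kappa> :: "nat \<Rightarrow> point \<Rightarrow> (nat \<Rightarrow> real) measure" +
  fixes \<mu> :: "point measure" and J :: nat and N I :: "'i set"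
  assumes \<mu>: "prob_space \<mu>" "sets \<mu> = sets (blocks d {1..K})"
    and cond: "\<And>k. k \<in> {1..K} \<Longrightarrow> cond_distr d \<mu> k (pa E k) (\<kappa> k)"
    and N: "finite N" "I \<subseteq> N" "I \<noteq> {}"
begin

interpretation c: quantized "cube m" "cube_dist m" "cube_q m" "cube_grid m" for m by (rule quantized_cube)

lemma finite_pa: "finite (pa E k)"
  using pa_sub finite_subset by blast

interpretation p: quantized "blocks d (pa E k)" "blocks_dist d (pa E k)" "blocks_q d (pa E k)" "blocks_grid d (pa E k)" for k
  by (rule quantized_blocks[OF finite_pa])

abbreviation "sample \<equiv> \<Pi>\<^sub>M i\<in>N. \<mu>"

lemma finite_I: "finite I" using N finite_subset by blast

lemma restrict_pa:
  assumes "k \<in> {1..K}"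
  shows "(\<lambda>x. restrict x (pa E k)) \<in> \<mu> \<rightarrow>\<^sub>M blocks d (pa E k)"
  unfolding measurable_cong_sets[OF \<mu>(2) refl]
  by (rule measurable_blocks_restrict) (use pa_sub[of k] assms in auto)

lemma component: "k \<in> {1..K} \<Longrightarrow> (\<lambda>x. x k) \<in> \<mu> \<rightarrow>\<^sub>M cube (d k)"
  unfolding measurable_cong_sets[OF \<mu>(2) refl] by (rule measurable_blocks_component)

definition joint :: "nat \<Rightarrow> point \<Rightarrow> nat \<Rightarrow> (nat \<Rightarrow> real) \<Rightarrow> point set" where
  "joint k c j z = {x \<in> space \<mu>. restrict x (pa E k) \<in> p.cell k J c \<and> x k \<in> c.cell (d k) j z}"

lemma joint_sets:
  assumes "k \<in> {1..K}"
  shows "joint k c j z \<in> sets \<mu>"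
proof -
  have "joint k c j z = ((\<lambda>x. restrict x (pa E k)) -` p.cell k J c \<inter> space \<mu>) \<inter> ((\<lambda>x. x k) -` c.cell (d k) j z \<inter> space \<mu>)"
    by (auto simp: joint_def)
  then show ?thesis
    by (simp only:) (rule sets.Int measurable_sets[OF restrict_pa[OF assms] p.cell_sets]
      measurable_sets[OF component[OF assms] c.cell_sets])+
qed

text \<open>The two terms of the fluctuation have the same integral, the joint cell probability: for
  the first this is immediate, for the second it is the defining identity of the conditional law.
  Both the centring and the variance bound follow.\<close>

lemma fluct_parts:
  assumes k: "k \<in> {1..K}"
  defines "A \<equiv> \<lambda>c x. indicator (p.cell k J c) (restrict x (pa E k)) :: real"
    and "M \<equiv> \<lambda>j z x. measure (\<kappa> k (restrict x (pa E k))) (c.cell (d k) j z)"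
  shows "integrable \<mu> (\<lambda>x. A c x * indicator (c.cell (d k) j z) (x k))"
    and "integrable \<mu> (\<lambda>x. A c x * M j z x)"
    and "(\<integral>x. A c x * indicator (c.cell (d k) j z) (x k) \<partial>\<mu>) = measure \<mu> (joint k c j z)"
    and "(\<integral>x. A c x * M j z x \<partial>\<mu>) = measure \<mu> (joint k c j z)"
proof -
  interpret prob_space \<mu> by (rule \<mu>(1))
  have A [measurable]: "A c \<in> borel_measurable \<mu>"
    unfolding A_def by (intro measurable_compose[OF restrict_pa[OF k]] borel_measurable_indicator p.cell_sets)
  have M [measurable]: "M j z \<in> borel_measurable \<mu>"
    unfolding M_def
    by (rule measurable_compose[OF measurable_compose[OF restrict_pa[OF k] kernel[OF k]] measurable_measure_prob_algebra[OF c.cell_sets]])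
  have M1: "0 \<le> M j z x" "M j z x \<le> 1" if "x \<in> space \<mu>" for x
    using prob_space.prob_le_1[OF kernel_props(1)[OF k measurable_space[OF restrict_pa[OF k] that]]] by (auto simp: M_def)
  have ind: "A c x * indicator (c.cell (d k) j z) (x k) = indicator (joint k c j z) x" if "x \<in> space \<mu>" for x
    using that by (auto simp: A_def joint_def split: split_indicator)
  show 1: "integrable \<mu> (\<lambda>x. A c x * indicator (c.cell (d k) j z) (x k))"
    using joint_sets[OF k] by (subst Bochner_Integration.integrable_cong[OF refl ind]) (auto simp: emeasure_finite less_top[symmetric])
  show 2: "integrable \<mu> (\<lambda>x. A c x * M j z x)"
  proof (rule integrable_const_bound[where B=1])
    show "AE x in \<mu>. norm (A c x * M j z x) \<le> 1"
      using M1 by (intro AE_I2) (auto simp: A_def split: split_indicator)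
  qed (rule borel_measurable_times[OF A M])
  show "(\<integral>x. A c x * indicator (c.cell (d k) j z) (x k) \<partial>\<mu>) = measure \<mu> (joint k c j z)"
    using joint_sets[OF k] by (subst Bochner_Integration.integral_cong[OF refl ind]) auto
  have "ennreal (\<integral>x. A c x * M j z x \<partial>\<mu>) = (\<integral>\<^sup>+x. ennreal (A c x * M j z x) \<partial>\<mu>)"
  proof (rule nn_integral_eq_integral[OF 2, symmetric])
    show "AE x in \<mu>. 0 \<le> A c x * M j z x" using M1 by (intro AE_I2) (auto simp: A_def)
  qed
  also have "\<dots> = (\<integral>\<^sup>+x. indicator (p.cell k J c) (restrict x (pa E k)) * emeasure (\<kappa> k (restrict x (pa E k))) (c.cell (d k) j z) \<partial>\<mu>)"
  proof (rule nn_integral_cong)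
    fix x assume "x \<in> space \<mu>"
    then interpret k: prob_space "\<kappa> k (restrict x (pa E k))"
      using kernel_props(1)[OF k measurable_space[OF restrict_pa[OF k]]] by simp
    show "ennreal (A c x * M j z x) = indicator (p.cell k J c) (restrict x (pa E k)) * emeasure (\<kappa> k (restrict x (pa E k))) (c.cell (d k) j z)"
      by (auto simp: A_def M_def k.emeasure_eq_measure split: split_indicator)
  qed
  also have "\<dots> = emeasure \<mu> (joint k c j z)"
    using cond[OF k] unfolding cond_distr_def joint_def by simp
  finally have eq: "ennreal (\<integral>x. A c x * M j z x \<partial>\<mu>) = ennreal (measure \<mu> (joint k c j z))"
    by (simp only: emeasure_eq_measure)
  have "0 \<le> (\<integral>x. A c x * M j z x \<partial>\<mu>)"
    using M1 by (intro integral_nonneg_AE AE_I2) (auto simp: A_def)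
  then show "(\<integral>x. A c x * M j z x \<partial>\<mu>) = measure \<mu> (joint k c j z)"
    using eq by (subst (asm) ennreal_inj) auto
qed

lemma fluct_eq:
  "fluct d E \<kappa> J k c j z x = indicator (p.cell k J c) (restrict x (pa E k)) * indicator (c.cell (d k) j z) (x k) -
    indicator (p.cell k J c) (restrict x (pa E k)) * measure (\<kappa> k (restrict x (pa E k))) (c.cell (d k) j z)"
  by (simp add: fluct_def right_diff_distrib)

lemma fluct_mean:
  assumes k: "k \<in> {1..K}"
  shows "(\<integral>x. fluct d E \<kappa> J k c j z x \<partial>\<mu>) = 0"
  unfolding fluct_eq Bochner_Integration.integral_diff[OF fluct_parts(1,2)[OF k]] fluct_parts(3,4)[OF k] by simp

lemma fluct_measurable: "k \<in> {1..K} \<Longrightarrow> fluct d E \<kappa> J k c j z \<in> borel_measurable \<mu>"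
  unfolding fluct_eq[abs_def]
  by (rule borel_measurable_diff[OF borel_measurable_integrable[OF fluct_parts(1)] borel_measurable_integrable[OF fluct_parts(2)]])

lemma fluct_abs_le_1:
  assumes "k \<in> {1..K}" "x \<in> space \<mu>"
  shows "\<bar>fluct d E \<kappa> J k c j z x\<bar> \<le> 1"
proof -
  have "measure (\<kappa> k (restrict x (pa E k))) (c.cell (d k) j z) \<le> 1"
    using prob_space.prob_le_1[OF kernel_props(1)[OF assms(1) measurable_space[OF restrict_pa[OF assms(1)] assms(2)]]] .
  then show ?thesis by (auto simp: fluct_def split: split_indicator)
qed

text \<open>The fluctuation is at most 1 in modulus, so its square is below its modulus, which is
  below the sum of its two terms.\<close>

lemma fluct_square:
  assumes k: "k \<in> {1..K}"
  shows "(\<integral>x. (fluct d E \<kappa> J k c j z x)\<^sup>2 \<partial>\<mu>) \<le> 2 * measure \<mu> (joint k c j z)"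
proof -
  interpret prob_space \<mu> by (rule \<mu>(1))
  let ?f = "fluct d E \<kappa> J k c j z"
  let ?g = "\<lambda>x. indicator (p.cell k J c) (restrict x (pa E k)) * indicator (c.cell (d k) j z) (x k) +
    indicator (p.cell k J c) (restrict x (pa E k)) * measure (\<kappa> k (restrict x (pa E k))) (c.cell (d k) j z)"
  have "(\<integral>x. (?f x)\<^sup>2 \<partial>\<mu>) \<le> (\<integral>x. ?g x \<partial>\<mu>)"
  proof (rule integral_mono)
    show "integrable \<mu> (\<lambda>x. (?f x)\<^sup>2)"
    proof (rule integrable_const_bound[where B=1])
      show "AE x in \<mu>. norm ((?f x)\<^sup>2) \<le> 1"
        using fluct_abs_le_1[OF k] by (intro AE_I2) (simp add: abs_square_le_1)
    qed (rule borel_measurable_power[OF fluct_measurable[OF k]])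
    show "integrable \<mu> ?g" by (rule Bochner_Integration.integrable_add[OF fluct_parts(1,2)[OF k]])
    fix x assume x: "x \<in> space \<mu>"
    have "(?f x)\<^sup>2 = \<bar>?f x\<bar> * \<bar>?f x\<bar>" by (simp add: power2_eq_square)
    also have "\<dots> \<le> \<bar>?f x\<bar> * 1" using fluct_abs_le_1[OF k x] by (intro mult_left_mono) auto
    also have "\<dots> \<le> ?g x"
    proof -
      define r where "r = measure (\<kappa> k (restrict x (pa E k))) (c.cell (d k) j z)"
      have "r \<ge> 0" by (simp add: r_def)
      then show ?thesis unfolding fluct_def r_def[symmetric] by (auto split: split_indicator)
    qed
    finally show "(?f x)\<^sup>2 \<le> ?g x" .
  qed
  also have "\<dots> = 2 * measure \<mu> (joint k c j z)"
    unfolding Bochner_Integration.integral_add[OF fluct_parts(1,2)[OF k]] fluct_parts(3,4)[OF k] by simp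
  finally show ?thesis .
qed

lemma fluct_component_measurable:
  assumes "k \<in> {1..K}" "i \<in> N"
  shows "(\<lambda>X. fluct d E \<kappa> J k c j z (X i)) \<in> borel_measurable sample"
  by (rule measurable_compose[OF measurable_component_singleton[OF assms(2)] fluct_measurable[OF assms(1)]])

lemma fluct_sum_integrable:
  assumes k: "k \<in> {1..K}"
  shows "integrable sample (\<lambda>X. \<bar>\<Sum>i\<in>I. fluct d E \<kappa> J k c j z (X i)\<bar>)"
proof -
  interpret P: prob_space sample by (intro prob_space_PiM \<mu>)
  show ?thesis
  proof (intro P.integrable_const_bound[where B="real (card I)"] AE_I2)
    fix X assume X: "X \<in> space sample"
    have "\<bar>fluct d E \<kappa> J k c j z (X i)\<bar> \<le> 1" if "i \<in> I" for i
      using X that N by (intro fluct_abs_le_1[OF k]) (auto simp: space_PiM PiE_iff)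
    then have "(\<Sum>i\<in>I. \<bar>fluct d E \<kappa> J k c j z (X i)\<bar>) \<le> real (card I) * 1" by (intro sum_bounded_above)
    then show "norm \<bar>\<Sum>i\<in>I. fluct d E \<kappa> J k c j z (X i)\<bar> \<le> real (card I)"
      by (simp add: order_trans[OF sum_abs])
  next
    show "(\<lambda>X. \<bar>\<Sum>i\<in>I. fluct d E \<kappa> J k c j z (X i)\<bar>) \<in> borel_measurable sample"
      using fluct_component_measurable[OF k] N by (intro borel_measurable_abs borel_measurable_sum) blast
  qed
qed

lemma fluct_sum_expectation:
  assumes k: "k \<in> {1..K}"
  shows "(\<integral>X. \<bar>\<Sum>i\<in>I. fluct d E \<kappa> J k c j z (X i)\<bar> \<partial>sample) \<le> sqrt (card I * (2 * measure \<mu> (joint k c j z)))"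
proof (rule PiM_orthogonal_sum[OF \<mu>(1) N(1,2), where B=1])
  fix i assume "i \<in> I"
  then have i: "i \<in> N" using N by auto
  show "(\<lambda>X. fluct d E \<kappa> J k c j z (X i)) \<in> borel_measurable sample" by (rule fluct_component_measurable[OF k i])
  show "\<bar>fluct d E \<kappa> J k c j z (X i)\<bar> \<le> 1" if "X \<in> space sample" for X
    using that i by (intro fluct_abs_le_1[OF k]) (auto simp: space_PiM PiE_iff)
  have "(\<integral>X. (fluct d E \<kappa> J k c j z (X i))\<^sup>2 \<partial>sample) = (\<integral>x. (fluct d E \<kappa> J k c j z x)\<^sup>2 \<partial>distr sample \<mu> (\<lambda>X. X i))"
    using fluct_measurable[OF k] i
    by (intro integral_distr[symmetric] measurable_component_singleton) auto
  also have "distr sample \<mu> (\<lambda>X. X i) = \<mu>"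
    using distr_PiM_component[of N "\<lambda>_. \<mu>" i] N(1) \<mu>(1) i by simp
  also have "(\<integral>x. (fluct d E \<kappa> J k c j z x)\<^sup>2 \<partial>\<mu>) \<le> 2 * measure \<mu> (joint k c j z)" by (rule fluct_square[OF k])
  finally show "(\<integral>X. (fluct d E \<kappa> J k c j z (X i))\<^sup>2 \<partial>sample) \<le> 2 * measure \<mu> (joint k c j z)" .
qed (use fluct_mean[OF k] in auto)

lemma level_error_integrable:
  assumes k: "k \<in> {1..K}"
  shows "integrable sample (\<lambda>X. level_error d E \<kappa> L J I X k)"
proof -
  interpret P: prob_space sample by (intro prob_space_PiM \<mu>)
  show ?thesis unfolding level_error_def total_fluct_def
    by (intro Bochner_Integration.integrable_add P.integrable_const integrable_divide integrable_mult_right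
        Bochner_Integration.integrable_sum fluct_sum_integrable[OF k])
qed

lemma sum_joint_le_1:
  assumes k: "k \<in> {1..K}"
  shows "(\<Sum>s\<in>blocks_grid d (pa E k) J \<times> cube_grid (d k) j. measure \<mu> (joint k (fst s) j (snd s))) \<le> 1"
proof -
  interpret prob_space \<mu> by (rule \<mu>(1))
  let ?G = "blocks_grid d (pa E k) J \<times> cube_grid (d k) j"
  have "(\<Sum>s\<in>?G. measure \<mu> (joint k (fst s) j (snd s))) = measure \<mu> (\<Union>s\<in>?G. joint k (fst s) j (snd s))"
    using joint_sets[OF k]
    by (intro finite_measure_finite_Union[symmetric]) (auto simp: p.finite_G c.finite_G disjoint_family_on_def joint_def p.cell_def c.cell_def)
  then show ?thesis by simp
qed

text \<open>For fixed \<open>j\<close>, Cauchy-Schwarz is applied to all pairs of a parent cell and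
  a cell of the block at once: their probabilities sum to at most 1 and only the number of pairs
  remains. All scales then obey the same bound, and \<open>J + 1\<close> counts them.\<close>

lemma level_error_expectation:
  assumes k: "k \<in> {1..K}" and L: "L \<ge> 0" and n: "2 ^ (J * D) \<le> n" "n \<le> 3 * card I"
    and D: "(\<Sum>l\<in>pa E k. d l) + max 2 (d k) \<le> D"
  shows "(\<integral>X. level_error d E \<kappa> L J I X k \<partial>sample) \<le>
    (3 + L + 2 * sqrt (6 * 2 ^ (\<Sum>l\<in>{1..K}. d l))) * ((real J + 1) * (1/2) ^ J)"
proof -
  interpret P: prob_space sample by (intro prob_space_PiM \<mu>)
  let ?dp = "\<Sum>l\<in>pa E k. d l" and ?DS = "\<Sum>l\<in>{1..K}. d l" and ?m = "real (card I)"
  let ?G = "\<lambda>j. blocks_grid d (pa E k) J \<times> cube_grid (d k) j"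
  let ?e = "\<lambda>c j z. \<integral>X. \<bar>\<Sum>i\<in>I. fluct d E \<kappa> J k c j z (X i)\<bar> \<partial>sample"
  have m: "?m > 0" using finite_I N(3) by (simp add: card_gt_0_iff)
  have DS: "?dp + d k \<le> ?DS"
  proof -
    have "?dp + d k = (\<Sum>l\<in>insert k (pa E k). d l)" using finite_pa pa_sub[of k] by (subst sum.insert) auto
    also have "\<dots> \<le> ?DS" using k pa_sub[of k] by (intro sum_mono2) auto
    finally show ?thesis .
  qed
  have inner: "(\<Sum>c\<in>blocks_grid d (pa E k) J. \<Sum>z\<in>cube_grid (d k) j. ?e c j z) \<le>
    ?m * sqrt (2 * ((2 * 2 ^ J) ^ ?dp * (2 * 2 ^ j) ^ d k) / ?m)" for j
  proof -
    have "(\<Sum>c\<in>blocks_grid d (pa E k) J. \<Sum>z\<in>cube_grid (d k) j. ?e c j z) = (\<Sum>s\<in>?G j. ?e (fst s) j (snd s))"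
      by (simp add: sum.cartesian_product split_beta')
    also have "\<dots> \<le> (\<Sum>s\<in>?G j. sqrt (?m * (2 * measure \<mu> (joint k (fst s) j (snd s)))))"
      by (intro sum_mono fluct_sum_expectation[OF k])
    also have "\<dots> \<le> sqrt (card (?G j) * (\<Sum>s\<in>?G j. ?m * (2 * measure \<mu> (joint k (fst s) j (snd s)))))"
      by (intro sum_sqrt_le) auto
    also have "(\<Sum>s\<in>?G j. ?m * (2 * measure \<mu> (joint k (fst s) j (snd s)))) = ?m * 2 * (\<Sum>s\<in>?G j. measure \<mu> (joint k (fst s) j (snd s)))"
      by (simp add: sum_distrib_left mult.assoc)
    also have "sqrt (card (?G j) * (?m * 2 * (\<Sum>s\<in>?G j. measure \<mu> (joint k (fst s) j (snd s))))) \<le>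
      sqrt (((2 * 2 ^ J) ^ ?dp * (2 * 2 ^ j) ^ d k) * (?m * 2 * 1))"
    proof (intro real_sqrt_le_mono mult_mono sum_joint_le_1[OF k])
      have "card (?G j) \<le> (2 * 2 ^ J) ^ ?dp * (2 * 2 ^ j) ^ d k"
        unfolding card_cartesian_product by (intro mult_le_mono card_blocks_grid[OF finite_pa] card_cube_grid)
      then have "real (card (?G j)) \<le> real ((2 * 2 ^ J) ^ ?dp * (2 * 2 ^ j) ^ d k)" by (simp only: of_nat_le_iff)
      then show "real (card (?G j)) \<le> (2 * 2 ^ J) ^ ?dp * (2 * 2 ^ j) ^ d k" by simp
    qed (auto intro!: sum_nonneg mult_nonneg_nonneg)
    also have "\<dots> = sqrt (?m * ?m * (2 * ((2 * 2 ^ J) ^ ?dp * (2 * 2 ^ j) ^ d k) / ?m))"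
      using m by (simp add: field_simps)
    also have "\<dots> = ?m * sqrt (2 * ((2 * 2 ^ J) ^ ?dp * (2 * 2 ^ j) ^ d k) / ?m)"
      unfolding real_sqrt_mult[of "?m * ?m"] by simp
    finally show ?thesis .
  qed
  have "(\<integral>X. level_error d E \<kappa> L J I X k \<partial>sample) = (3 + L) * (1/2) ^ J +
    (\<Sum>c\<in>blocks_grid d (pa E k) J. \<Sum>j\<le>J. 2 * (1/2) ^ j * (\<Sum>z\<in>cube_grid (d k) j. ?e c j z)) / ?m"
    unfolding level_error_def total_fluct_def
    using fluct_sum_integrable[OF k]
    by (simp add: Bochner_Integration.integral_sum Bochner_Integration.integrable_sum P.prob_space)
  also have "(\<Sum>c\<in>blocks_grid d (pa E k) J. \<Sum>j\<le>J. 2 * (1/2) ^ j * (\<Sum>z\<in>cube_grid (d k) j. ?e c j z)) =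
    (\<Sum>j\<le>J. 2 * (1/2) ^ j * (\<Sum>c\<in>blocks_grid d (pa E k) J. \<Sum>z\<in>cube_grid (d k) j. ?e c j z))"
    by (subst sum.swap) (simp add: sum_distrib_left)
  also have "\<dots> / ?m = (\<Sum>j\<le>J. 2 * (1/2) ^ j * ((\<Sum>c\<in>blocks_grid d (pa E k) J. \<Sum>z\<in>cube_grid (d k) j. ?e c j z) / ?m))"
    by (subst sum_divide_distrib) (simp only: times_divide_eq_right)
  also have "\<dots> \<le> (\<Sum>j\<le>J. 2 * (sqrt (6 * 2 ^ ?DS) * (1/2) ^ J))"
  proof (rule sum_mono)
    fix j assume j: "j \<in> {..J}"
    have "(\<Sum>c\<in>blocks_grid d (pa E k) J. \<Sum>z\<in>cube_grid (d k) j. ?e c j z) / ?m \<le> sqrt (2 * ((2 * 2 ^ J) ^ ?dp * (2 * 2 ^ j) ^ d k) / ?m)"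
      using inner[of j] m by (simp add: pos_divide_le_eq mult.commute)
    then have "2 * (1/2) ^ j * ((\<Sum>c\<in>blocks_grid d (pa E k) J. \<Sum>z\<in>cube_grid (d k) j. ?e c j z) / ?m) \<le>
      2 * ((1/2) ^ j * sqrt (2 * ((2 * 2 ^ J) ^ ?dp * (2 * 2 ^ j) ^ d k) / ?m))"
      unfolding mult.assoc by (intro mult_left_mono) auto
    also have "\<dots> \<le> 2 * (sqrt (6 * 2 ^ ?DS) * (1/2) ^ J)"
      using j n m D DS by (intro mult_left_mono level_term_bound[where n=n and D=D]) auto
    finally show "2 * (1/2) ^ j * ((\<Sum>c\<in>blocks_grid d (pa E k) J. \<Sum>z\<in>cube_grid (d k) j. ?e c j z) / ?m) \<le>
      2 * (sqrt (6 * 2 ^ ?DS) * (1/2) ^ J)" .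
  qed
  also have "(\<Sum>j\<le>J. 2 * (sqrt (6 * 2 ^ ?DS) * (1/2) ^ J)) = 2 * sqrt (6 * 2 ^ ?DS) * ((real J + 1) * (1/2) ^ J)"
    by simp
  finally have "(\<integral>X. level_error d E \<kappa> L J I X k \<partial>sample) \<le> (3 + L) * (1/2) ^ J + 2 * sqrt (6 * 2 ^ ?DS) * ((real J + 1) * (1/2) ^ J)"
    by simp
  moreover have "(3 + L) * (1/2) ^ J \<le> (3 + L) * ((real J + 1) * (1/2) ^ J)"
    using L by (intro mult_left_mono) auto
  ultimately show ?thesis by (simp add: distrib_right)
qed

lemma product_error_integrable: "m \<le> K \<Longrightarrow> integrable sample (\<lambda>X. product_error d E \<kappa> L J I X m)"
  by (induction m) (auto intro!: level_error_integrable)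

lemma product_error_expectation:
  assumes "m \<le> K" and L: "L \<ge> 0" and n: "2 ^ (J * D) \<le> n" "n \<le> 3 * card I"
    and D: "\<And>k. k \<in> {1..K} \<Longrightarrow> (\<Sum>l\<in>pa E k. d l) + max 2 (d k) \<le> D"
  shows "(\<integral>X. product_error d E \<kappa> L J I X m \<partial>sample) \<le> (\<Sum>i<m. (1 + L) ^ i) *
    ((3 + L + 2 * sqrt (6 * 2 ^ (\<Sum>l\<in>{1..K}. d l))) * ((real J + 1) * (1/2) ^ J))"
  using assms(1)
proof (induction m)
  case (Suc m)
  define b where "b = (3 + L + 2 * sqrt (6 * 2 ^ (\<Sum>l\<in>{1..K}. d l))) * ((real J + 1) * (1/2) ^ J)"
  have k: "Suc m \<in> {1..K}" using Suc.prems by simp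
  have "(\<integral>X. product_error d E \<kappa> L J I X (Suc m) \<partial>sample) =
    (1 + L) * (\<integral>X. product_error d E \<kappa> L J I X m \<partial>sample) + (\<integral>X. level_error d E \<kappa> L J I X (Suc m) \<partial>sample)"
    using product_error_integrable[of m L] level_error_integrable[OF k, of L] Suc.prems by simp
  also have "\<dots> \<le> (1 + L) * ((\<Sum>i<m. (1 + L) ^ i) * b) + b"
    unfolding b_def using Suc.IH Suc.prems L level_error_expectation[OF k L n D[OF k]] by (intro add_mono mult_left_mono) auto
  also have "\<dots> = (1 + (1 + L) * (\<Sum>i<m. (1 + L) ^ i)) * b" by (simp add: distrib_right)
  also have "1 + (1 + L) * (\<Sum>i<m. (1 + L) ^ i) = (\<Sum>i<Suc m. (1 + L) ^ i)"
    by (subst sum.lessThan_Suc_shift) (simp add: sum_distrib_left)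
  finally show ?case unfolding b_def .
qed simp

end

text \<open>The upper bound on \<open>n\<close> gives (1/2)^J \<le> 2 n^(-1/D), the lower one J D ln
  2 \<le> ln n. Since D ln 2 \<ge> 1 for D \<ge> 2, \<open>J\<close> is at most ln n, and each of
  the two factors contributes a 2.\<close>

lemma dyadic_rate:
  assumes "D \<ge> 2" "n \<ge> 1" "2 ^ (J * D) \<le> n" "n < 2 ^ (Suc J * D)"
  shows "(real J + 1) * (1/2) ^ J \<le> 4 * max 1 (ln (real n)) * real n powr (- 1 / real D)"
proof -
  have "real n powr (1 / real D) \<le> (2 ^ (Suc J * D)) powr (1 / real D)"
  proof (rule powr_mono2)
    have "real n \<le> real (2 ^ (Suc J * D))" using assms(4) by (simp only: of_nat_le_iff)
    then show "real n \<le> 2 ^ (Suc J * D)" by simp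
  qed auto
  also have "\<dots> = 2 ^ Suc J"
  proof -
    have "(2::real) ^ (Suc J * D) = 2 powr (real (Suc J) * real D)"
      by (subst powr_realpow[symmetric]) (auto simp: of_nat_mult algebra_simps)
    moreover have "(2::real) ^ Suc J = 2 powr (real (Suc J))" by (rule powr_realpow[symmetric]) simp
    ultimately show ?thesis using assms(1) by (simp only: powr_powr) (simp add: algebra_simps)
  qed
  finally have "real n powr (1 / real D) \<le> 2 * 2 ^ J" by simp
  moreover have "real n powr (1 / real D) > 0" using assms(2) by simp
  ultimately have "1 / 2 ^ J \<le> 2 / real n powr (1 / real D)" by (simp add: field_simps)
  then have 1: "(1/2) ^ J \<le> 2 * real n powr (- 1 / real D)"
    by (simp add: power_one_over powr_minus_divide)
  have "real J * 1 \<le> real J * (real D * ln 2)"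
    using assms(1) ln2_ge_two_thirds mult_mono[of 2 "real D" "1/2" "ln 2"] by (intro mult_left_mono) auto
  also have "\<dots> = ln (2 ^ (J * D))" by (simp add: ln_realpow)
  also have "\<dots> \<le> ln (real n)"
  proof (subst ln_le_cancel_iff)
    have "real (2 ^ (J * D)) \<le> real n" using assms(3) by (simp only: of_nat_le_iff)
    then show "2 ^ (J * D) \<le> real n" by simp
  qed (use assms(2) in auto)
  finally have 2: "real J + 1 \<le> 2 * max 1 (ln (real n))" by simp
  have "(real J + 1) * (1/2) ^ J \<le> (2 * max 1 (ln (real n))) * (2 * real n powr (- 1 / real D))"
    using 1 2 by (intro mult_mono) auto
  then show ?thesis by simp
qed

section \<open>Selection of the graph\<close>

text \<open>Used twice: changing the sample outside the fitting half does not change a candidate,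
  and rounding in two stages gives the same candidate as rounding once.\<close>

lemma empirical_product_cong:
  assumes "finite I" "I \<noteq> {}" "\<And>i. i \<in> I \<Longrightarrow> Y i = Y' i"
  shows "empirical_product E Y I m = empirical_product E Y' I m"
proof (induction m)
  case (Suc m)
  have D: "donors Y I J x = donors Y' I J x" for J x
    using assms(3) by (auto simp: donors_def matching_def)
  have "map_pmf (\<lambda>i. x(Suc m := Y i (Suc m))) (pmf_of_set (donors Y I (pa E (Suc m)) x)) =
    map_pmf (\<lambda>i. x(Suc m := Y' i (Suc m))) (pmf_of_set (donors Y' I (pa E (Suc m)) x))" for x
    unfolding D
  proof (rule map_pmf_cong[OF refl])
    have ne: "donors Y' I (pa E (Suc m)) x \<noteq> {}" "finite (donors Y' I (pa E (Suc m)) x)"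
      "donors Y' I (pa E (Suc m)) x \<subseteq> I"
      using assms(1,2) by (auto simp: donors_def matching_def)
    fix i assume "i \<in> set_pmf (pmf_of_set (donors Y' I (pa E (Suc m)) x))"
    then have "i \<in> I" using ne by auto
    then show "x(Suc m := Y i (Suc m)) = x(Suc m := Y' i (Suc m))" using assms(3) by simp
  qed
  then show ?case using Suc by simp
qed simp

text \<open>The bound \<open>J \<le> n\<close> guarantees that the sample rounded at level
  \<open>n\<close> still determines its rounding at level \<open>J\<close>.\<close>

lemma ex_dyadic_level:
  assumes "D \<ge> 1" "n \<ge> 1"
  shows "\<exists>J\<le>n. 2 ^ (J * D) \<le> n \<and> n < 2 ^ (Suc J * D)"
proof -
  define P where "P J \<longleftrightarrow> n < 2 ^ (Suc J * D)" for J
  have "n < 2 ^ n" by (rule less_exp)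
  also have "\<dots> \<le> (2::nat) ^ (Suc n * D)"
  proof (rule power_increasing)
    show "n \<le> Suc n * D" using mult_le_mono[of n "Suc n" 1 D] assms(1) by simp
  qed simp
  finally have Pn: "P n" by (simp add: P_def)
  define J where "J = (LEAST J. P J)"
  have "P J" unfolding J_def using Pn by (rule LeastI)
  moreover have "J \<le> n" unfolding J_def using Pn by (rule Least_le)
  moreover have "2 ^ (J * D) \<le> n"
  proof (cases J)
    case 0 then show ?thesis using assms(2) by simp
  next
    case (Suc i)
    then have "\<not> P i" unfolding J_def by (intro not_less_Least) simp
    then show ?thesis using Suc by (simp add: P_def)
  qed
  ultimately show ?thesis by (auto simp: P_def)
qed

section \<open>Candidates, test functions and the selected estimator\<close>

locale graph_estimator =
  fixes d :: "nat \<Rightarrow> nat" and K :: nat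
  assumes K: "K \<ge> 1"
begin

abbreviation "B \<equiv> blocks d {1..K}"
abbreviation "\<rho> \<equiv> blocks_dist d {1..K}"

sublocale b: quantized B \<rho> "blocks_q d {1..K}" "blocks_grid d {1..K}"
  by (rule quantized_blocks) simp

definition graphs :: "nat rel set" where
  "graphs = {E. sorted_dag K E \<and> (\<forall>k\<in>{1..K}. fully_connected E (pa E k))}"

lemma finite_graphs: "finite graphs"
  by (rule finite_subset[of _ "Pow ({1..K} \<times> {1..K})"]) (auto simp: graphs_def sorted_dag_def)

definition "x0 = (SOME x. x \<in> space B)"

lemma x0: "x0 \<in> space B"
proof -
  have "(\<lambda>k\<in>{1..K}. \<lambda>j\<in>{..<d k}. 0) \<in> space B" by (auto simp: space_blocks space_cube PiE_iff)
  then have "\<exists>x. x \<in> space B" by blast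
  from someI_ex[OF this] show ?thesis unfolding x0_def .
qed

text \<open>A pmf lives on the discrete sigma-algebra, so this relabelling is measurable; sending
  stray points to \<open>x0\<close> makes the result a probability measure on \<open>B\<close> for
  every \<open>p\<close>.\<close>

definition to_measure :: "point pmf \<Rightarrow> point measure" where
  "to_measure p = distr (measure_pmf p) B (\<lambda>x. if x \<in> space B then x else x0)"

lemma to_measure: "prob_space (to_measure p)" "sets (to_measure p) = sets B"
  unfolding to_measure_def using x0 by (auto intro!: measure_pmf.prob_space_distr)

lemma integral_to_measure:
  assumes "f \<in> borel_measurable B" "set_pmf p \<subseteq> space B"
  shows "(\<integral>x. f x \<partial>to_measure p) = measure_pmf.expectation p (f :: _ \<Rightarrow> real)"
proof -
  have "(\<integral>x. f x \<partial>to_measure p) = measure_pmf.expectation p (\<lambda>x. f (if x \<in> space B then x else x0))"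
    unfolding to_measure_def using x0 assms(1) by (intro integral_distr) auto
  also have "\<dots> = measure_pmf.expectation p f"
    using assms(2) by (intro integral_cong_AE) (auto simp: AE_measure_pmf_iff)
  finally show ?thesis .
qed

definition level :: "nat \<Rightarrow> nat rel \<Rightarrow> nat" where
  "level n E = (SOME J. J \<le> n \<and> 2 ^ (J * d_loc d K E) \<le> n \<and> n < 2 ^ (Suc J * d_loc d K E))"

lemma d_loc_ge: "k \<in> {1..K} \<Longrightarrow> max 2 (d k) + (\<Sum>l\<in>pa E k. d l) \<le> d_loc d K E"
  unfolding d_loc_def by (intro Max_ge) auto

lemma d_loc_ge_2: "d_loc d K E \<ge> 2"
  using d_loc_ge[of 1 E] K by auto

lemma level:
  assumes "n \<ge> 1"
  shows "level n E \<le> n" "2 ^ (level n E * d_loc d K E) \<le> n" "n < 2 ^ (Suc (level n E) * d_loc d K E)"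
proof -
  have "\<exists>J\<le>n. 2 ^ (J * d_loc d K E) \<le> n \<and> n < 2 ^ (Suc J * d_loc d K E)"
    using d_loc_ge_2[of E] assms by (intro ex_dyadic_level) auto
  from someI_ex[OF this] show "level n E \<le> n" "2 ^ (level n E * d_loc d K E) \<le> n" "n < 2 ^ (Suc (level n E) * d_loc d K E)"
    unfolding level_def by auto
qed

definition fit_half :: "nat \<Rightarrow> nat set" where "fit_half n = {1..n div 2}"
definition test_half :: "nat \<Rightarrow> nat set" where "test_half n = {Suc (n div 2)..n}"

text \<open>All of the following depend on the sample only through its quantisation \<open>w\<close> at level \<open>n\<close>.\<close>

definition quant :: "nat \<Rightarrow> (nat \<Rightarrow> point) \<Rightarrow> nat \<Rightarrow> point" where
  "quant n X = (\<lambda>i\<in>{1..n}. blocks_q d {1..K} n (X i))"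

definition candidate :: "nat \<Rightarrow> (nat \<Rightarrow> point) \<Rightarrow> nat rel \<Rightarrow> point measure" where
  "candidate n w E = to_measure (empirical_product E (\<lambda>i. blocks_q d {1..K} (level n E) (w i)) (fit_half n) K)"

text \<open>Near-maximiser of the dual problem for the pair; the slack 1 / n makes existence
  immediate and is below the rate.\<close>

definition near_optimal :: "nat \<Rightarrow> point measure \<Rightarrow> point measure \<Rightarrow>
    (point \<Rightarrow> real) \<Rightarrow> bool" where
  "near_optimal n \<alpha> \<beta> f \<longleftrightarrow> lip_fun B \<rho> 1 f \<and> (\<forall>g. lip_fun B \<rho> 1 g \<longrightarrow>
     \<bar>(\<integral>x. g x \<partial>\<alpha>) - (\<integral>x. g x \<partial>\<beta>)\<bar> \<le> \<bar>(\<integral>x. f x \<partial>\<alpha>) - (\<integral>x. f x \<partial>\<beta>)\<bar> + 1 / real n)"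

text \<open>The choice is made from the rounded sample \<open>w\<close>, which takes finitely many
  values, so an arbitrary choice is harmless for measurability.\<close>

definition test_fun :: "nat \<Rightarrow> (nat \<Rightarrow> point) \<Rightarrow> nat rel \<times> nat rel \<Rightarrow> point \<Rightarrow> real" where
  "test_fun n w s = (SOME f. near_optimal n (candidate n w (fst s)) (candidate n w (snd s)) f)"

definition test_average :: "nat \<Rightarrow> (nat \<Rightarrow> point) \<Rightarrow> nat rel \<times> nat rel \<Rightarrow> real" where
  "test_average n w s = (\<Sum>i\<in>test_half n. test_fun n w s (w i)) / card (test_half n)"

text \<open>Minimum distance selection in the style of Yatracos and of Devroye and Lugosi, with the
  near-optimal functions of all pairs as the test class.\<close>

definition score :: "nat \<Rightarrow> (nat \<Rightarrow> point) \<Rightarrow> nat rel \<Rightarrow> real" where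
  "score n w E = Max ((\<lambda>s. \<bar>(\<integral>x. test_fun n w s x \<partial>candidate n w E) - test_average n w s\<bar>) ` (graphs \<times> graphs))"

definition select :: "nat \<Rightarrow> (nat \<Rightarrow> point) \<Rightarrow> nat rel" where
  "select n w = arg_min_on (score n w) graphs"

text \<open>For \<open>n = 1\<close> the fitting half is empty, hence the constant answer.\<close>

definition estimator :: "nat \<Rightarrow> (nat \<Rightarrow> point) \<Rightarrow> point measure" where
  "estimator n X = (if n < 2 then return B x0 else candidate n (quant n X) (select n (quant n X)))"

lemma candidate: "prob_space (candidate n w E)" "sets (candidate n w E) = sets B"
  unfolding candidate_def by (rule to_measure)+

lemma lip_fun_diff_le_1:
  assumes "prob_space \<alpha>" "sets \<alpha> = sets B" "prob_space \<beta>" "sets \<beta> = sets B" "lip_fun B \<rho> 1 f"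
  shows "\<bar>(\<integral>x. f x \<partial>\<alpha>) - (\<integral>x. f x \<partial>\<beta>)\<bar> \<le> 2"
proof -
  have pt: "\<bar>f x - f x0\<bar> \<le> 1" if "x \<in> space B" for x
    using assms(5) that x0 b.dist_le_1[OF that x0] unfolding lip_fun_def by fastforce
  have one: "\<bar>(\<integral>x. f x \<partial>\<tau>) - f x0\<bar> \<le> 1" if \<tau>: "prob_space \<tau>" "sets \<tau> = sets B" for \<tau>
  proof -
    interpret prob_space \<tau> by (rule \<tau>(1))
    have int: "integrable \<tau> f" by (rule b.lip_fun_integrable[OF assms(5) _ \<tau>]) simp
    have "\<bar>(\<integral>x. f x \<partial>\<tau>) - f x0\<bar> = \<bar>\<integral>x. f x - f x0 \<partial>\<tau>\<bar>" using int by (simp add: prob_space)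
    also have "\<dots> \<le> (\<integral>x. \<bar>f x - f x0\<bar> \<partial>\<tau>)" using integral_norm_bound[of \<tau> "\<lambda>x. f x - f x0"] by simp
    also have "\<dots> \<le> (\<integral>x. 1 \<partial>\<tau>)"
      using pt sets_eq_imp_space_eq[OF \<tau>(2)] int by (intro integral_mono) auto
    finally show ?thesis by (simp add: prob_space)
  qed
  show ?thesis using one[OF assms(1,2)] one[OF assms(3,4)] by linarith
qed

lemma test_fun:
  assumes "n \<ge> 1"
  shows "near_optimal n (candidate n w (fst s)) (candidate n w (snd s)) (test_fun n w s)"
proof -
  let ?\<alpha> = "candidate n w (fst s)" and ?\<beta> = "candidate n w (snd s)"
  define V where "V = {\<bar>(\<integral>x. g x \<partial>?\<alpha>) - (\<integral>x. g x \<partial>?\<beta>)\<bar> |g. lip_fun B \<rho> 1 g}"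
  have bdd: "bdd_above V"
    unfolding V_def by (rule bdd_aboveI[of _ 2]) (auto intro: lip_fun_diff_le_1[OF candidate candidate])
  have "lip_fun B \<rho> 1 (\<lambda>_. 0)" by (auto simp: lip_fun_def b.dist_nonneg)
  then have "V \<noteq> {}" unfolding V_def by blast
  moreover have "Sup V - 1 / real n < Sup V" using assms by simp
  ultimately obtain v where v: "v \<in> V" "Sup V - 1 / real n < v"
    using less_cSup_iff[OF _ bdd] by blast
  then obtain f where f: "lip_fun B \<rho> 1 f" "v = \<bar>(\<integral>x. f x \<partial>?\<alpha>) - (\<integral>x. f x \<partial>?\<beta>)\<bar>" unfolding V_def by blast
  have "near_optimal n ?\<alpha> ?\<beta> f"
    unfolding near_optimal_def
  proof (intro conjI allI impI f(1))
    fix g assume "lip_fun B \<rho> 1 g"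
    then have "\<bar>(\<integral>x. g x \<partial>?\<alpha>) - (\<integral>x. g x \<partial>?\<beta>)\<bar> \<le> Sup V"
      by (intro cSup_upper[OF _ bdd]) (auto simp: V_def)
    then show "\<bar>(\<integral>x. g x \<partial>?\<alpha>) - (\<integral>x. g x \<partial>?\<beta>)\<bar> \<le> \<bar>(\<integral>x. f x \<partial>?\<alpha>) - (\<integral>x. f x \<partial>?\<beta>)\<bar> + 1 / real n"
      using v(2) f(2) by linarith
  qed
  then have "\<exists>f. near_optimal n ?\<alpha> ?\<beta> f" by blast
  from someI_ex[OF this] show ?thesis unfolding test_fun_def .
qed

lemma test_fun_lip: "n \<ge> 1 \<Longrightarrow> lip_fun B \<rho> 1 (test_fun n w s)"
  using test_fun by (simp add: near_optimal_def)

text \<open>The candidates for \<open>E\<close> and for the selected graph are compared through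
  their own test function. Each of the two integrals is within the respective score of the same test
  average, the selected score is the smaller one, and the score of \<open>E\<close> is at most
  \<epsilon> plus the deviations. This gives twice that sum between the candidates, and another
  \<epsilon> leads from the candidate for \<open>E\<close> to \<mu>.\<close>

lemma selection_inequality:
  assumes n: "n \<ge> 1" and E: "E \<in> graphs" and \<mu>: "prob_space \<mu>" "sets \<mu> = sets B"
    and \<epsilon>: "\<And>f. lip_fun B \<rho> 1 f \<Longrightarrow> \<bar>(\<integral>x. f x \<partial>candidate n w E) - (\<integral>x. f x \<partial>\<mu>)\<bar> \<le> \<epsilon>"
    and f: "lip_fun B \<rho> 1 f"
  shows "\<bar>(\<integral>x. f x \<partial>\<mu>) - (\<integral>x. f x \<partial>candidate n w (select n w))\<bar> \<le>
    3 * \<epsilon> + 2 * (\<Sum>s\<in>graphs \<times> graphs. \<bar>test_average n w s - (\<integral>x. test_fun n w s x \<partial>\<mu>)\<bar>) + 1 / real n"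
proof -
  let ?F = "select n w" and ?R = "\<Sum>s\<in>graphs \<times> graphs. \<bar>test_average n w s - (\<integral>x. test_fun n w s x \<partial>\<mu>)\<bar>"
  let ?c = "\<lambda>E f. \<integral>x. f x \<partial>candidate n w E"
  have fin: "finite (graphs \<times> graphs)" using finite_graphs by simp
  have ne: "graphs \<noteq> {}" using E by auto
  have F: "?F \<in> graphs" "score n w ?F \<le> score n w E"
    using arg_min_if_finite[OF finite_graphs ne, of "score n w"] E unfolding select_def by (auto simp: not_less[symmetric])
  define t where "t = test_fun n w (E, ?F)"
  have t: "near_optimal n (candidate n w E) (candidate n w ?F) t" unfolding t_def using test_fun[OF n, of w "(E, ?F)"] by simp
  have score_ge: "\<bar>?c G t - test_average n w (E, ?F)\<bar> \<le> score n w G" for G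
    unfolding score_def t_def using fin E F by (intro Max_ge) auto
  have "score n w E \<in> (\<lambda>s. \<bar>?c E (test_fun n w s) - test_average n w s\<bar>) ` (graphs \<times> graphs)"
    unfolding score_def using fin ne by (intro Max_in) auto
  then obtain s where s: "s \<in> graphs \<times> graphs" "score n w E = \<bar>?c E (test_fun n w s) - test_average n w s\<bar>" by auto
  have "\<bar>test_average n w s - (\<integral>x. test_fun n w s x \<partial>\<mu>)\<bar> \<le> ?R"
    using s(1) fin by (intro member_le_sum) auto
  then have "score n w E \<le> \<epsilon> + ?R" using \<epsilon>[OF test_fun_lip[OF n, of w s]] s(2) by linarith
  moreover have "\<bar>?c E f - ?c ?F f\<bar> \<le> \<bar>?c E t - ?c ?F t\<bar> + 1 / real n"
    using t f by (auto simp: near_optimal_def)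
  ultimately show ?thesis using score_ge[of E] score_ge[of ?F] F(2) \<epsilon>[OF f] by linarith
qed

section \<open>Measurability of the estimator and deviations of the test averages\<close>

lemma quant_measurable:
  assumes "sets \<mu> = sets B"
  shows "quant n \<in> (\<Pi>\<^sub>M i\<in>{1..n}. \<mu>) \<rightarrow>\<^sub>M count_space (\<Pi>\<^sub>E i\<in>{1..n}. blocks_grid d {1..K} n)"
proof (subst measurable_count_space_eq2)
  show "finite (\<Pi>\<^sub>E i\<in>{1..n}. blocks_grid d {1..K} n)" by (intro finite_PiE b.finite_G) simp
  have sp: "space \<mu> = space B" by (rule sets_eq_imp_space_eq[OF assms])
  show "quant n \<in> space (\<Pi>\<^sub>M i\<in>{1..n}. \<mu>) \<rightarrow> (\<Pi>\<^sub>E i\<in>{1..n}. blocks_grid d {1..K} n) \<and>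
    (\<forall>a\<in>\<Pi>\<^sub>E i\<in>{1..n}. blocks_grid d {1..K} n. quant n -` {a} \<inter> space (\<Pi>\<^sub>M i\<in>{1..n}. \<mu>) \<in> sets (\<Pi>\<^sub>M i\<in>{1..n}. \<mu>))"
  proof (intro conjI ballI)
    show "quant n \<in> space (\<Pi>\<^sub>M i\<in>{1..n}. \<mu>) \<rightarrow> (\<Pi>\<^sub>E i\<in>{1..n}. blocks_grid d {1..K} n)"
      using b.q_in sp by (auto simp: quant_def space_PiM PiE_iff)
    fix a assume a: "a \<in> (\<Pi>\<^sub>E i\<in>{1..n}. blocks_grid d {1..K} n)"
    have "quant n -` {a} \<inter> space (\<Pi>\<^sub>M i\<in>{1..n}. \<mu>) = (\<Pi>\<^sub>E i\<in>{1..n}. b.cell n (a i))"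
      using a sp by (auto simp: quant_def space_PiM PiE_iff b.cell_def fun_eq_iff restrict_def extensional_def)
    also have "\<dots> \<in> sets (\<Pi>\<^sub>M i\<in>{1..n}. \<mu>)" using assms by (intro sets_PiM_I_finite) auto
    finally show "quant n -` {a} \<inter> space (\<Pi>\<^sub>M i\<in>{1..n}. \<mu>) \<in> sets (\<Pi>\<^sub>M i\<in>{1..n}. \<mu>)" .
  qed
qed

lemma estimator_measurable: "estimator n \<in> (\<Pi>\<^sub>M i\<in>{1..n}. B) \<rightarrow>\<^sub>M prob_algebra B"
proof (cases "n < 2")
  case True
  have "return B x0 \<in> space (prob_algebra B)" using x0 by (rule measurable_space[OF measurable_return_prob_space])
  then show ?thesis unfolding estimator_def[abs_def] using True by simp
next
  case False
  have "(\<lambda>w. candidate n w (select n w)) \<in> count_space (\<Pi>\<^sub>E i\<in>{1..n}. blocks_grid d {1..K} n) \<rightarrow>\<^sub>M prob_algebra B"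
    using candidate by (simp add: space_prob_algebra)
  from measurable_compose[OF quant_measurable[OF refl] this] show ?thesis
    unfolding estimator_def[abs_def] using False by simp
qed

text \<open>Centred by the integral of the rounded test function, because the averages use rounded
  points; the mean over a fresh point is then exactly 0.\<close>

definition test_term :: "point measure \<Rightarrow> nat \<Rightarrow> nat rel \<times> nat rel \<Rightarrow> nat \<Rightarrow> (nat \<Rightarrow> point) \<Rightarrow> real" where
  "test_term \<mu> n s i X = test_fun n (quant n X) s (quant n X i) -
     (\<integral>x. test_fun n (quant n X) s (blocks_q d {1..K} n x) \<partial>\<mu>)"

lemma test_term_measurable:
  assumes "sets \<mu> = sets B"
  shows "test_term \<mu> n s i \<in> borel_measurable (\<Pi>\<^sub>M i\<in>{1..n}. \<mu>)"
proof -
  have "(\<lambda>w. test_fun n w s (w i) - (\<integral>x. test_fun n w s (blocks_q d {1..K} n x) \<partial>\<mu>)) \<in>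
    borel_measurable (count_space (\<Pi>\<^sub>E i\<in>{1..n}. blocks_grid d {1..K} n))" by simp
  from measurable_compose[OF quant_measurable[OF assms] this] show ?thesis
    unfolding test_term_def[abs_def] .
qed

lemma test_term_bound:
  assumes n: "n \<ge> 1" and \<mu>: "prob_space \<mu>" "sets \<mu> = sets B" and i: "i \<in> {1..n}"
    and X: "X \<in> space (\<Pi>\<^sub>M i\<in>{1..n}. \<mu>)"
  shows "\<bar>test_term \<mu> n s i X\<bar> \<le> 1"
proof -
  interpret prob_space \<mu> by (rule \<mu>(1))
  let ?f = "test_fun n (quant n X) s"
  have sp: "space \<mu> = space B" by (rule sets_eq_imp_space_eq[OF \<mu>(2)])
  have xi: "quant n X i \<in> space B" using X i b.q_space sp by (auto simp: quant_def space_PiM PiE_iff)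
  note int = b.integral_comp_q(1)[OF \<mu>, of ?f n]
  have pt: "\<bar>?f (quant n X i) - ?f (blocks_q d {1..K} n x)\<bar> \<le> 1" if "x \<in> space \<mu>" for x
  proof -
    have x: "blocks_q d {1..K} n x \<in> space B" using that sp b.q_space by simp
    have "\<bar>?f (quant n X i) - ?f (blocks_q d {1..K} n x)\<bar> \<le> 1 * \<rho> (quant n X i) (blocks_q d {1..K} n x)"
      using test_fun_lip[OF n] xi x unfolding lip_fun_def by blast
    then show ?thesis using b.dist_le_1[OF xi x] by linarith
  qed
  have "\<bar>test_term \<mu> n s i X\<bar> = \<bar>\<integral>x. ?f (quant n X i) - ?f (blocks_q d {1..K} n x) \<partial>\<mu>\<bar>"
    using int by (simp add: test_term_def prob_space)
  also have "\<dots> \<le> (\<integral>x. \<bar>?f (quant n X i) - ?f (blocks_q d {1..K} n x)\<bar> \<partial>\<mu>)"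
    using integral_norm_bound[of \<mu> "\<lambda>x. ?f (quant n X i) - ?f (blocks_q d {1..K} n x)"] by simp
  also have "\<dots> \<le> (\<integral>x. 1 \<partial>\<mu>)" using pt int by (intro integral_mono) auto
  finally show ?thesis by (simp add: prob_space)
qed

lemma test_fun_update:
  assumes "j \<in> test_half n" "n \<ge> 2"
  shows "test_fun n (quant n (X(j := y))) s = test_fun n (quant n X) s"
proof -
  have "candidate n (quant n (X(j := y))) E = candidate n (quant n X) E" for E
    unfolding candidate_def using assms
    by (intro arg_cong[where f=to_measure] empirical_product_cong) (auto simp: fit_half_def test_half_def quant_def)
  then show ?thesis unfolding test_fun_def by simp
qed

text \<open>The test functions are fixed by the fitting half, so changing a point of the test half
  affects its own term only. This is the orthogonality needed, with variances at most 1.\<close>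

lemma test_sum_expectation:
  assumes n: "n \<ge> 2" and \<mu>: "prob_space \<mu>" "sets \<mu> = sets B"
  shows "(\<integral>X. \<bar>\<Sum>i\<in>test_half n. test_term \<mu> n s i X\<bar> \<partial>(\<Pi>\<^sub>M i\<in>{1..n}. \<mu>)) \<le> sqrt (card (test_half n))"
    and "integrable (\<Pi>\<^sub>M i\<in>{1..n}. \<mu>) (\<lambda>X. \<bar>\<Sum>i\<in>test_half n. test_term \<mu> n s i X\<bar>)"
proof -
  interpret prob_space \<mu> by (rule \<mu>(1))
  interpret P: prob_space "\<Pi>\<^sub>M i\<in>{1..n}. \<mu>" by (intro prob_space_PiM \<mu>)
  have n1: "n \<ge> 1" using n by simp
  have sub: "test_half n \<subseteq> {1..n}" by (auto simp: test_half_def)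
  have bound: "\<bar>test_term \<mu> n s i X\<bar> \<le> 1" if "i \<in> test_half n" "X \<in> space (\<Pi>\<^sub>M i\<in>{1..n}. \<mu>)" for i X
    using test_term_bound[OF n1 \<mu> _ that(2)] that(1) sub by blast
  have "(\<integral>X. \<bar>\<Sum>i\<in>test_half n. test_term \<mu> n s i X\<bar> \<partial>(\<Pi>\<^sub>M i\<in>{1..n}. \<mu>)) \<le> sqrt (real (card (test_half n)) * 1)"
  proof (rule PiM_orthogonal_sum[OF \<mu>(1) _ sub test_term_measurable[OF \<mu>(2)] bound])
    fix i j X y assume ij: "i \<in> test_half n" "j \<in> test_half n" "i \<noteq> j"
    have "quant n (X(j := y)) i = quant n X i" using ij by (simp add: quant_def)
    then show "test_term \<mu> n s i (X(j := y)) = test_term \<mu> n s i X"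
      unfolding test_term_def test_fun_update[OF ij(2) n] by simp
  next
    fix j X assume j: "j \<in> test_half n"
    have q: "quant n (X(j := y)) j = blocks_q d {1..K} n y" for y using j sub by (auto simp: quant_def)
    show "(\<integral>y. test_term \<mu> n s j (X(j := y)) \<partial>\<mu>) = 0"
      unfolding test_term_def test_fun_update[OF j n] q
      using b.integral_comp_q(1)[OF \<mu>, of "test_fun n (quant n X) s" n] by (simp add: prob_space)
  next
    fix i assume i: "i \<in> test_half n"
    have "(\<integral>X. (test_term \<mu> n s i X)\<^sup>2 \<partial>(\<Pi>\<^sub>M i\<in>{1..n}. \<mu>)) \<le> (\<integral>X. 1 \<partial>(\<Pi>\<^sub>M i\<in>{1..n}. \<mu>))"
    proof (rule integral_mono)
      have b2: "(test_term \<mu> n s i X)\<^sup>2 \<le> 1" if "X \<in> space (\<Pi>\<^sub>M i\<in>{1..n}. \<mu>)" for X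
        using bound[OF i that] by (simp add: abs_square_le_1)
      then show "(test_term \<mu> n s i X)\<^sup>2 \<le> 1" if "X \<in> space (\<Pi>\<^sub>M i\<in>{1..n}. \<mu>)" for X using that .
      show "integrable (\<Pi>\<^sub>M i\<in>{1..n}. \<mu>) (\<lambda>X. (test_term \<mu> n s i X)\<^sup>2)"
      proof (rule P.integrable_const_bound[where B=1])
        show "AE X in \<Pi>\<^sub>M i\<in>{1..n}. \<mu>. norm ((test_term \<mu> n s i X)\<^sup>2) \<le> 1" using b2 by (intro AE_I2) simp
      qed (rule borel_measurable_power[OF test_term_measurable[OF \<mu>(2)]])
    qed simp
    then show "(\<integral>X. (test_term \<mu> n s i X)\<^sup>2 \<partial>(\<Pi>\<^sub>M i\<in>{1..n}. \<mu>)) \<le> 1" by (simp add: P.prob_space)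
  qed simp
  then show "(\<integral>X. \<bar>\<Sum>i\<in>test_half n. test_term \<mu> n s i X\<bar> \<partial>(\<Pi>\<^sub>M i\<in>{1..n}. \<mu>)) \<le> sqrt (card (test_half n))" by simp
  show "integrable (\<Pi>\<^sub>M i\<in>{1..n}. \<mu>) (\<lambda>X. \<bar>\<Sum>i\<in>test_half n. test_term \<mu> n s i X\<bar>)"
  proof (rule P.integrable_const_bound[where B="real (card (test_half n))"])
    have "\<bar>\<Sum>i\<in>test_half n. test_term \<mu> n s i X\<bar> \<le> real (card (test_half n)) * 1" if "X \<in> space (\<Pi>\<^sub>M i\<in>{1..n}. \<mu>)" for X
      by (rule order_trans[OF sum_abs sum_bounded_above]) (rule bound[OF _ that])
    then show "AE X in \<Pi>\<^sub>M i\<in>{1..n}. \<mu>. norm \<bar>\<Sum>i\<in>test_half n. test_term \<mu> n s i X\<bar> \<le> real (card (test_half n))"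
      by (intro AE_I2) simp
  qed (intro borel_measurable_abs borel_measurable_sum test_term_measurable[OF \<mu>(2)])
qed

lemma test_average_deviation:
  assumes n: "n \<ge> 2" and \<mu>: "prob_space \<mu>" "sets \<mu> = sets B"
  shows "\<bar>test_average n (quant n X) s - (\<integral>x. test_fun n (quant n X) s x \<partial>\<mu>)\<bar> \<le>
    \<bar>\<Sum>i\<in>test_half n. test_term \<mu> n s i X\<bar> / card (test_half n) + (1/2) ^ n"
proof -
  let ?f = "test_fun n (quant n X) s" and ?m = "real (card (test_half n))"
  have m: "?m > 0" using n by (simp add: test_half_def)
  have "(\<Sum>i\<in>test_half n. test_term \<mu> n s i X) = (\<Sum>i\<in>test_half n. ?f (quant n X i)) - ?m * (\<integral>x. ?f (blocks_q d {1..K} n x) \<partial>\<mu>)"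
    by (simp add: test_term_def sum_subtractf)
  then have "(\<Sum>i\<in>test_half n. test_term \<mu> n s i X) / ?m = test_average n (quant n X) s - (\<integral>x. ?f (blocks_q d {1..K} n x) \<partial>\<mu>)"
    using m by (simp add: test_average_def diff_divide_distrib)
  moreover have "\<bar>(\<integral>x. ?f (blocks_q d {1..K} n x) \<partial>\<mu>) - (\<integral>x. ?f x \<partial>\<mu>)\<bar> \<le> 1 * (1/2) ^ n"
    using n by (intro b.lip_fun_integral_q test_fun_lip \<mu>) auto
  moreover have "\<bar>\<Sum>i\<in>test_half n. test_term \<mu> n s i X\<bar> / ?m = \<bar>(\<Sum>i\<in>test_half n. test_term \<mu> n s i X) / ?m\<bar>"
    by (simp add: abs_divide)
  ultimately show ?thesis by linarith
qed

end

section \<open>Bound on the expected error\<close>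

lemma product_error_nonneg:
  assumes "L \<ge> 0"
  shows "product_error d E \<kappa> L J I X m \<ge> 0"
proof -
  have "level_error d E \<kappa> L J I X k \<ge> 0" for k
    unfolding level_error_def using assms
    by (intro add_nonneg_nonneg divide_nonneg_nonneg sum_nonneg total_fluct_nonneg mult_nonneg_nonneg) auto
  then show ?thesis using assms by (induction m) (auto intro!: add_nonneg_nonneg mult_nonneg_nonneg)
qed

context graph_estimator
begin

lemma candidate_error:
  assumes n: "n \<ge> 2" and ker: "graph_kernels d K E \<kappa>" and fc: "\<And>k. k \<in> {1..K} \<Longrightarrow> fully_connected E (pa E k)"
    and \<mu>: "prob_space \<mu>" "sets \<mu> = sets B" and L: "L \<ge> 0"
    and lip: "kernels_lipschitz d K E L \<kappa>"
    and dis: "disintegrates d K E \<mu> \<kappa>"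
    and X: "X \<in> space (\<Pi>\<^sub>M i\<in>{1..n}. \<mu>)" and f: "lip_fun B \<rho> 1 f"
  shows "\<bar>(\<integral>x. f x \<partial>candidate n (quant n X) E) - (\<integral>x. f x \<partial>\<mu>)\<bar> \<le>
    product_error d E \<kappa> L (level n E) (fit_half n) X K"
proof -
  have sp: "space \<mu> = space B" by (rule sets_eq_imp_space_eq[OF \<mu>(2)])
  have sub: "fit_half n \<subseteq> {1..n}" and I: "finite (fit_half n)" "fit_half n \<noteq> {}"
    using n by (auto simp: fit_half_def)
  have Xi: "X i \<in> space B" if "i \<in> fit_half n" for i
    using X sub that sp by (auto simp: space_PiM PiE_iff)
  interpret graph_kernels d K E \<kappa> by (rule ker)
  interpret e: kernel_estimate d K E \<kappa> \<mu> L "level n E" "fit_half n" X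
    by (rule kernel_estimate.intro[OF ker], rule kernel_estimate_axioms.intro) (fact \<mu> L fc lip dis I Xi)+
  \<comment> \<open>Rounding at level \<open>n\<close> and then at the level of the graph is the
    same as rounding at the latter, since the levels are nested.\<close>
  have P: "empirical_product E (\<lambda>i. blocks_q d {1..K} (level n E) (quant n X i)) (fit_half n) K = e.emp.P K"
  proof (rule empirical_product_cong[OF I])
    fix i assume i: "i \<in> fit_half n"
    then show "blocks_q d {1..K} (level n E) (quant n X i) = e.Y i"
      using sub n level(1)[of n E] b.q_q[OF _ Xi[OF i], of "level n E" n] by (auto simp: quant_def e.Y_def)
  qed
  have "(\<integral>x. f x \<partial>candidate n (quant n X) E) = measure_pmf.expectation (e.emp.P K) f"
    unfolding candidate_def P using f e.support_space
    by (intro integral_to_measure) (auto simp: lip_fun_def)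
  moreover have "(\<integral>x. f (restrict x {1..K}) \<partial>\<mu>) = (\<integral>x. f x \<partial>\<mu>)"
    using sp by (intro Bochner_Integration.integral_cong refl) (auto simp: space_blocks PiE_restrict)
  ultimately show ?thesis using e.product_estimate[OF _ f] by simp
qed

text \<open>The 12 is the 3 of the selection inequality times the 4 of \<open>dyadic_rate\<close>.
  Each pair of graphs costs twice 3 rates, and 5 pays for the slack 1 / n and the duality error
  \<open>4 * (1/2) ^ n\<close>.\<close>

definition risk_const :: "real \<Rightarrow> real" where
  "risk_const L = 12 * ((\<Sum>i<K. (1 + \<bar>L\<bar>) ^ i) * (3 + \<bar>L\<bar> + 2 * sqrt (6 * 2 ^ (\<Sum>l\<in>{1..K}. d l)))) +
     6 * card (graphs \<times> graphs) + 5"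

lemma risk_const_ge: "risk_const L \<ge> 5"
  unfolding risk_const_def by (simp add: sum_nonneg)

text \<open>As D \<ge> 2, the rate is never faster than n^(-1/2), so the deviations of the test
  averages are absorbed by it.\<close>

lemma small_terms:
  assumes n: "n \<ge> 2" and D: "D \<ge> 2"
  defines "r \<equiv> real n powr (- 1 / real D)"
  shows "1 / real n \<le> r" "(1/2) ^ n \<le> r" "sqrt (card (test_half n)) / card (test_half n) \<le> 2 * r"
proof -
  have n0: "real n > 0" "real n \<ge> 1" using n by auto
  have "1 / real n = real n powr (- 1)" using n0 by (simp add: powr_minus_divide)
  also have "\<dots> \<le> r" unfolding r_def using n0 D by (intro powr_mono) auto
  finally show 1: "1 / real n \<le> r" .
  have "real n \<le> real (2 ^ n)" using less_exp[of n] by (simp only: of_nat_le_iff less_imp_le)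
  then have "(1/2) ^ n \<le> 1 / real n" using n0 by (simp add: power_one_over field_simps)
  then show "(1/2) ^ n \<le> r" using 1 by simp
  \<comment> \<open>At least half of \<open>n\<close> is available; a quarter has a convenient root,
    which yields the factor 2.\<close>
  have card: "real (card (test_half n)) \<ge> real n / 4" "card (test_half n) > 0" using n by (auto simp: test_half_def)
  have "sqrt (card (test_half n)) / card (test_half n) = 1 / sqrt (card (test_half n))"
    using card(2) by (simp add: real_div_sqrt divide_simps)
  also have "\<dots> \<le> 1 / sqrt (real n / 4)" using card n0 by (intro divide_left_mono real_sqrt_le_mono) auto
  also have "\<dots> = 2 * real n powr (- (1 / 2))" using n0
    by (simp add: real_sqrt_divide powr_minus_divide powr_half_sqrt)
  also have "\<dots> \<le> 2 * r" unfolding r_def using n0 D by (intro mult_left_mono powr_mono) (auto simp: field_simps)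
  finally show "sqrt (card (test_half n)) / card (test_half n) \<le> 2 * r" .
qed

lemma estimator_risk:
  assumes n: "n \<ge> 2" and E: "E \<in> graphs" and \<mu>G: "\<mu> \<in> graph_measures d K E" and lk: "lipschitz_kernels d K E L \<mu>"
  shows "(\<integral>\<^sup>+ X. wasserstein \<rho> \<mu> (estimator n X) \<partial>(\<Pi>\<^sub>M i\<in>{1..n}. \<mu>)) \<le>
    ennreal (risk_const L * max 1 (ln (real n)) * real n powr (- 1 / real (d_loc d K E)))"
proof -
  have dag: "sorted_dag K E" and fc: "\<And>k. k \<in> {1..K} \<Longrightarrow> fully_connected E (pa E k)"
    using E by (auto simp: graphs_def)
  have \<mu>: "prob_space \<mu>" "sets \<mu> = sets B" using \<mu>G by (auto simp: graph_measures_def space_prob_algebra)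
  obtain \<kappa> where ker: "graph_kernels d K E \<kappa>"
    and cond: "\<And>k. k \<in> {1..K} \<Longrightarrow> cond_distr d \<mu> k (pa E k) (\<kappa> k)"
    and lip: "kernels_lipschitz d K E \<bar>L\<bar> \<kappa>"
    and dis: "disintegrates d K E \<mu> \<kappa>"
    using graph_measure_kernels[OF dag \<mu>G lk] by blast
  interpret graph_kernels d K E \<kappa> by (rule ker)
  define D where "D = d_loc d K E"
  define J where "J = level n E"
  define r where "r = real n powr (- 1 / real D)"
  define M where "M = max 1 (ln (real n))"
  let ?P = "\<Pi>\<^sub>M i\<in>{1..n}. \<mu>" and ?A = "graphs \<times> graphs" and ?m = "real (card (test_half n))"
  let ?C = "(\<Sum>i<K. (1 + \<bar>L\<bar>) ^ i) * (3 + \<bar>L\<bar> + 2 * sqrt (6 * 2 ^ (\<Sum>l\<in>{1..K}. d l)))"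
  have n1: "n \<ge> 1" using n by simp
  have D2: "D \<ge> 2" unfolding D_def by (rule d_loc_ge_2)
  note lev = level[OF n1, of E, folded D_def J_def]
  \<comment> \<open>The factor 3 is attained at \<open>n = 3\<close>, where the fitting half has one
    element.\<close>
  have I: "fit_half n \<subseteq> {1..n}" "fit_half n \<noteq> {}" "n \<le> 3 * card (fit_half n)"
    using n by (auto simp: fit_half_def)
  interpret P: prob_space ?P by (intro prob_space_PiM \<mu>)
  interpret s: kernel_sample d K E \<kappa> \<mu> J "{1..n}" "fit_half n"
    by (rule kernel_sample.intro[OF ker], rule kernel_sample_axioms.intro) (fact \<mu> cond I finite_atLeastAtMost)+
  define pe where "pe X = product_error d E \<kappa> \<bar>L\<bar> J (fit_half n) X K" for X
  define te where "te s X = \<bar>\<Sum>i\<in>test_half n. test_term \<mu> n s i X\<bar>" for s X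
  \<comment> \<open>An integrable majorant of the loss. Monotonicity of the nonnegative integral
    then bounds the risk without any statement on measurability of the distance in the sample. The
    last term is the duality error at level \<open>n\<close>.\<close>
  define \<Phi> where "\<Phi> X = 3 * pe X + 2 * (\<Sum>s\<in>?A. te s X / ?m + (1/2) ^ n) + 1 / real n + 4 * (1/2) ^ n" for X
  have pe_int: "integrable ?P pe" unfolding pe_def by (rule s.product_error_integrable) simp
  have te_int: "integrable ?P (te s)" for s
    unfolding te_def by (rule test_sum_expectation(2)[OF n \<mu>])
  have \<Phi>_int: "integrable ?P \<Phi>"
    unfolding \<Phi>_def using pe_int te_int by auto
  have W: "wasserstein \<rho> \<mu> (estimator n X) \<le> ennreal (\<Phi> X)" if X: "X \<in> space ?P" for X
  proof -
    have "(\<integral>x. f x \<partial>\<mu>) - (\<integral>x. f x \<partial>estimator n X) \<le>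
      3 * pe X + 2 * (\<Sum>s\<in>?A. te s X / ?m + (1/2) ^ n) + 1 / real n" if f: "lip_fun B \<rho> 1 f" for f
    proof -
      let ?w = "quant n X"
      have "\<bar>(\<integral>x. f x \<partial>\<mu>) - (\<integral>x. f x \<partial>candidate n ?w (select n ?w))\<bar> \<le>
        3 * pe X + 2 * (\<Sum>s\<in>?A. \<bar>test_average n ?w s - (\<integral>x. test_fun n ?w s x \<partial>\<mu>)\<bar>) + 1 / real n"
        unfolding pe_def J_def
        by (intro selection_inequality[OF n1 E \<mu> _ f] candidate_error[OF n ker fc \<mu> _ lip dis X]) auto
      also have "\<dots> \<le> 3 * pe X + 2 * (\<Sum>s\<in>?A. te s X / ?m + (1/2) ^ n) + 1 / real n"
        unfolding te_def
        by (intro add_mono mult_left_mono sum_mono test_average_deviation[OF n \<mu>] order_refl) auto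
      finally show ?thesis using n by (simp add: estimator_def)
    qed
    moreover have "prob_space (estimator n X)" "sets (estimator n X) = sets B"
      using candidate n by (auto simp: estimator_def)
    ultimately show ?thesis unfolding \<Phi>_def by (intro b.wasserstein_le_dual[OF \<mu>]) auto
  qed
  have \<Phi>0: "\<Phi> X \<ge> 0" for X
    unfolding \<Phi>_def pe_def te_def
    by (intro add_nonneg_nonneg mult_nonneg_nonneg sum_nonneg product_error_nonneg divide_nonneg_nonneg) auto
  have r0: "r \<ge> 0" and M1: "M \<ge> 1" by (auto simp: r_def M_def)
  note small = small_terms[OF n D2, folded r_def]
  have "(\<integral>X. pe X \<partial>?P) \<le> (\<Sum>i<K. (1 + \<bar>L\<bar>) ^ i) *
    ((3 + \<bar>L\<bar> + 2 * sqrt (6 * 2 ^ (\<Sum>l\<in>{1..K}. d l))) * ((real J + 1) * (1/2) ^ J))"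
    unfolding pe_def
    by (rule s.product_error_expectation[OF _ _ lev(2) I(3)]) (use d_loc_ge[of _ E] in \<open>auto simp: D_def add.commute\<close>)
  also have "\<dots> = ?C * ((real J + 1) * (1/2) ^ J)" by (simp only: mult.assoc)
  also have "\<dots> \<le> ?C * (4 * M * r)"
    using dyadic_rate[OF D2 n1 lev(2,3)] unfolding M_def r_def
    by (intro mult_left_mono mult_nonneg_nonneg sum_nonneg) auto
  finally have pe: "(\<integral>X. pe X \<partial>?P) \<le> 4 * ?C * M * r" by (simp only: mult_ac)
  have te: "(\<integral>X. te s X \<partial>?P) / ?m + (1/2) ^ n \<le> 3 * r" for s
  proof -
    have "(\<integral>X. te s X \<partial>?P) / ?m \<le> sqrt ?m / ?m"
      unfolding te_def by (intro divide_right_mono test_sum_expectation(1)[OF n \<mu>]) auto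
    then show ?thesis using small by linarith
  qed
  have "(\<integral>X. \<Phi> X \<partial>?P) = 3 * (\<integral>X. pe X \<partial>?P) + 2 * (\<Sum>s\<in>?A. (\<integral>X. te s X \<partial>?P) / ?m + (1/2) ^ n) + 1 / real n + 4 * (1/2) ^ n"
    unfolding \<Phi>_def using pe_int te_int by (simp add: P.prob_space Bochner_Integration.integral_sum)
  also have "\<dots> \<le> 3 * (4 * ?C * M * r) + 2 * (\<Sum>s\<in>?A. 3 * r) + r + 4 * r"
    by (intro add_mono mult_left_mono sum_mono te pe small) auto
  also have "\<dots> = 12 * ?C * M * r + (6 * card ?A + 5) * r" by (simp add: algebra_simps)
  also have "\<dots> \<le> 12 * ?C * M * r + (6 * card ?A + 5) * (M * r)"
    using M1 r0 mult_right_mono[OF M1 r0] by (intro add_left_mono mult_left_mono) auto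
  also have "\<dots> = risk_const L * M * r" by (simp add: risk_const_def distrib_right)
  finally have fin: "(\<integral>X. \<Phi> X \<partial>?P) \<le> risk_const L * M * r" .
  have "(\<integral>\<^sup>+ X. wasserstein \<rho> \<mu> (estimator n X) \<partial>?P) \<le> (\<integral>\<^sup>+ X. ennreal (\<Phi> X) \<partial>?P)"
    by (rule nn_integral_mono) (rule W)
  also have "\<dots> = ennreal (\<integral>X. \<Phi> X \<partial>?P)"
    by (rule nn_integral_eq_integral[OF \<Phi>_int]) (simp add: \<Phi>0)
  also have "\<dots> \<le> ennreal (risk_const L * M * r)" using fin by (rule ennreal_leI)
  finally show ?thesis by (simp only: M_def r_def D_def)
qed

text \<open>At \<open>n = 1\<close> the rate is 1 and a bounded loss is enough: duality at level 1
  gives 2 + 4 / 2, below the 5 in \<open>risk_const\<close>.\<close>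

lemma estimator_risk_1:
  assumes "\<mu> \<in> graph_measures d K E"
  shows "(\<integral>\<^sup>+ X. wasserstein \<rho> \<mu> (estimator 1 X) \<partial>(\<Pi>\<^sub>M i\<in>{1..1::nat}. \<mu>)) \<le> ennreal (risk_const L)"
proof -
  have \<mu>: "prob_space \<mu>" "sets \<mu> = sets B" using assms by (auto simp: graph_measures_def space_prob_algebra)
  interpret P: prob_space "\<Pi>\<^sub>M i\<in>{1..1::nat}. \<mu>" by (intro prob_space_PiM \<mu>)
  have \<nu>: "prob_space (return B x0)" "sets (return B x0) = sets B" using prob_space_return[OF x0] by auto
  have "(\<integral>x. f x \<partial>\<mu>) - (\<integral>x. f x \<partial>return B x0) \<le> 2" if "lip_fun B \<rho> 1 f" for f
    using lip_fun_diff_le_1[OF \<mu> \<nu> that] by linarith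
  then have "wasserstein \<rho> \<mu> (return B x0) \<le> ennreal (2 + 4 * (1/2) ^ 1)"
    by (rule b.wasserstein_le_dual[OF \<mu> \<nu>])
  also have "\<dots> \<le> ennreal (risk_const L)" using risk_const_ge[of L] by (intro ennreal_leI) simp
  finally have "(\<integral>\<^sup>+ X. wasserstein \<rho> \<mu> (estimator 1 X) \<partial>(\<Pi>\<^sub>M i\<in>{1..1::nat}. \<mu>)) \<le>
    (\<integral>\<^sup>+ X. ennreal (risk_const L) \<partial>(\<Pi>\<^sub>M i\<in>{1..1::nat}. \<mu>))"
    by (intro nn_integral_mono) (simp add: estimator_def)
  then show ?thesis by (simp only: nn_integral_const P.emeasure_space_1 mult_1_right)
qed

end

theorem theorem2p3:
  fixes K :: nat and d :: "nat \<Rightarrow> nat"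
  assumes "K \<ge> 1" and "\<And>k. k \<in> {1..K} \<Longrightarrow> d k \<ge> 1"
  shows "\<exists>est :: nat \<Rightarrow> (nat \<Rightarrow> nat \<Rightarrow> nat \<Rightarrow> real) \<Rightarrow> (nat \<Rightarrow> nat \<Rightarrow> real) measure.
    (\<forall>n\<ge>1. est n \<in> (\<Pi>\<^sub>M i\<in>{1..n}. blocks d {1..K}) \<rightarrow>\<^sub>M prob_algebra (blocks d {1..K})) \<and>
    (\<forall>L::real. \<exists>C::real. \<forall>n\<ge>1. \<forall>E. \<forall>\<mu>.
       sorted_dag K E \<longrightarrow> (\<forall>k\<in>{1..K}. fully_connected E (pa E k)) \<longrightarrow>
       \<mu> \<in> graph_measures d K E \<longrightarrow> lipschitz_kernels d K E L \<mu> \<longrightarrow>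
       (\<integral>\<^sup>+ X. wasserstein (blocks_dist d {1..K}) \<mu> (est n X) \<partial>(\<Pi>\<^sub>M i\<in>{1..n}. \<mu>))
         \<le> ennreal (C * max 1 (ln (real n)) * real n powr (- 1 / real (d_loc d K E))))"
proof -
  interpret graph_estimator d K by unfold_locales (rule assms(1))
  show ?thesis
  proof (intro exI[of _ estimator] conjI allI impI)
    show "estimator n \<in> (\<Pi>\<^sub>M i\<in>{1..n}. blocks d {1..K}) \<rightarrow>\<^sub>M prob_algebra (blocks d {1..K})" for n
      by (rule estimator_measurable)
    fix L :: real
    show "\<exists>C. \<forall>n\<ge>1. \<forall>E \<mu>. sorted_dag K E \<longrightarrow> (\<forall>k\<in>{1..K}. fully_connected E (pa E k)) \<longrightarrow>
       \<mu> \<in> graph_measures d K E \<longrightarrow> lipschitz_kernels d K E L \<mu> \<longrightarrow>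
       (\<integral>\<^sup>+ X. wasserstein (blocks_dist d {1..K}) \<mu> (estimator n X) \<partial>(\<Pi>\<^sub>M i\<in>{1..n}. \<mu>))
         \<le> ennreal (C * max 1 (ln (real n)) * real n powr (- 1 / real (d_loc d K E)))"
    \<comment> \<open>The witness involves only \<open>L\<close>, \<open>K\<close> and
      \<open>d\<close>: the number of admissible graphs is fixed by \<open>K\<close>.\<close>
    proof (intro exI[of _ "risk_const L"] allI impI)
      fix n :: nat and E \<mu>
      assume n: "n \<ge> 1" and E: "sorted_dag K E" "\<forall>k\<in>{1..K}. fully_connected E (pa E k)"
        and \<mu>: "\<mu> \<in> graph_measures d K E" "lipschitz_kernels d K E L \<mu>"
      show "(\<integral>\<^sup>+ X. wasserstein (blocks_dist d {1..K}) \<mu> (estimator n X) \<partial>(\<Pi>\<^sub>M i\<in>{1..n}. \<mu>))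
         \<le> ennreal (risk_const L * max 1 (ln (real n)) * real n powr (- 1 / real (d_loc d K E)))"
      proof (cases "n = 1")
        case True
        then show ?thesis using estimator_risk_1[OF \<mu>(1), of L] by simp
      next
        case False
        then show ?thesis using n E \<mu> by (intro estimator_risk) (auto simp: graphs_def)
      qed
    qed
  qed
qed

end
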